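(* Assume the Riemann hypothesis. Then there exist constants $N_{0}$ and $c_{0}$ such that for every $N\geqslant N_{0}$, with \[ M=\Bigl[\frac{31}{5\pi}(\ln N+c_{0})\ln\ln\ln N\Bigr], \] the interval $(N,N+M]$ contains indices $n$ and $m$ with $\Delta_{n}=3$ and $\Delta_{m}=-3$.
   Context: Let $\vartheta(t)$ denote the increment of a continuous branch of the argument of $\pi^{-s/2}\Gamma(s/2)$ along the segment joining $s=0.5$ and $s=0.5+it$. For $n\geqslant 0$, the Gram point $t_{n}$ is the unique solution of $\vartheta(t_{n})=(n-1)\pi$ with $\vartheta'(t_{n})>0$. Let $0<\gamma_{1}\leqslant\gamma_{2}\leqslant\cdots$ be the positive ordinates of the zeros of $\zeta(s)$, listed in increasing order with multiplicity. For each $n$ let $m=m(n)$ be the unique integer with $t_{m-1}<\gamma_{n}\leqslant t_{m}$, and put $\Delta_{n}=m-n$. $[x]$ denotes the integer part. *)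

theory Defs
  imports "HOL-Complex_Analysis.Complex_Analysis"
begin

text \<open>The value at the pole \<open>s = 1\<close> is a mere convention that pins the function down there.\<close>

definition zeta :: "complex \<Rightarrow> complex" where
  "zeta = (THE f. f holomorphic_on (- {1}) \<and>
                  (\<forall>s. Re s > 1 \<longrightarrow> f s = (\<Sum>k. of_nat (Suc k) powr (- s))) \<and>
                  f 1 = 0)"

definition Riemann_hypothesis :: bool where
  "Riemann_hypothesis \<longleftrightarrow> (\<forall>s. 0 < Re s \<and> Re s < 1 \<and> zeta s = 0 \<longrightarrow> Re s = 1 / 2)"

definition gamma_factor :: "complex \<Rightarrow> complex" where
  "gamma_factor s = of_real pi powr (- s / 2) * Gamma (s / 2)"

definition is_continuous_arg :: "complex set \<Rightarrow> (complex \<Rightarrow> complex) \<Rightarrow> (complex \<Rightarrow> real) \<Rightarrow> bool" where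
  "is_continuous_arg S f \<phi> \<longleftrightarrow>
     continuous_on S \<phi> \<and> (\<forall>s\<in>S. f s = of_real (cmod (f s)) * cis (\<phi> s))"

definition theta :: "real \<Rightarrow> real" where
  "theta t = (THE d. \<exists>\<phi>.
     is_continuous_arg (closed_segment (1 / 2) (Complex (1 / 2) t)) gamma_factor \<phi> \<and>
     d = \<phi> (Complex (1 / 2) t) - \<phi> (1 / 2))"

text \<open>
  The condition \<open>0 < t\<close> is needed for uniqueness: \<open>theta\<close> is odd, so it also takes
  every value \<open>(n - 1) * pi\<close> at some negative argument, possibly with positive derivative.
\<close>

definition gram_point :: "nat \<Rightarrow> real" where
  "gram_point n = (THE t. 0 < t \<and> theta t = (real n - 1) * pi \<and> deriv theta t > 0)"

text \<open>
  \<open>zeta_ordinate\<close> is indexed from 1; its value at 0 is irrelevant. A value \<open>x\<close> is repeated as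
  often as there are zeros on the line \<open>Im s = x\<close>, counted with multiplicity.
\<close>

definition zeta_ordinate :: "nat \<Rightarrow> real" where
  "zeta_ordinate = (THE \<gamma>.
     \<gamma> 0 = 0 \<and> (\<forall>n\<ge>1. 0 < \<gamma> n) \<and> mono_on {1..} \<gamma> \<and>
     (\<forall>x>0. finite {n. 1 \<le> n \<and> \<gamma> n = x} \<and>
            card {n. 1 \<le> n \<and> \<gamma> n = x} =
              (\<Sum>\<rho> | zeta \<rho> = 0 \<and> Im \<rho> = x. nat (zorder zeta \<rho>))))"

definition gram_index :: "nat \<Rightarrow> nat" where
  "gram_index n = (THE m. 1 \<le> m \<and> gram_point (m - 1) < zeta_ordinate n \<and>
                          zeta_ordinate n \<le> gram_point m)"

definition Delta :: "nat \<Rightarrow> int" where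
  "Delta n = int (gram_index n) - int n"

lemma is_continuous_arg_increment_unique:
  assumes "connected S" "a \<in> S" "b \<in> S" and nz: "\<And>s. s \<in> S \<Longrightarrow> f s \<noteq> 0"
    and \<phi>: "is_continuous_arg S f \<phi>" and \<psi>: "is_continuous_arg S f \<psi>"
  shows "\<phi> b - \<phi> a = \<psi> b - \<psi> a"
proof -
  define h where "h s = (\<phi> s - \<psi> s) / (2 * pi)" for s
  have cont: "continuous_on S h"
    using \<phi> \<psi> unfolding h_def is_continuous_arg_def by (auto intro!: continuous_intros)
  have int: "h s \<in> \<int>" if "s \<in> S" for s
  proof -
    have "of_real (cmod (f s)) * cis (\<phi> s) = of_real (cmod (f s)) * cis (\<psi> s)"
      using \<phi> \<psi> that unfolding is_continuous_arg_def by metis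
    then have "cis (\<phi> s) = cis (\<psi> s)" using nz[OF that] by simp
    then have "cis (\<phi> s - \<psi> s) = 1" by (simp flip: cis_divide)
    then have "cos (\<phi> s - \<psi> s) = 1" by (metis Re_complex_of_real cis.sel(1) of_real_1)
    then obtain k :: int where "\<phi> s - \<psi> s = of_int k * 2 * pi"
      using cos_one_2pi_int by auto
    then show ?thesis by (simp add: h_def)
  qed
  have "h constant_on S"
  proof (rule continuous_discrete_range_constant[OF \<open>connected S\<close> cont])
    fix x assume x: "x \<in> S"
    have "1 \<le> norm (h y - h x)" if "y \<in> S" "h y \<noteq> h x" for y
      using int[OF x] int[OF \<open>y \<in> S\<close>] that(2)
      by (metis Ints_diff Ints_nonzero_abs_ge1 eq_iff_diff_eq_0 real_norm_def)
    then show "\<exists>e>0. \<forall>y. y \<in> S \<and> h y \<noteq> h x \<longrightarrow> e \<le> norm (h y - h x)"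
      by (intro exI[of _ 1]) auto
  qed
  then have "h a = h b" using assms(2,3) by (auto simp: constant_on_def)
  then show ?thesis by (simp add: h_def)
qed

lemma theta_eq: "theta t = Im (ln_Gamma (Complex (1 / 4) (t / 2))) - t / 2 * ln pi"
proof -
  define S where "S = closed_segment (1 / 2) (Complex (1 / 2) t)"
  define L where "L s = ln_Gamma (s / 2) - s / 2 * of_real (ln pi)" for s :: complex
  have re: "Re s = 1 / 2" if "s \<in> S" for s
  proof -
    obtain u where "s = (1 - u) *\<^sub>R (1 / 2) + u *\<^sub>R Complex (1 / 2) t"
      using \<open>s \<in> S\<close> by (auto simp: S_def closed_segment_def)
    then have "Re s = (1 - u) * (1 / 2) + u * (1 / 2)" by simp
    then show ?thesis by (simp add: field_simps)
  qed
  have nonpos: "s / 2 \<notin> \<real>\<^sub>\<le>\<^sub>0" if "s \<in> S" for s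
    using re[OF that] by (auto simp: complex_nonpos_Reals_iff)
  have exp_L: "gamma_factor s = exp (L s)" if "s \<in> S" for s
  proof -
    have "s / 2 \<notin> \<int>\<^sub>\<le>\<^sub>0" using nonpos[OF that] nonpos_Ints_subset_nonpos_Reals by auto
    then have "Gamma (s / 2) = exp (ln_Gamma (s / 2))" by (simp add: Gamma_complex_altdef)
    then show ?thesis
      by (simp add: gamma_factor_def L_def powr_def Ln_of_real add.commute flip: exp_add)
  qed
  have arg: "is_continuous_arg S gamma_factor (\<lambda>s. Im (L s))"
    unfolding is_continuous_arg_def
  proof
    show "continuous_on S (\<lambda>s. Im (L s))"
      unfolding L_def
      by (intro continuous_intros continuous_on_compose2[OF continuous_on_ln_Gamma_complex[of "- \<real>\<^sub>\<le>\<^sub>0"]])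
         (use nonpos in auto)
    show "\<forall>s\<in>S. gamma_factor s = of_real (cmod (gamma_factor s)) * cis (Im (L s))"
      by (auto simp: exp_L exp_eq_polar norm_mult)
  qed
  have nz: "gamma_factor s \<noteq> 0" if "s \<in> S" for s using exp_L[OF that] by simp
  have "theta t = Im (L (Complex (1 / 2) t)) - Im (L (1 / 2))"
    unfolding theta_def S_def[symmetric]
  proof (rule the_equality)
    fix d assume "\<exists>\<phi>. is_continuous_arg S gamma_factor \<phi> \<and> d = \<phi> (Complex (1 / 2) t) - \<phi> (1 / 2)"
    then show "d = Im (L (Complex (1 / 2) t)) - Im (L (1 / 2))"
      using is_continuous_arg_increment_unique[of S "1 / 2" "Complex (1 / 2) t", OF _ _ _ nz _ arg]
      by (auto simp: S_def)
  qed (use arg in blast)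
  moreover have "Im (L (1 / 2)) = 0"
  proof -
    have "ln_Gamma (1 / 4 :: complex) = of_real (ln_Gamma (1 / 4))"
      using ln_Gamma_complex_of_real[of "1 / 4"] by simp
    then show ?thesis by (simp add: L_def)
  qed
  moreover have "Complex (1 / 2) t / 2 = Complex (1 / 4) (t / 2)"
    by (simp add: complex_eq_iff)
  ultimately show ?thesis by (simp add: L_def)
qed

end

theory Submission
  imports Defs "HOL-Real_Asymp.Real_Asymp" "HOL-Number_Theory.Prime_Powers"
begin

text \<open>
  Write \<open>n(u)\<close> for the number of ordinates up to \<open>u\<close>. Under the Riemann hypothesis the boundary value of
  \<open>Im log zeta\<close> on the critical line is \<open>pi n(u) - theta u\<close> up to an additive constant. Averaged against the
  positive kernel \<open>(1 - v^2/L^2) exp (- A cosh v)\<close> over a window of half-length \<open>L = ln ln ln T\<close>, it can be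
  moved to the line \<open>Re s = 3/2\<close>, where it becomes a Dirichlet polynomial over prime powers; moving back
  turns its coefficients into \<open>p^(-1/2)\<close> times a slowly varying weight. Since the sum of \<open>1/p\<close>
  diverges, the mean square of that polynomial is as large as we please, and by almost periodicity
  large values of either sign recur with bounded gaps. So \<open>pi n(u) - theta u\<close> exceeds any given \<open>V\<close>, and falls
  below \<open>- V\<close>, in every window of length \<open>2 L + R\<close>.

  At the \<open>n\<close>-th ordinate \<open>\<gamma>\<close> the displacement is \<open>\<lceil>theta \<gamma> / pi\<rceil> + 1 - n\<close>. It drops by at most one at
  each step, so between a large positive and a later large negative value it hits \<open>3\<close> and \<open>- 3\<close>. Four
  consecutive windows take up about \<open>8 L\<close>, that is \<open>(4 / pi) L ln T\<close> indices, fewer than \<open>31 / (5 pi) L ln T\<close>.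
\<close>

section \<open>The zeta function in the right half-plane\<close>

text \<open>The order of the choices shapes the proof. The recurrence gap \<open>R\<close> must not
  depend on \<open>T\<close>, so the polynomial is fixed first: \<open>V\<close> determines a set of
  primes with large reciprocal sum; these determine \<open>A\<close>, large enough that
  \<open>khat A\<close> at their logarithms stays at least half of \<open>khat A 0\<close>; then
  comes the length \<open>X\<close>. Only the half-length \<open>L\<close> grows with
  \<open>T\<close>. This is possible because cutting the kernel at \<open>L\<close> and the series
  at \<open>X\<close> costs errors that are uniform in \<open>t\<close>. The kernel gets lighter as
  \<open>A\<close> grows, so all sizes are measured in units of \<open>khat A 0\<close>, which
  bounds the mass of the cut kernel. The ordinates are given by a definite description, which has a
  solution only if there are infinitely many of them. The oscillation is therefore stated for the
  counting function, and it supplies this fact itself. Four windows meet \<open>4 / pi\<close> only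
  to leading order, because of \<open>R\<close> and the error terms of \<open>theta\<close>. The
  margin up to \<open>31 / (5 * pi)\<close> absorbs all of this, and with \<open>T \<le> N\<close>
  for the \<open>N\<close>-th ordinate \<open>T\<close> it allows
  \<open>c\<^sub>0 = 0\<close>.\<close>

text \<open>\<open>zeta_num s\<close> is \<open>(s - 1) * zeta s\<close>; the power differences telescope to \<open>- 1\<close> for
  \<open>Re s > 1\<close> and make the series converge for \<open>Re s > 0\<close>.\<close>

definition zeta_term :: "nat \<Rightarrow> complex \<Rightarrow> complex" where
  "zeta_term k s = (s - 1) * of_nat (Suc k) powr (- s) - of_nat (Suc k) powr (1 - s)
     + of_nat (Suc (Suc k)) powr (1 - s)"

definition zeta_num :: "complex \<Rightarrow> complex" where
  "zeta_num s = 1 + (\<Sum>k. zeta_term k s)"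

lemma norm_of_real_powr: "x > 0 \<Longrightarrow> norm (of_real x powr s :: complex) = x powr Re s"
  by (simp add: norm_powr_real_powr)

text \<open>The term is the increment over \<open>{n..n + 1}\<close>, with \<open>n = Suc k\<close>,
  of \<open>f z = (s - 1) * n powr (- s) * (z - n) + z powr (1 - s)\<close>. Its derivative
  \<open>(s - 1) * (n powr (- s) - z powr (- s))\<close> is small by a second mean value bound; this
  gains one power of \<open>n\<close> and pushes convergence down to
  \<open>Re s > 0\<close>.\<close>

lemma norm_zeta_term_le:
  assumes "Re s > 0"
  shows "norm (zeta_term k s) \<le> norm (s - 1) * norm s * real (Suc k) powr (- Re s - 1)"
proof -
  define n where "n = real (Suc k)"
  have n: "n > 0" by (simp add: n_def)
  define S where "S = closed_segment (complex_of_real n) (of_real (n + 1))"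
  have cvS: "convex S" by (simp add: S_def)
  have inS: "\<exists>x. z = of_real x \<and> n \<le> x \<and> x \<le> n + 1" if "z \<in> S" for z
  proof -
    obtain u where u: "0 \<le> u" "u \<le> 1" "z = (1 - u) *\<^sub>R complex_of_real n + u *\<^sub>R of_real (n + 1)"
      using \<open>z \<in> S\<close> unfolding S_def closed_segment_def by blast
    then have "z = of_real (n + u)" by (simp add: scaleR_conv_of_real algebra_simps)
    with u show ?thesis by (intro exI[of _ "n + u"]) auto
  qed
  have ends: "of_real n \<in> S" "of_real (n + 1) \<in> S" by (auto simp: S_def)
  define B where "B = norm s * n powr (- Re s - 1)"
  have B0: "B \<ge> 0" by (simp add: B_def)
  have est: "norm (of_real n powr (- s) - z powr (- s)) \<le> B" if zS: "z \<in> S" for z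
  proof -
    have "norm (z powr (- s) - of_real n powr (- s)) \<le> B * norm (z - of_real n)"
    proof (rule field_differentiable_bound[OF cvS _ _ zS ends(1), where f' = "\<lambda>z. - s * z powr (- s - 1)"])
      fix w assume "w \<in> S"
      then obtain x where x: "w = of_real x" "n \<le> x" using inS by blast
      then have xp: "x > 0" using n by linarith
      show "((\<lambda>z. z powr - s) has_field_derivative - s * w powr (- s - 1)) (at w within S)"
        using xp x by (intro has_field_derivative_powr[THEN has_field_derivative_at_within])
          (auto simp: complex_nonpos_Reals_iff)
      have "x powr (- Re s - 1) \<le> n powr (- Re s - 1)"
        using assms n x by (intro powr_mono2') auto
      then show "norm (- s * w powr (- s - 1)) \<le> B"
        using xp by (simp add: x norm_mult norm_of_real_powr B_def mult_left_mono)
    qed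
    moreover obtain x where x: "z = of_real x" "n \<le> x" "x \<le> n + 1" using inS[OF zS] by blast
    have "norm (z - of_real n) = \<bar>x - n\<bar>"
      unfolding x by (metis norm_of_real of_real_diff)
    then have "norm (z - of_real n) \<le> 1" using x by simp
    ultimately have "norm (z powr (- s) - of_real n powr (- s)) \<le> B * 1"
      using B0 by (meson mult_left_mono order_trans)
    then show ?thesis by (simp add: norm_minus_commute)
  qed
  define f where "f = (\<lambda>z. (s - 1) * of_real n powr (- s) * (z - of_real n) + z powr (1 - s))"
  have "norm (f (of_real (n + 1)) - f (of_real n)) \<le> (norm (s - 1) * B) * norm (of_real (n+1) - of_real n :: complex)"
  proof (rule field_differentiable_bound[OF cvS _ _ ends(2,1), where f' = "\<lambda>z. (s - 1) * (of_real n powr (- s) - z powr (- s))"])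
    fix w assume wS: "w \<in> S"
    then obtain x where x: "w = of_real x" "n \<le> x" using inS by blast
    then have xp: "x > 0" using n by linarith
    have "((\<lambda>z. z powr (1 - s)) has_field_derivative (1 - s) * w powr (1 - s - 1)) (at w within S)"
      using xp x by (intro has_field_derivative_powr[THEN has_field_derivative_at_within])
          (auto simp: complex_nonpos_Reals_iff)
    from DERIV_add[OF DERIV_cmult[OF DERIV_diff[OF DERIV_ident DERIV_const]] this]
    show "(f has_field_derivative (s - 1) * (of_real n powr (- s) - w powr (- s))) (at w within S)"
      unfolding f_def by (rule DERIV_cong) (simp add: algebra_simps)
    show "norm ((s - 1) * (of_real n powr (- s) - w powr (- s))) \<le> norm (s - 1) * B"
      using est[OF wS] by (simp add: norm_mult mult_left_mono)
  qed
  moreover have "f (of_real (n + 1)) - f (of_real n) = zeta_term k s"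
    by (simp add: f_def zeta_term_def n_def algebra_simps)
  ultimately show ?thesis by (simp add: B_def n_def mult.assoc)
qed

lemma summable_Suc_powr: "a < -1 \<Longrightarrow> summable (\<lambda>k. real (Suc k) powr a)"
  using summable_real_powr_iff[of a] by (subst summable_Suc_iff) simp

lemma summable_zeta_term:
  assumes "Re s > 0"
  shows "summable (\<lambda>k. zeta_term k s)"
proof (rule summable_comparison_test')
  show "summable (\<lambda>k. norm (s - 1) * norm s * real (Suc k) powr (- Re s - 1))"
    using assms by (intro summable_mult summable_Suc_powr) auto
qed (rule norm_zeta_term_le[OF assms])

lemma holomorphic_zeta_term: "zeta_term k holomorphic_on A"
  unfolding zeta_term_def by (intro holomorphic_intros)

lemma holomorphic_zeta_num: "zeta_num holomorphic_on {s. Re s > 0}"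
proof (rule holomorphic_uniform_sequence[where f = "\<lambda>n s. 1 + (\<Sum>k<n. zeta_term k s)"])
  show "open {s. Re s > 0}" by (rule open_halfspace_Re_gt)
  show "(\<lambda>s. 1 + (\<Sum>k<n. zeta_term k s)) holomorphic_on {s. Re s > 0}" for n
    by (intro holomorphic_intros holomorphic_zeta_term)
  fix x :: complex assume x: "x \<in> {s. Re s > 0}"
  \<comment> \<open>On the ball of this radius the real part stays at least \<open>d\<close>, so one
    convergent majorant serves all its points.\<close>
  define d where "d = Re x / 2"
  have d: "d > 0" using x by (simp add: d_def)
  have re: "Re y \<ge> d \<and> norm y \<le> norm x + d" if "y \<in> cball x d" for y
  proof -
    have *: "norm (x - y) \<le> d" using that by (simp add: dist_norm)
    have "\<bar>Re (x - y)\<bar> \<le> d" using abs_Re_le_cmod[of "x - y"] * by linarith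
    moreover have "norm y \<le> norm x + norm (x - y)"
      by (metis norm_minus_commute norm_triangle_sub)
    moreover have "Re x = 2 * d" by (simp add: d_def)
    ultimately show ?thesis using * by simp
  qed
  have "uniform_limit (cball x d) (\<lambda>n s. (\<Sum>k<n. zeta_term k s)) (\<lambda>s. \<Sum>k. zeta_term k s) sequentially"
  proof (rule Weierstrass_m_test)
    show "norm (zeta_term k y) \<le> (norm x + d + 1) * (norm x + d) * real (Suc k) powr (- d - 1)"
      if "y \<in> cball x d" for k y
    proof -
      have "norm (zeta_term k y) \<le> norm (y - 1) * norm y * real (Suc k) powr (- Re y - 1)"
        using re[OF that] d by (intro norm_zeta_term_le) auto
      also have "\<dots> \<le> (norm x + d + 1) * (norm x + d) * real (Suc k) powr (- d - 1)"
      proof (intro mult_mono)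
        show "norm (y - 1) \<le> norm x + d + 1"
          using re[OF that] norm_triangle_ineq4[of y 1] by simp
        show "real (Suc k) powr (- Re y - 1) \<le> real (Suc k) powr (- d - 1)"
          using re[OF that] by (intro powr_mono) auto
      qed (use re[OF that] d in auto)
      finally show ?thesis .
    qed
    show "summable (\<lambda>k. (norm x + d + 1) * (norm x + d) * real (Suc k) powr (- d - 1))"
      using d by (intro summable_mult summable_Suc_powr) auto
  qed
  then have "uniform_limit (cball x d) (\<lambda>n s. 1 + (\<Sum>k<n. zeta_term k s)) zeta_num sequentially"
    unfolding zeta_num_def by (intro uniform_limit_add uniform_limit_const)
  moreover have "cball x d \<subseteq> {s. Re s > 0}" using re d by force
  ultimately show "\<exists>d>0. cball x d \<subseteq> {s. 0 < Re s} \<and>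
         uniform_limit (cball x d) (\<lambda>n s. 1 + (\<Sum>k<n. zeta_term k s)) zeta_num sequentially"
    using d by blast
qed

lemma sum_zeta_term:
  "(\<Sum>k<m. zeta_term k s) =
     (s - 1) * (\<Sum>k<m. of_nat (Suc k) powr (- s)) + of_nat (Suc m) powr (1 - s) - 1"
  by (induction m) (simp_all add: zeta_term_def algebra_simps)

lemma summable_Suc_powr_complex:
  assumes "Re s > 1"
  shows "summable (\<lambda>k. of_nat (Suc k) powr (- s) :: complex)"
proof (rule summable_comparison_test'[OF summable_Suc_powr[of "- Re s"], where N = 0])
  show "norm (of_nat (Suc k) powr (- s) :: complex) \<le> real (Suc k) powr (- Re s)" for k
    using norm_of_real_powr[of "real (Suc k)" "-s"] by simp
qed (use assms in auto)

lemma zeta_num_eq_Re_gt_1: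
  assumes "Re s > 1"
  shows "zeta_num s = (s - 1) * (\<Sum>k. of_nat (Suc k) powr (- s))"
proof -
  have "(\<lambda>m. of_nat (Suc m) powr (1 - s) :: complex) \<longlonglongrightarrow> 0"
  proof (rule tendsto_norm_zero_cancel)
    have "(\<lambda>m. real m powr (1 - Re s)) \<longlonglongrightarrow> 0"
      by (rule tendsto_neg_powr[OF _ filterlim_real_sequentially]) (use assms in auto)
    then have "(\<lambda>m. real (Suc m) powr (1 - Re s)) \<longlonglongrightarrow> 0" by (rule LIMSEQ_Suc)
    then show "(\<lambda>m. norm (of_nat (Suc m) powr (1 - s) :: complex)) \<longlonglongrightarrow> 0"
      using norm_of_real_powr[of "real (Suc _)" "1-s"] by simp
  qed
  moreover have "(\<lambda>m. \<Sum>k<m. of_nat (Suc k) powr (- s)) \<longlonglongrightarrow> (\<Sum>k. of_nat (Suc k) powr (- s) :: complex)"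
    using summable_Suc_powr_complex[OF assms] by (rule summable_LIMSEQ)
  ultimately have "(\<lambda>m. \<Sum>k<m. zeta_term k s) \<longlonglongrightarrow> (s - 1) * (\<Sum>k. of_nat (Suc k) powr (- s)) + 0 - 1"
    unfolding sum_zeta_term by (intro tendsto_intros)
  moreover have "(\<lambda>m. \<Sum>k<m. zeta_term k s) \<longlonglongrightarrow> (\<Sum>k. zeta_term k s)"
    using assms by (intro summable_LIMSEQ summable_zeta_term) auto
  ultimately show ?thesis unfolding zeta_num_def using LIMSEQ_unique by fastforce
qed

text \<open>Quadratic growth is enough: after division by \<open>s - 1\<close> it bounds zeta
  linearly, and only the logarithm of that bound enters \<open>logz_bound\<close>.\<close>

lemma norm_zeta_num_le:
  obtains C where "\<And>s. Re s \<ge> 1/2 \<Longrightarrow> norm (zeta_num s) \<le> 1 + C * norm (s - 1) * norm s" "C \<ge> 0"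
proof
  define C where "C = (\<Sum>k. real (Suc k) powr (- 3/2))"
  have sm: "summable (\<lambda>k. real (Suc k) powr (- 3/2))" by (rule summable_Suc_powr) auto
  show "C \<ge> 0" unfolding C_def by (rule suminf_nonneg[OF sm]) auto
  fix s :: complex assume s: "Re s \<ge> 1/2"
  have le: "norm (zeta_term k s) \<le> norm (s - 1) * norm s * real (Suc k) powr (- 3/2)" for k
  proof -
    have "norm (zeta_term k s) \<le> norm (s - 1) * norm s * real (Suc k) powr (- Re s - 1)"
      using s by (intro norm_zeta_term_le) auto
    also have "\<dots> \<le> norm (s - 1) * norm s * real (Suc k) powr (- 3/2)"
      using s by (intro mult_left_mono powr_mono) auto
    finally show ?thesis .
  qed
  have "norm (\<Sum>k. zeta_term k s) \<le> (\<Sum>k. norm (s - 1) * norm s * real (Suc k) powr (- 3/2))"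
    by (rule norm_suminf_le[OF le]) (intro summable_mult sm)
  also have "\<dots> = norm (s - 1) * norm s * C" unfolding C_def by (rule suminf_mult[OF sm])
  finally have *: "norm (\<Sum>k. zeta_term k s) \<le> norm (s - 1) * norm s * C" .
  show "norm (zeta_num s) \<le> 1 + C * norm (s - 1) * norm s"
    using * norm_triangle_ineq[of 1 "\<Sum>k. zeta_term k s"] unfolding zeta_num_def
    by (simp add: mult.commute mult.left_commute)
qed

section \<open>The functional equation\<close>

lemma Digamma_reflection:
  fixes z :: complex
  assumes "z \<notin> \<int>"
  shows "(Digamma (1 - z) - Digamma z) * sin (of_real pi * z) = of_real pi * cos (of_real pi * z)"
proof -
  have nz: "w \<notin> \<int>\<^sub>\<le>\<^sub>0" "1 - w \<notin> \<int>\<^sub>\<le>\<^sub>0" if "w \<notin> \<int>" for w :: complex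
    using that nonpos_Ints_subset_Ints Ints_diff[OF Ints_1, of "1 - w"] by auto
  have s0: "sin (of_real pi * w) \<noteq> 0" if "w \<notin> \<int>" for w :: complex
    using that by (subst sin_eq_0) (auto simp: mult.commute)
  let ?f = "\<lambda>w::complex. Gamma w * Gamma (1 - w) * sin (of_real pi * w)"
  \<comment> \<open>By the reflection formula this product is constant off the integers; its
    logarithmic derivative is the claim.\<close>
  have "(?f has_field_derivative 0) (at z)"
  proof (rule has_field_derivative_transform_within_open)
    show "((\<lambda>_. of_real pi) has_field_derivative 0) (at z)" by simp
    show "open (- \<int> :: complex set)" using closed_Ints by auto
    show "of_real pi = ?f w" if "w \<in> - \<int>" for w
      using s0[of w] that Gamma_reflection_complex[of w] by simp
  qed (use assms in auto)
  moreover have "(?f has_field_derivative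
      Gamma z * Gamma (1 - z) * ((Digamma z - Digamma (1 - z)) * sin (of_real pi * z) + of_real pi * cos (of_real pi * z))) (at z)"
    using nz[OF assms] by (auto intro!: derivative_eq_intros simp: algebra_simps)
  ultimately have "Gamma z * Gamma (1 - z) * ((Digamma z - Digamma (1 - z)) * sin (of_real pi * z) + of_real pi * cos (of_real pi * z)) = 0"
    using DERIV_unique by blast
  then have "(Digamma z - Digamma (1 - z)) * sin (of_real pi * z) + of_real pi * cos (of_real pi * z) = 0"
    using nz[OF assms] by (auto simp: Gamma_eq_zero_iff)
  then show ?thesis by (simp add: algebra_simps add_eq_0_iff)
qed

text \<open>In substance the expansion of \<open>coth (x / 2)\<close>: at the imaginary point
  \<open>z = \<i> * x / (2 * pi)\<close> the reflection formula for \<open>Digamma\<close> has a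
  hyperbolic right side, while the left side is a limit of partial fractions.\<close>

lemma sums_inverse_exp_minus_1:
  fixes x :: real
  assumes x: "x > 0"
  shows "(\<lambda>n. 2 * x / (4 * pi^2 * (real n + 1)^2 + x^2)) sums (1 / (exp x - 1) - 1 / x + 1 / 2)"
proof -
  define y where "y = x / (2 * pi)"
  define z where "z = Complex 0 y"
  have y: "y > 0" using x by (simp add: y_def)
  have zi: "z \<notin> \<int>" using y by (auto simp: z_def Ints_def complex_eq_iff)
  have z0: "z \<noteq> 0" "1 - z \<noteq> 0" using zi by auto
  have nz: "z + of_nat n \<noteq> 0" "1 - z + of_nat n \<noteq> 0" for n using y by (auto simp: z_def complex_eq_iff)
  let ?g = "\<lambda>n. 2 * y / ((real n + 1)^2 + y^2)"
  \<comment> \<open>The summands are paired with an offset of one, \<open>1 - z + m\<close> against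
    \<open>z + (m + 1)\<close>, because these are conjugate and have a real product. The unpaired
    ends are \<open>1 / z\<close> and the vanishing \<open>inverse (z + of_nat m)\<close>.\<close>
  have part: "(\<Sum>n<m. inverse (1 - z + of_nat n)) - (\<Sum>n<m. inverse (z + of_nat n))
      = \<i> * of_real (\<Sum>n<m. ?g n) - 1 / z + inverse (z + of_nat m)" for m
  proof (induction m)
    case (Suc m)
    have "inverse (1 - z + of_nat m) - inverse (z + of_nat (Suc m)) = \<i> * of_real (?g m)"
    proof -
      have "(1 - z + of_nat m) * (z + of_nat (Suc m)) = of_real ((real m + 1)^2 + y^2)"
        by (simp add: z_def complex_eq_iff power2_eq_square algebra_simps)
      moreover have "z + of_nat (Suc m) - (1 - z + of_nat m) = \<i> * of_real (2 * y)"
        by (simp add: z_def complex_eq_iff)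
      moreover have "inverse (1 - z + of_nat m) - inverse (z + of_nat (Suc m)) =
        (z + of_nat (Suc m) - (1 - z + of_nat m)) / ((1 - z + of_nat m) * (z + of_nat (Suc m)))"
        using nz(2)[of m] nz(1)[of "Suc m"] by (simp add: field_simps)
      ultimately show ?thesis by simp
    qed
    with Suc show ?case by (simp add: algebra_simps)
  qed (use z0 in \<open>simp add: field_simps\<close>)
  \<comment> \<open>The divergent \<open>ln m\<close> cancels between the two limits.\<close>
  have "(\<lambda>m. (of_real (ln (real m)) - (\<Sum>n<m. inverse (z + of_nat n)))
         - (of_real (ln (real m)) - (\<Sum>n<m. inverse (1 - z + of_nat n)))) \<longlonglongrightarrow> Digamma z - Digamma (1 - z)"
    by (intro tendsto_diff Digamma_LIMSEQ z0)
  then have L1: "(\<lambda>m. (\<Sum>n<m. inverse (1 - z + of_nat n)) - (\<Sum>n<m. inverse (z + of_nat n))) \<longlonglongrightarrow> Digamma z - Digamma (1 - z)"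
    by (simp add: algebra_simps)
  have L2: "(\<lambda>m. inverse (z + of_nat m)) \<longlonglongrightarrow> 0"
    by (rule filterlim_compose[OF tendsto_inverse_0])
       (rule tendsto_add_filterlim_at_infinity[OF tendsto_const tendsto_of_nat])
  define e where "e = exp x"
  have e1: "e > 1" using x by (simp add: e_def)
  have "Digamma z - Digamma (1 - z) = \<i> * of_real (pi * (e + 1) / (e - 1))"
  proof -
    have pz: "of_real pi * z = \<i> * of_real (x / 2)"
      by (simp add: z_def y_def complex_eq_iff)
    define q where "q = exp (x / 2)"
    have q: "q > 1" "e = q * q" using x by (auto simp: q_def e_def simp flip: exp_add)
    have "exp (\<i> * (\<i> * of_real (x / 2))) = complex_of_real (1 / q)"
      by (simp add: q_def exp_of_real[symmetric] exp_minus inverse_eq_divide flip: mult.assoc)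
    moreover have "exp (- (\<i> * (\<i> * of_real (x / 2)))) = complex_of_real q"
      by (simp add: q_def exp_of_real[symmetric] flip: mult.assoc)
    ultimately have sc: "sin (of_real pi * z) = (of_real (1/q) - of_real q) / (2 * \<i>)"
         "cos (of_real pi * z) = (of_real (1/q) + of_real q) / 2"
      unfolding pz sin_exp_eq cos_exp_eq by simp_all
    have qq: "1/q - q \<noteq> 0" proof -
      have "1/q < 1" using q by simp
      then show ?thesis using q by linarith
    qed
    have eq: "(Digamma (1 - z) - Digamma z) * ((of_real (1/q) - of_real q) / (2 * \<i>)) = of_real pi * ((of_real (1/q) + of_real q) / 2)"
      using Digamma_reflection[OF zi] unfolding sc .
    have cancel: "X * P = \<i> * (R * S)" if "X * (P / (2 * \<i>)) = R * (S / 2)" for X P R S :: complex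
    proof -
      have "(X * P) / (2 * \<i>) = (R * S) / 2" using that by (simp only: times_divide_eq_right)
      then have "X * P = (R * S) / 2 * (2 * \<i>)" by (subst (asm) nonzero_divide_eq_eq) auto
      then show ?thesis by simp
    qed
    have "(Digamma (1 - z) - Digamma z) * of_real (1/q - q) = \<i> * of_real (pi * (1/q + q))"
      using cancel[OF eq] by simp
    then have "Digamma (1 - z) - Digamma z = \<i> * of_real (pi * (1/q + q)) / of_real (1/q - q)"
      using qq by (simp add: field_simps del: of_real_diff of_real_divide)
    also have "\<dots> = \<i> * of_real (pi * (1/q + q) / (1/q - q))" by simp
    also have "pi * (1/q + q) / (1/q - q) = - (pi * (e + 1) / (e - 1))"
      using q qq e1 by (simp add: field_simps)
    finally have "Digamma (1 - z) - Digamma z = - (\<i> * of_real (pi * (e + 1) / (e - 1)))"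
      by (simp only: of_real_minus mult_minus_right)
    then show ?thesis by (simp only: minus_diff_eq[symmetric, of "Digamma z"] minus_minus)
  qed
  with L1 have "(\<lambda>m. \<i> * of_real (\<Sum>n<m. ?g n) - 1 / z + inverse (z + of_nat m)) \<longlonglongrightarrow> \<i> * of_real (pi * (e + 1) / (e - 1))"
    unfolding part by simp
  from tendsto_Im[OF tendsto_add[OF tendsto_diff[OF this L2] tendsto_const[of "1/z"]]]
  have "(\<lambda>m. \<Sum>n<m. ?g n) \<longlonglongrightarrow> pi * (e + 1) / (e - 1) - 1 / y"
    using \<open>y > 0\<close> e1 less_imp_neq[OF e1] by (simp add: z_def Im_divide power2_eq_square)
  then have "?g sums (pi * (e + 1) / (e - 1) - 1 / y)" unfolding sums_def .
  then have "(\<lambda>n. 1 / (2 * pi) * ?g n) sums (1 / (2 * pi) * (pi * (e + 1) / (e - 1) - 1 / y))"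
    by (rule sums_mult)
  moreover have "1 / (2 * pi) * ?g n = 2 * x / (4 * pi^2 * (real n + 1)^2 + x^2)" for n
  proof -
    have "(real n + 1)^2 + y^2 > 0" using y by (intro add_nonneg_pos) auto
    moreover have "4 * pi^2 * (real n + 1)^2 + x^2 = 4 * pi^2 * ((real n + 1)^2 + y^2)"
      by (simp add: y_def field_simps power2_eq_square)
    ultimately show ?thesis by (simp add: y_def field_simps power2_eq_square)
  qed
  moreover have "1 / (2 * pi) * (pi * (e + 1) / (e - 1) - 1 / y) = 1 / (exp x - 1) - 1 / x + 1 / 2"
    using e1 x unfolding e_def[symmetric] y_def by (simp add: field_simps)
  ultimately show ?thesis by simp
qed

text \<open>The gap between the integral of \<open>v powr (- a)\<close> over \<open>{n..n + 1}\<close> and the value at the right end;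
  the gaps add up to \<open>- zeta a\<close>.\<close>

definition zeta_gap :: "real \<Rightarrow> nat \<Rightarrow> real" where
  "zeta_gap a n = (real (Suc n) powr (1 - a) - real n powr (1 - a)) / (1 - a) - real (Suc n) powr (- a)"

text \<open>Up to the factor \<open>1 - a\<close>, the partial sums of \<open>zeta_gap a\<close> and
  those defining \<open>zeta_num\<close> differ only by
  \<open>Suc m powr (1 - a) - m powr (1 - a)\<close>, which tends to 0. All these quantities are
  real, hence so is the limit.\<close>

lemma zeta_gap_sums:
  assumes a: "0 < a" "a < 1"
  shows "zeta_gap a sums (Re (zeta_num (of_real a)) / (1 - a))"
    and "zeta_num (of_real a) \<in> \<real>"
proof -
  have part: "(\<Sum>n<m. zeta_gap a n) = real m powr (1 - a) / (1 - a) - (\<Sum>k<m. real (Suc k) powr (- a))" for m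
    by (induction m) (use a in \<open>simp_all add: zeta_gap_def diff_divide_distrib\<close>)
  have d0: "(\<lambda>m. real (Suc m) powr (1 - a) - real m powr (1 - a)) \<longlonglongrightarrow> 0"
    using a by real_asymp
  have "(\<lambda>m. \<Sum>k<m. zeta_term k (of_real a)) \<longlonglongrightarrow> (\<Sum>k. zeta_term k (of_real a))"
    using a by (intro summable_LIMSEQ summable_zeta_term) auto
  from tendsto_add[OF tendsto_const this, of 1]
  have L: "(\<lambda>m. 1 + (\<Sum>k<m. zeta_term k (of_real a))) \<longlonglongrightarrow> zeta_num (of_real a)"
    by (simp add: zeta_num_def)
  have eq: "1 + (\<Sum>k<m. zeta_term k (of_real a)) =
     of_real ((1 - a) * (\<Sum>n<m. zeta_gap a n) + (real (Suc m) powr (1 - a) - real m powr (1 - a)))" for m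
  proof -
    have pw: "of_nat (Suc k) powr (complex_of_real b) = complex_of_real (real (Suc k) powr b)" for k b
      by (metis of_nat_0_le_iff of_real_of_nat_eq powr_of_real)
    have "1 + (\<Sum>k<m. zeta_term k (of_real a)) =
       (of_real a - 1) * (\<Sum>k<m. of_nat (Suc k) powr (of_real (- a))) + of_nat (Suc m) powr (of_real (1 - a))"
      by (simp add: sum_zeta_term del: of_nat_Suc)
    also have "\<dots> = of_real ((a - 1) * (\<Sum>k<m. real (Suc k) powr (- a)) + real (Suc m) powr (1 - a))"
      unfolding pw by simp
    also have "(a - 1) * (\<Sum>k<m. real (Suc k) powr (- a)) + real (Suc m) powr (1 - a) =
       (1 - a) * (\<Sum>n<m. zeta_gap a n) + (real (Suc m) powr (1 - a) - real m powr (1 - a))"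
      unfolding part using a by (simp add: field_simps)
    finally show ?thesis .
  qed
  have R: "(\<lambda>m. (1 - a) * (\<Sum>n<m. zeta_gap a n) + (real (Suc m) powr (1 - a) - real m powr (1 - a))) \<longlonglongrightarrow> Re (zeta_num (of_real a))"
    using tendsto_Re[OF L] unfolding eq by simp
  from tendsto_divide[OF tendsto_diff[OF R d0] tendsto_const[of "1 - a"]] a
  show "zeta_gap a sums (Re (zeta_num (of_real a)) / (1 - a))" unfolding sums_def by simp
  from tendsto_of_real[OF R, where 'a = complex] L have "zeta_num (of_real a) = of_real (Re (zeta_num (of_real a)))"
    unfolding eq using LIMSEQ_unique by blast
  then show "zeta_num (of_real a) \<in> \<real>" by (metis Reals_of_real)
qed

lemma has_integral_powr_minus_unit:
  fixes a :: real
  assumes a: "0 < a" "a < 1"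
  shows "((\<lambda>v. v powr (- a) - real (Suc n) powr (- a)) has_integral zeta_gap a n) {real n..real n + 1}"
proof -
  let ?F = "\<lambda>v. v powr (1 - a) / (1 - a) - v * real (Suc n) powr (- a)"
  have "((\<lambda>v. v powr (- a) - real (Suc n) powr (- a)) has_integral ?F (real n + 1) - ?F (real n)) {real n..real n + 1}"
  \<comment> \<open>The derivative is taken in the open interval only: for \<open>n = 0\<close> the
    integrand blows up towards the left end.\<close>
  proof (rule fundamental_theorem_of_calculus_interior)
    show "continuous_on {real n..real n + 1} ?F"
      using a by (intro continuous_intros continuous_on_powr') auto
    fix v assume v: "v \<in> {real n<..<real n + 1}"
    then have "v > 0" by auto
    then show "(?F has_vector_derivative v powr (- a) - real (Suc n) powr (- a)) (at v)"
      unfolding has_real_derivative_iff_has_vector_derivative[symmetric]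
      using a by (auto intro!: derivative_eq_intros)
  qed simp
  also have "?F (real n + 1) - ?F (real n) = zeta_gap a n"
    by (simp add: zeta_gap_def diff_divide_distrib algebra_simps)
  finally show ?thesis .
qed

text \<open>The left end is dropped because for \<open>n = 0\<close> the convention
  \<open>0 powr (- a) = 0\<close> would make the integrands below negative there.\<close>

lemma has_integral_Icc_iff_Ioc:
  fixes f :: "real \<Rightarrow> real"
  shows "(f has_integral y) {a..b} \<longleftrightarrow> (f has_integral y) {a<..b}"
  by (rule has_integral_spike_set_eq; rule negligible_subset[of "{a}"]) auto

lemma zeta_gap_nonneg:
  assumes a: "0 < a" "a < 1"
  shows "zeta_gap a n \<ge> 0"
proof (rule has_integral_nonneg)
  show "((\<lambda>v. v powr (- a) - real (Suc n) powr (- a)) has_integral zeta_gap a n) {real n<..real n + 1}"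
    using has_integral_powr_minus_unit[OF a, of n] by (simp only: has_integral_Icc_iff_Ioc)
qed (use a in \<open>auto intro!: powr_mono2'\<close>)

text \<open>Both expansions of \<open>1 / x - 1 / (exp x - 1)\<close> below are of the form required here, and
  equating the two resulting values is the functional equation.\<close>

lemma mellin_zeta_gap:
  fixes c I :: "_ \<Rightarrow> real \<Rightarrow> real" and H :: "real \<Rightarrow> real"
  assumes meas: "(\<lambda>p. c (fst p) (snd p)) \<in> borel_measurable (borel \<Otimes>\<^sub>M borel)"
    and nn: "\<And>v x. 0 \<le> v \<Longrightarrow> 0 < x \<Longrightarrow> 0 \<le> c v x"
    and anti: "\<And>v w x. 0 \<le> v \<Longrightarrow> v \<le> w \<Longrightarrow> 0 < x \<Longrightarrow> c w x \<le> c v x"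
    and mel: "\<And>v. 0 < v \<Longrightarrow> (\<integral>\<^sup>+x. ennreal (c v x * x powr (s - 1)) * indicator {0<..} x \<partial>lborel) = ennreal (m * v powr (- a))"
    and m: "m \<ge> 0" and a: "0 < a" "a < 1"
    and int: "\<And>n x. 0 < x \<Longrightarrow> ((\<lambda>v. c v x) has_integral I n x) {real n..real n + 1}"
    and H: "\<And>x. 0 < x \<Longrightarrow> (\<lambda>n::nat. I n x - c (real n + 1) x) sums H x"
  shows "(\<integral>\<^sup>+x. ennreal (H x * x powr (s - 1)) * indicator {0<..} x \<partial>lborel)
     = ennreal (m * (Re (zeta_num (of_real a)) / (1 - a)))"
proof -
  note [measurable] = measurable_compose[OF measurable_Pair meas, unfolded fst_conv snd_conv]
  \<comment> \<open>The kernel minus its value at the right end of the cell. By monotonicity it is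
    nonnegative, so Tonelli's theorem justifies every interchange below.\<close>
  let ?d = "\<lambda>n v x. ennreal (c v x - c (real n + 1) x) * indicator {real n<..real n + 1} v"
  let ?w = "\<lambda>x. ennreal (x powr (s - 1)) * indicator {0<..} x"
  have inner: "ennreal (I n x - c (real n + 1) x) = (\<integral>\<^sup>+v. ?d n v x \<partial>lborel)"
    and inn: "I n x - c (real n + 1) x \<ge> 0" if x: "0 < x" for n :: nat and x
  proof -
    have "((\<lambda>v. c v x - c (real n + 1) x) has_integral (I n x - c (real n + 1) x)) {real n..real n + 1}"
      using has_integral_diff[OF int[OF x] has_integral_const_real[of "c (real n + 1) x" "real n" "real n + 1"]] by simp
    then have *: "((\<lambda>v. c v x - c (real n + 1) x) has_integral (I n x - c (real n + 1) x)) {real n<..real n + 1}"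
      by (simp only: has_integral_Icc_iff_Ioc)
    have pos: "0 \<le> c v x - c (real n + 1) x" if "v \<in> {real n<..real n + 1}" for v
      using that anti[of v "real n + 1" x] x by auto
    show "ennreal (I n x - c (real n + 1) x) = (\<integral>\<^sup>+v. ?d n v x \<partial>lborel)"
      using nn_integral_has_integral_lebesgue'[OF pos *] by simp
    show "I n x - c (real n + 1) x \<ge> 0" by (rule has_integral_nonneg[OF * pos])
  qed
  \<comment> \<open>For fixed \<open>v\<close> the Mellin transform of the difference is the
    difference of two known transforms; both are finite, which makes the subtraction of extended
    reals legitimate.\<close>
  have outer: "(\<integral>\<^sup>+x. ?d n v x * ?w x \<partial>lborel)
      = ennreal (m * (v powr (- a) - real (Suc n) powr (- a))) * indicator {real n<..real n + 1} v" for n v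
  proof (cases "v \<in> {real n<..real n + 1}")
    case True
    then have v: "v > 0" by auto
    have "(\<integral>\<^sup>+x. ?d n v x * ?w x \<partial>lborel) =
       (\<integral>\<^sup>+x. ennreal (c v x * x powr (s - 1)) * indicator {0<..} x
             - ennreal (c (real n + 1) x * x powr (s - 1)) * indicator {0<..} x \<partial>lborel)"
    proof (rule nn_integral_cong)
      fix x :: real
      show "?d n v x * ?w x = ennreal (c v x * x powr (s - 1)) * indicator {0<..} x
             - ennreal (c (real n + 1) x * x powr (s - 1)) * indicator {0<..} x"
      proof (cases "x > 0")
        case x: True
        have "ennreal (c v x - c (real n + 1) x) * ennreal (x powr (s - 1)) = ennreal ((c v x - c (real n + 1) x) * x powr (s - 1))"
          using anti[of v "real n + 1" x] True x v by (intro ennreal_mult[symmetric]) auto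
        also have "(c v x - c (real n + 1) x) * x powr (s - 1) = c v x * x powr (s - 1) - c (real n + 1) x * x powr (s - 1)"
          by (simp add: algebra_simps)
        also have "ennreal \<dots> = ennreal (c v x * x powr (s - 1)) - ennreal (c (real n + 1) x * x powr (s - 1))"
          using nn[of "real n + 1" x] x by (intro ennreal_minus[symmetric]) auto
        finally show ?thesis using True x by simp
      qed auto
    qed
    also have "\<dots> = (\<integral>\<^sup>+x. ennreal (c v x * x powr (s - 1)) * indicator {0<..} x \<partial>lborel)
             - (\<integral>\<^sup>+x. ennreal (c (real n + 1) x * x powr (s - 1)) * indicator {0<..} x \<partial>lborel)"
    proof (rule nn_integral_diff)
      show "(\<integral>\<^sup>+x. ennreal (c (real n + 1) x * x powr (s - 1)) * indicator {0<..} x \<partial>lborel) \<noteq> \<infinity>"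
        by (subst mel) auto
      show "AE x in lborel. ennreal (c (real n + 1) x * x powr (s - 1)) * indicator {0<..} x
         \<le> ennreal (c v x * x powr (s - 1)) * indicator {0<..} x"
        using True v anti[of v "real n + 1"]
        by (intro AE_I2) (auto simp: indicator_def intro!: ennreal_leI mult_right_mono)
    qed measurable
    also have "\<dots> = ennreal (m * v powr (- a)) - ennreal (m * (real n + 1) powr (- a))"
      using v by (subst (1 2) mel) auto
    also have "\<dots> = ennreal (m * (v powr (- a) - real (Suc n) powr (- a)))"
      using m by (subst ennreal_minus) (auto simp: algebra_simps)
    finally show ?thesis using True by simp
  qed auto
  have gap: "(\<integral>\<^sup>+v. ennreal (m * (v powr (- a) - real (Suc n) powr (- a))) * indicator {real n<..real n + 1} v \<partial>lborel)
      = ennreal (m * zeta_gap a n)" for n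
  proof -
    have *: "((\<lambda>v. v powr (- a) - real (Suc n) powr (- a)) has_integral zeta_gap a n) {real n<..real n + 1}"
      using has_integral_powr_minus_unit[OF a, of n] by (simp only: has_integral_Icc_iff_Ioc)
    have pos: "0 \<le> v powr (- a) - real (Suc n) powr (- a)" if "v \<in> {real n<..real n + 1}" for v
      using that a by (auto intro!: powr_mono2')
    show "(\<integral>\<^sup>+v. ennreal (m * (v powr (- a) - real (Suc n) powr (- a))) * indicator {real n<..real n + 1} v \<partial>lborel)
      = ennreal (m * zeta_gap a n)"
      by (rule nn_integral_has_integral_lebesgue'[OF _ has_integral_mult_right[OF *]])
         (use pos m in auto)
  qed
  have "(\<integral>\<^sup>+x. ennreal (H x * x powr (s - 1)) * indicator {0<..} x \<partial>lborel)
      = (\<integral>\<^sup>+x. (\<Sum>n. (\<integral>\<^sup>+v. ?d n v x \<partial>lborel) * ?w x) \<partial>lborel)"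
  proof (rule nn_integral_cong)
    fix x :: real
    show "ennreal (H x * x powr (s - 1)) * indicator {0<..} x = (\<Sum>n. (\<integral>\<^sup>+v. ?d n v x \<partial>lborel) * ?w x)"
    proof (cases "x > 0")
      case x: True
      have "(\<Sum>n. (\<integral>\<^sup>+v. ?d n v x \<partial>lborel) * ?w x) = (\<Sum>n. (\<integral>\<^sup>+v. ?d n v x \<partial>lborel)) * ?w x"
        by (rule ennreal_suminf_multc)
      also have "(\<Sum>n. (\<integral>\<^sup>+v. ?d n v x \<partial>lborel)) = (\<Sum>n. ennreal (I n x - c (real n + 1) x))"
        using inner[OF x] by simp
      also have "\<dots> = ennreal (H x)"
        using H[OF x] inn[OF x] by (simp add: suminf_ennreal2 sums_iff)
      finally have "(\<Sum>n. (\<integral>\<^sup>+v. ?d n v x \<partial>lborel) * ?w x) = ennreal (H x) * ?w x" .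
      moreover have "H x \<ge> 0" using sums_le[OF inn[OF x] sums_zero H[OF x]] .
      ultimately show ?thesis using x by (simp add: ennreal_mult)
    qed auto
  qed
  also have "\<dots> = (\<Sum>n. \<integral>\<^sup>+x. (\<integral>\<^sup>+v. ?d n v x \<partial>lborel) * ?w x \<partial>lborel)"
    by (rule nn_integral_suminf) measurable
  also have "\<dots> = (\<Sum>n. \<integral>\<^sup>+x. (\<integral>\<^sup>+v. ?d n v x * ?w x \<partial>lborel) \<partial>lborel)"
    by (subst nn_integral_multc) auto
  also have "\<dots> = (\<Sum>n. \<integral>\<^sup>+v. (\<integral>\<^sup>+x. ?d n v x * ?w x \<partial>lborel) \<partial>lborel)"
    by (intro suminf_cong lborel_pair.Fubini') measurable
  also have "\<dots> = (\<Sum>n. ennreal (m * zeta_gap a n))"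
    by (subst outer) (subst gap, rule refl)
  also have "\<dots> = ennreal (\<Sum>n. m * zeta_gap a n)"
    using zeta_gap_nonneg[OF a] m zeta_gap_sums(1)[OF a] by (intro suminf_ennreal2) (auto simp: sums_iff intro!: summable_mult)
  also have "(\<Sum>n. m * zeta_gap a n) = m * (Re (zeta_num (of_real a)) / (1 - a))"
    using zeta_gap_sums(1)[OF a] by (simp add: sums_iff suminf_mult)
  finally show ?thesis .
qed


section \<open>Mellin transforms of the two kernels\<close>

lemma nn_integral_Gamma_scaled:
  fixes a s :: real
  assumes "a > 0" "s > 0"
  shows "(\<integral>\<^sup>+x. ennreal (x powr (s - 1) * exp (- (a * x))) * indicator {0<..} x \<partial>lborel)
    = ennreal (Gamma s * a powr (- s))"
proof -
  let ?f = "\<lambda>y::real. ennreal (y powr (s - 1) / exp y) * indicator {0..} y"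
  let ?g = "\<lambda>x::real. ennreal (x powr (s - 1) * exp (- (a * x))) * indicator {0<..} x"
  have "ennreal (Gamma s) = (\<integral>\<^sup>+y. ?f y \<partial>lborel)"
    using nn_integral_has_integral_lebesgue'[OF _ Gamma_integral_real[OF assms(2)]] by simp
  also have "\<dots> = \<bar>a\<bar> * (\<integral>\<^sup>+x. ?f (0 + a * x) \<partial>lborel)"
    using assms by (intro nn_integral_real_affine) auto
  also have "(\<integral>\<^sup>+x. ?f (0 + a * x) \<partial>lborel) = (\<integral>\<^sup>+x. ennreal (a powr (s - 1)) * ?g x \<partial>lborel)"
  proof (rule nn_integral_cong_AE)
    have "AE x in lborel. x \<noteq> (0::real)" by (rule AE_lborel_singleton)
    then show "AE x in lborel. ?f (0 + a * x) = ennreal (a powr (s - 1)) * ?g x"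
    proof eventually_elim
      case (elim x)
      show ?case
      proof (cases "x > 0")
        case True
        then show ?thesis using assms
          by (simp add: powr_mult exp_minus divide_inverse ennreal_mult' mult.assoc)
      next
        case False
        then have "a * x < 0" using elim assms by (simp add: mult_pos_neg)
        with False show ?thesis by simp
      qed
    qed
  qed
  also have "\<dots> = ennreal (a powr (s - 1)) * (\<integral>\<^sup>+x. ?g x \<partial>lborel)"
    by (rule nn_integral_cmult) measurable
  also have "ennreal \<bar>a\<bar> * (ennreal (a powr (s - 1)) * (\<integral>\<^sup>+x. ?g x \<partial>lborel)) = ennreal (a powr s) * (\<integral>\<^sup>+x. ?g x \<partial>lborel)"
    using assms by (simp add: powr_diff mult.assoc[symmetric] ennreal_mult'[symmetric])
  finally have "ennreal (a powr (- s)) * ennreal (Gamma s) = ennreal (a powr (- s)) * (ennreal (a powr s) * (\<integral>\<^sup>+x. ?g x \<partial>lborel))"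
    by simp
  also have "\<dots> = ennreal (a powr (- s) * a powr s) * (\<integral>\<^sup>+x. ?g x \<partial>lborel)"
    by (simp add: ennreal_mult' mult.assoc)
  also have "a powr (- s) * a powr s = 1" using assms by (simp flip: powr_add)
  finally have "ennreal (a powr (- s)) * ennreal (Gamma s) = (\<integral>\<^sup>+x. ?g x \<partial>lborel)" by simp
  moreover have "ennreal (Gamma s * a powr (- s)) = ennreal (a powr (- s)) * ennreal (Gamma s)"
    using assms by (simp add: ennreal_mult'' mult.commute)
  ultimately show ?thesis by simp
qed

text \<open>The substitution \<open>y = x\<^sup>2\<close> in the gamma integral of exponent
  \<open>(s + 1) / 2\<close>.\<close>

lemma nn_integral_Gamma_square:
  fixes r s :: real
  assumes r: "r > 0" and s: "s > - 1"
  shows "(\<integral>\<^sup>+x. ennreal (2 * x powr s * exp (- (r * x\<^sup>2))) * indicator {0<..} x \<partial>lborel)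
    = ennreal (Gamma ((s + 1) / 2) * r powr (- ((s + 1) / 2)))"
proof -
  define b where "b = Gamma ((s + 1) / 2) * r powr (- ((s + 1) / 2))"
  have b: "b \<ge> 0" unfolding b_def using s by (intro mult_nonneg_nonneg) auto
  let ?f = "\<lambda>y::real. y powr ((s + 1) / 2 - 1) * exp (- (r * y))"
  have "(\<integral>\<^sup>+y. ennreal (?f y * indicator {0<..} y) \<partial>lborel) = ennreal b"
    unfolding b_def using nn_integral_Gamma_scaled[OF r, of "(s + 1) / 2"] s
    by (simp add: ennreal_mult'' ennreal_indicator)
  then have "((\<lambda>y. ?f y * indicator {0<..} y) has_integral b) UNIV"
    using b by (intro nn_integral_has_integral) auto
  moreover have "(\<lambda>y. ?f y * indicator {0<..} y) = (\<lambda>y. if y \<in> {0<..} then ?f y else 0)"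
    by (auto simp: indicator_def)
  ultimately have hf: "(?f has_integral b) {0<..}"
    by (simp only: has_integral_restrict_UNIV)
  have "?f absolutely_integrable_on {0<..} \<and> integral {0<..} ?f = b"
    using hf by (intro conjI nonnegative_absolutely_integrable_1) (auto intro: integral_unique)
  moreover have "(\<lambda>x::real. x\<^sup>2) ` {0<..} = {0<..}"
  proof
    show "{0<..} \<subseteq> (\<lambda>x::real. x\<^sup>2) ` {0<..}"
      by (rule subsetI, rule_tac x = "sqrt x" in image_eqI) auto
  qed auto
  ultimately have "(\<lambda>x. \<bar>2 * x\<bar> * ?f (x\<^sup>2)) absolutely_integrable_on {0<..} \<and>
     integral {0<..} (\<lambda>x. \<bar>2 * x\<bar> * ?f (x\<^sup>2)) = b"
    by (subst has_absolute_integral_change_of_variables_1'[where g = "\<lambda>x::real. x\<^sup>2"])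
       (auto intro!: derivative_eq_intros inj_onI simp: power2_eq_iff)
  then have I: "((\<lambda>x. \<bar>2 * x\<bar> * ?f (x\<^sup>2)) has_integral b) {0<..}"
    using absolutely_integrable_on_def integrable_integral by blast
  have "((\<lambda>x. 2 * x powr s * exp (- (r * x\<^sup>2))) has_integral b) {0<..}"
  proof (rule has_integral_eq[OF _ I])
    fix x :: real assume "x \<in> {0<..}"
    then have x: "x > 0" by simp
    have "(x\<^sup>2) powr ((s + 1) / 2 - 1) = x powr (s - 1)"
      using x by (simp add: powr_powr diff_divide_distrib add_divide_distrib flip: powr_numeral)
    also have "\<dots> = x powr s / x" using x by (simp add: powr_diff)
    finally show "\<bar>2 * x\<bar> * ?f (x\<^sup>2) = 2 * x powr s * exp (- (r * x\<^sup>2))" using x by simp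
  qed
  from nn_integral_has_integral_lebesgue'[OF _ this] show ?thesis by (simp add: b_def)
qed

text \<open>Writing \<open>1 / (b\<^sup>2 + x\<^sup>2)\<close> as the integral of
  \<open>exp (- ((b\<^sup>2 + x\<^sup>2) * r))\<close> over \<open>r > 0\<close> and exchanging the
  integrals splits the transform into two gamma integrals. Their product is left unsimplified, since
  the duplication formula will need exactly this shape.\<close>

lemma mellin_quadratic_kernel:
  fixes b s :: real
  assumes b: "b > 0" and s: "0 < s" "s < 1"
  shows "(\<integral>\<^sup>+x. ennreal (2 * x / (b\<^sup>2 + x\<^sup>2) * x powr (s - 1)) * indicator {0<..} x \<partial>lborel)
     = ennreal (Gamma ((s + 1) / 2) * Gamma ((1 - s) / 2) * b powr (s - 1))"
proof -
  let ?k = "\<lambda>x r. ennreal (2 * x powr s * exp (- (r * x\<^sup>2))) * indicator {0<..} x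
      * (ennreal (exp (- (b\<^sup>2 * r))) * indicator {0<..} r)"
  have "(\<integral>\<^sup>+x. ennreal (2 * x / (b\<^sup>2 + x\<^sup>2) * x powr (s - 1)) * indicator {0<..} x \<partial>lborel)
     = (\<integral>\<^sup>+x. \<integral>\<^sup>+r. ?k x r \<partial>lborel \<partial>lborel)"
  proof (rule nn_integral_cong)
    fix x :: real
    show "ennreal (2 * x / (b\<^sup>2 + x\<^sup>2) * x powr (s - 1)) * indicator {0<..} x = (\<integral>\<^sup>+r. ?k x r \<partial>lborel)"
    proof (cases "x > 0")
      case x: True
      have p: "b\<^sup>2 + x\<^sup>2 > 0" using b by (intro add_pos_nonneg) auto
      have "(\<integral>\<^sup>+r. ?k x r \<partial>lborel) = (\<integral>\<^sup>+r. ennreal (2 * x powr s) *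
          (ennreal (r powr (1 - 1) * exp (- ((b\<^sup>2 + x\<^sup>2) * r))) * indicator {0<..} r) \<partial>lborel)"
      proof (intro nn_integral_cong)
        fix r :: real
        have "ennreal (2 * x powr s * exp (- (r * x\<^sup>2))) * ennreal (exp (- (b\<^sup>2 * r)))
          = ennreal (2 * x powr s * exp (- (r * x\<^sup>2)) * exp (- (b\<^sup>2 * r)))"
          by (intro ennreal_mult[symmetric]) auto
        also have "2 * x powr s * exp (- (r * x\<^sup>2)) * exp (- (b\<^sup>2 * r)) = 2 * x powr s * exp (- ((b\<^sup>2 + x\<^sup>2) * r))"
          by (simp add: algebra_simps flip: exp_add)
        also have "ennreal \<dots> = ennreal (2 * x powr s) * ennreal (exp (- ((b\<^sup>2 + x\<^sup>2) * r)))"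
          by (intro ennreal_mult) auto
        finally show "?k x r = ennreal (2 * x powr s) *
          (ennreal (r powr (1 - 1) * exp (- ((b\<^sup>2 + x\<^sup>2) * r))) * indicator {0<..} r)"
          using x by (auto simp: indicator_def)
      qed
      also have "\<dots> = ennreal (2 * x powr s) * ennreal (Gamma 1 * (b\<^sup>2 + x\<^sup>2) powr (- 1))"
        by (subst nn_integral_cmult) (use nn_integral_Gamma_scaled[OF p, of 1] in auto)
      also have "\<dots> = ennreal (2 * x / (b\<^sup>2 + x\<^sup>2) * x powr (s - 1))"
        using x p by (subst ennreal_mult'[symmetric]) (auto simp: powr_minus powr_diff field_simps)
      finally show ?thesis using x by simp
    qed auto
  qed
  also have "\<dots> = (\<integral>\<^sup>+r. \<integral>\<^sup>+x. ?k x r \<partial>lborel \<partial>lborel)"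
    by (rule lborel_pair.Fubini'[symmetric]) measurable
  also have "\<dots> = (\<integral>\<^sup>+r. ennreal (Gamma ((s + 1) / 2)) *
       (ennreal (r powr ((1 - s) / 2 - 1) * exp (- (b\<^sup>2 * r))) * indicator {0<..} r) \<partial>lborel)"
  proof (rule nn_integral_cong)
    fix r :: real
    show "(\<integral>\<^sup>+x. ?k x r \<partial>lborel) = ennreal (Gamma ((s + 1) / 2)) *
       (ennreal (r powr ((1 - s) / 2 - 1) * exp (- (b\<^sup>2 * r))) * indicator {0<..} r)"
    proof (cases "r > 0")
      case r: True
      have "(\<integral>\<^sup>+x. ?k x r \<partial>lborel) = ennreal (Gamma ((s + 1) / 2) * r powr (- ((s + 1) / 2))) * ennreal (exp (- (b\<^sup>2 * r)))"
        using r nn_integral_Gamma_square[OF r, of s] s by (subst nn_integral_multc) auto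
      also have "- ((s + 1) / 2) = (1 - s) / 2 - 1" by (simp add: field_simps)
      also have "ennreal (Gamma ((s + 1) / 2) * r powr ((1 - s) / 2 - 1)) * ennreal (exp (- (b\<^sup>2 * r)))
         = ennreal (Gamma ((s + 1) / 2)) * ennreal (r powr ((1 - s) / 2 - 1) * exp (- (b\<^sup>2 * r)))"
        using s by (simp add: ennreal_mult'' mult.assoc)
      finally show ?thesis using r by simp
    qed auto
  qed
  also have "\<dots> = ennreal (Gamma ((s + 1) / 2)) * ennreal (Gamma ((1 - s) / 2) * (b\<^sup>2) powr (- ((1 - s) / 2)))"
    by (subst nn_integral_cmult) (use nn_integral_Gamma_scaled[of "b\<^sup>2" "(1 - s) / 2"] b s in auto)
  also have "(b\<^sup>2) powr (- ((1 - s) / 2)) = b powr (s - 1)"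
  proof -
    have "2 * (- ((1 - s) / 2)) = s - 1" by (simp add: field_simps)
    then have "(b powr 2) powr (- ((1 - s) / 2)) = b powr (s - 1)" by (simp only: powr_powr)
    then show ?thesis using b by simp
  qed
  also have "ennreal (Gamma ((s + 1) / 2)) * ennreal (Gamma ((1 - s) / 2) * b powr (s - 1)) =
    ennreal (Gamma ((s + 1) / 2) * Gamma ((1 - s) / 2) * b powr (s - 1))"
    using s by (simp add: ennreal_mult'' mult.assoc)
  finally show ?thesis .
qed

lemma functional_equation_real:
  fixes s :: real
  assumes s: "0 < s" "s < 1"
  shows "Gamma s * (Re (zeta_num (of_real s)) / (1 - s)) =
    Gamma ((s + 1) / 2) * Gamma ((1 - s) / 2) * (2 * pi) powr (s - 1) * (Re (zeta_num (of_real (1 - s))) / s)"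
proof -
  define H where "H x = 1 / x - 1 / (exp x - 1)" for x :: real
  define J where "J = (\<integral>\<^sup>+x. ennreal (H x * x powr (s - 1)) * indicator {0<..} x \<partial>lborel)"
  \<comment> \<open>The kernel \<open>exp (- (v * x))\<close> integrates over all cells to
    \<open>1 / x\<close>, and its values at the right ends form a geometric series with sum
    \<open>1 / (exp x - 1)\<close>.\<close>
  have J1: "J = ennreal (Gamma s * (Re (zeta_num (of_real s)) / (1 - s)))"
    unfolding J_def
  proof (rule mellin_zeta_gap[where c = "\<lambda>v x. exp (- (v * x))" and
           I = "\<lambda>n x. (exp (- (real n * x)) - exp (- ((real n + 1) * x))) / x"])
    show "(\<integral>\<^sup>+x. ennreal (exp (- (v * x)) * x powr (s - 1)) * indicator {0<..} x \<partial>lborel) = ennreal (Gamma s * v powr (- s))"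
      if "0 < v" for v :: real
      using nn_integral_Gamma_scaled[OF that s(1)] by (simp add: mult.commute)
    fix n :: nat and x :: real assume x: "0 < x"
    have "((\<lambda>v. exp (- (v * x))) has_integral (- exp (- ((real n + 1) * x)) / x - (- exp (- (real n * x)) / x))) {real n..real n + 1}"
    proof (rule fundamental_theorem_of_calculus)
      fix v
      show "((\<lambda>v. - exp (- (v * x)) / x) has_vector_derivative exp (- (v * x))) (at v within {real n..real n + 1})"
        unfolding has_real_derivative_iff_has_vector_derivative[symmetric]
        using x by (auto intro!: derivative_eq_intros)
    qed simp
    then show "((\<lambda>v. exp (- (v * x))) has_integral (exp (- (real n * x)) - exp (- ((real n + 1) * x))) / x) {real n..real n + 1}"
      by (simp add: diff_divide_distrib)
  next
    fix x :: real assume x: "0 < x"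
    have "(\<lambda>n. exp (- (real n * x)) / x) \<longlonglongrightarrow> 0" using x by real_asymp
    from telescope_sums'[OF this]
    have "(\<lambda>n. (exp (- (real n * x)) - exp (- ((real n + 1) * x))) / x) sums (1 / x)"
      by (simp add: diff_divide_distrib add.commute)
    note tel = this
    have "(\<lambda>n. exp (- x) * exp (- x) ^ n) sums (exp (- x) * (1 / (1 - exp (- x))))"
      using x by (intro sums_mult geometric_sums) auto
    moreover have "exp (- x) * exp (- x) ^ n = exp (- ((real n + 1) * x))" for n
      by (simp add: exp_of_nat_mult[symmetric] exp_add[symmetric] algebra_simps)
    moreover have "exp (- x) * (1 / (1 - exp (- x))) = 1 / (exp x - 1)"
      using x by (simp add: exp_minus field_simps)
    ultimately have "(\<lambda>n. exp (- ((real n + 1) * x))) sums (1 / (exp x - 1))" by simp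
    with tel show "(\<lambda>n. (exp (- (real n * x)) - exp (- ((real n + 1) * x))) / x - exp (- ((real n + 1) * x))) sums H x"
      unfolding H_def by (rule sums_diff)
  qed (use s in \<open>auto intro!: mult_right_mono\<close>)
  \<comment> \<open>The second kernel has total integral \<open>1 / 2\<close>, through
    \<open>arctan\<close>, and its values at the right ends are the partial fractions of
    \<open>1 / (exp x - 1) - 1 / x + 1 / 2\<close>; the difference is again
    \<open>H x\<close>.\<close>
  have J2: "J = ennreal (Gamma ((s + 1) / 2) * Gamma ((1 - s) / 2) * (2 * pi) powr (s - 1) * (Re (zeta_num (of_real (1 - s))) / (1 - (1 - s))))"
    unfolding J_def
  proof (rule mellin_zeta_gap[where c = "\<lambda>v x. 2 * x / (4 * pi\<^sup>2 * v\<^sup>2 + x\<^sup>2)" and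
           I = "\<lambda>n x. (arctan (2 * pi * (real n + 1) / x) - arctan (2 * pi * real n / x)) / pi"])
    show "(\<integral>\<^sup>+x. ennreal (2 * x / (4 * pi\<^sup>2 * v\<^sup>2 + x\<^sup>2) * x powr (s - 1)) * indicator {0<..} x \<partial>lborel)
       = ennreal (Gamma ((s + 1) / 2) * Gamma ((1 - s) / 2) * (2 * pi) powr (s - 1) * v powr (- (1 - s)))"
      if v: "0 < v" for v :: real
      using mellin_quadratic_kernel[of "2 * pi * v" s] v s
      by (simp add: power_mult_distrib powr_mult mult.assoc)
    show "2 * x / (4 * pi\<^sup>2 * w\<^sup>2 + x\<^sup>2) \<le> 2 * x / (4 * pi\<^sup>2 * v\<^sup>2 + x\<^sup>2)" if "0 \<le> v" "v \<le> w" "0 < x" for v w x :: real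
      using that by (intro divide_left_mono add_mono mult_left_mono power_mono mult_pos_pos add_nonneg_pos) auto
    fix n :: nat and x :: real assume x: "0 < x"
    have "((\<lambda>v. 2 * x / (4 * pi\<^sup>2 * v\<^sup>2 + x\<^sup>2)) has_integral (arctan (2 * pi * (real n + 1) / x) / pi - arctan (2 * pi * real n / x) / pi)) {real n..real n + 1}"
    proof (rule fundamental_theorem_of_calculus)
      fix v :: real
      define K where "K = 4 * pi\<^sup>2 * v\<^sup>2 + x\<^sup>2"
      have K: "K > 0" unfolding K_def using x by (intro add_nonneg_pos) auto
      have eq: "1 + (2 * pi * v / x)\<^sup>2 = (4 * pi\<^sup>2 * v\<^sup>2 + x\<^sup>2) / x\<^sup>2" using x by (simp add: field_simps)
      have "((\<lambda>v. arctan (2 * pi * v / x) / pi) has_field_derivative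
          inverse (1 + (2 * pi * v / x)\<^sup>2) * (2 * pi / x) / pi) (at v within {real n..real n + 1})"
        using x by (auto intro!: derivative_eq_intros)
      also have "inverse (1 + (2 * pi * v / x)\<^sup>2) * (2 * pi / x) / pi = 2 * x / K"
        unfolding eq K_def[symmetric] using x K by (simp add: field_simps power2_eq_square)
      finally show "((\<lambda>v. arctan (2 * pi * v / x) / pi) has_vector_derivative 2 * x / (4 * pi\<^sup>2 * v\<^sup>2 + x\<^sup>2)) (at v within {real n..real n + 1})"
        unfolding has_real_derivative_iff_has_vector_derivative[symmetric] K_def .
    qed simp
    then show "((\<lambda>v. 2 * x / (4 * pi\<^sup>2 * v\<^sup>2 + x\<^sup>2)) has_integral (arctan (2 * pi * (real n + 1) / x) - arctan (2 * pi * real n / x)) / pi) {real n..real n + 1}"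
      by (simp add: diff_divide_distrib)
  next
    fix x :: real assume x: "0 < x"
    have "(\<lambda>n. arctan (2 * pi * real n / x) / pi) \<longlonglongrightarrow> (pi / 2) / pi"
      using x by (intro tendsto_divide tendsto_const filterlim_compose[OF tendsto_arctan_at_top]) (real_asymp, simp)
    from telescope_sums[OF this]
    have "(\<lambda>n. (arctan (2 * pi * (real n + 1) / x) - arctan (2 * pi * real n / x)) / pi) sums (1 / 2)"
      by (simp add: diff_divide_distrib add.commute)
    from sums_diff[OF this sums_inverse_exp_minus_1[OF x]]
    show "(\<lambda>n. (arctan (2 * pi * (real n + 1) / x) - arctan (2 * pi * real n / x)) / pi - 2 * x / (4 * pi\<^sup>2 * (real n + 1)\<^sup>2 + x\<^sup>2)) sums H x"
      by (simp add: H_def)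
  qed (use s in auto)
  have pos: "Re (zeta_num (of_real a)) / (1 - a) \<ge> 0" if "0 < a" "a < 1" for a
    using sums_le[OF zeta_gap_nonneg[OF that] sums_zero zeta_gap_sums(1)[OF that]] .
  have "Gamma s * (Re (zeta_num (of_real s)) / (1 - s)) =
      Gamma ((s + 1) / 2) * Gamma ((1 - s) / 2) * (2 * pi) powr (s - 1) * (Re (zeta_num (of_real (1 - s))) / (1 - (1 - s)))"
  proof (rule ennreal_inj[THEN iffD1, OF _ _ trans[OF J1[symmetric] J2]])
    show "0 \<le> Gamma s * (Re (zeta_num (of_real s)) / (1 - s))"
      using s by (intro mult_nonneg_nonneg pos) auto
    show "0 \<le> Gamma ((s + 1) / 2) * Gamma ((1 - s) / 2) * (2 * pi) powr (s - 1) * (Re (zeta_num (of_real (1 - s))) / (1 - (1 - s)))"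
      using s by (intro mult_nonneg_nonneg pos) auto
  qed
  then show ?thesis by simp
qed

lemma gamma_factor_of_real:
  fixes s :: real
  shows "gamma_factor (of_real s) = of_real (pi powr (- s / 2) * Gamma (s / 2))"
proof -
  have "of_real pi powr (- complex_of_real s / 2) = complex_of_real (pi powr (- s / 2))"
    using powr_of_real[of pi "- s / 2"] by simp
  moreover have "Gamma (complex_of_real s / 2) = of_real (Gamma (s / 2))"
    using Gamma_complex_of_real[of "s / 2"] by simp
  ultimately show ?thesis unfolding gamma_factor_def by simp
qed

text \<open>Legendre's duplication formula expresses \<open>Gamma s\<close> through
  \<open>Gamma (s / 2) * Gamma ((s + 1) / 2)\<close>. The second factor also stands on the other
  side of the functional equation and cancels, which leaves the symmetric form.\<close>

lemma functional_equation_real_symmetric: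
  fixes s :: real
  assumes s: "0 < s" "s < 1"
  shows "gamma_factor (of_real s) * zeta_num (of_real s) / (1 - of_real s) =
    gamma_factor (1 - of_real s) * zeta_num (1 - of_real s) / of_real s"
proof -
  define A B where "A = Re (zeta_num (of_real s))" and "B = Re (zeta_num (of_real (1 - s)))"
  have A: "zeta_num (of_real s) = of_real A" and B: "zeta_num (of_real (1 - s)) = of_real B"
    using zeta_gap_sums(2)[of s] zeta_gap_sums(2)[of "1 - s"] s
    by (auto simp: A_def B_def elim!: Reals_cases)
  define G where "G = Gamma ((s + 1) / 2)"
  have G: "G > 0" using s by (simp add: G_def)
  have dup: "Gamma (s / 2) * G = 2 powr (1 - s) * sqrt pi * Gamma s"
  proof -
    have "complex_of_real (s/2) \<notin> \<int>\<^sub>\<le>\<^sub>0" "complex_of_real (s/2) + 1/2 \<notin> \<int>\<^sub>\<le>\<^sub>0"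
      using s by (auto elim!: nonpos_Ints_cases simp: complex_eq_iff)
    from Gamma_legendre_duplication[OF this]
    have "Gamma (complex_of_real (s/2)) * Gamma (complex_of_real ((s + 1)/2)) =
      exp ((1 - of_real s) * of_real (ln 2)) * of_real (sqrt pi) * Gamma (complex_of_real s)"
      by (simp add: add_divide_distrib)
    also have "exp ((1 - of_real s) * of_real (ln 2)) = complex_of_real (2 powr (1 - s))"
      by (simp add: powr_def exp_of_real[symmetric])
    finally show ?thesis unfolding G_def Gamma_complex_of_real of_real_mult[symmetric] of_real_eq_iff .
  qed
  have fe: "Gamma s * (A / (1 - s)) = G * Gamma ((1 - s) / 2) * (2 * pi) powr (s - 1) * (B / s)"
    using functional_equation_real[OF s] unfolding A_def B_def G_def .
  have "G * (Gamma (s/2) * (A / (1 - s))) = (Gamma (s/2) * G) * (A / (1 - s))"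
    by (simp only: mult_ac)
  also have "\<dots> = 2 powr (1 - s) * sqrt pi * (Gamma s * (A / (1 - s)))"
    unfolding dup by (simp only: mult.assoc)
  also have "\<dots> = G * ((2 powr (1 - s) * 2 powr (s - 1)) * (sqrt pi * pi powr (s - 1)) * Gamma ((1 - s) / 2) * (B / s))"
    unfolding fe by (simp add: powr_mult mult_ac)
  also have "2 powr (1 - s) * 2 powr (s - 1) = (1::real)" by (simp flip: powr_add)
  also have "sqrt pi * pi powr (s - 1) = pi powr (s - 1/2)"
    by (simp add: powr_half_sqrt[symmetric] flip: powr_add)
  finally have "G * (Gamma (s/2) * (A / (1 - s))) = G * (1 * pi powr (s - 1/2) * Gamma ((1 - s) / 2) * (B / s))" .
  then have "Gamma (s/2) * (A / (1 - s)) = pi powr (s - 1/2) * Gamma ((1 - s) / 2) * (B / s)"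
    using G by (metis mult_1 mult_left_cancel less_irrefl)
  then have "pi powr (- s / 2) * Gamma (s/2) * (A / (1 - s)) = (pi powr (- s / 2) * pi powr (s - 1/2)) * Gamma ((1 - s) / 2) * (B / s)"
    by (simp only: mult.assoc mult_1)
  also have "pi powr (- s / 2) * pi powr (s - 1/2) = pi powr (- (1 - s) / 2)"
  proof -
    have "- s / 2 + (s - 1/2) = - (1 - s) / 2" by (simp add: field_simps)
    then show ?thesis by (simp only: powr_add[symmetric])
  qed
  finally have eq: "pi powr (- s / 2) * Gamma (s/2) * (A / (1 - s)) = pi powr (- (1 - s) / 2) * Gamma ((1 - s) / 2) * (B / s)" .
  have c: "1 - complex_of_real s = of_real (1 - s)" by simp
  show ?thesis unfolding c gamma_factor_of_real A B
    using eq by (simp only: of_real_mult[symmetric] of_real_divide[symmetric] times_divide_eq_right)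
qed

section \<open>Continuation across the strip to the left half-plane\<close>

lemma holomorphic_gamma_factor:
  assumes "\<And>s. s \<in> A \<Longrightarrow> s / 2 \<notin> \<int>\<^sub>\<le>\<^sub>0"
  shows "gamma_factor holomorphic_on A"
  unfolding gamma_factor_def using assms
  by (intro holomorphic_intros) (auto simp: complex_nonpos_Reals_iff)

lemma nonpos_Ints_Re_Im: "s \<in> \<int>\<^sub>\<le>\<^sub>0 \<Longrightarrow> Re s \<le> 0 \<and> Im s = 0"
  by (auto elim!: nonpos_Ints_cases)

lemma functional_equation_strip:
  assumes "0 < Re s" "Re s < 1"
  shows "gamma_factor s * zeta_num s / (1 - s) = gamma_factor (1 - s) * zeta_num (1 - s) / s"
proof -
  define S where "S = {s. 0 < Re s \<and> Re s < 1}"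
  define f where "f s = gamma_factor s * zeta_num s / (1 - s) - gamma_factor (1 - s) * zeta_num (1 - s) / s" for s
  have opS: "open S"
    unfolding S_def Collect_conj_eq by (intro open_Int open_halfspace_Re_gt open_halfspace_Re_lt)
  have cvS: "convex S"
    unfolding S_def Collect_conj_eq by (intro convex_Int convex_halfspace_Re_gt convex_halfspace_Re_lt)
  have zn: "zeta_num holomorphic_on S"
    by (rule holomorphic_on_subset[OF holomorphic_zeta_num]) (auto simp: S_def)
  have gf: "gamma_factor holomorphic_on S"
    by (rule holomorphic_gamma_factor) (auto simp: S_def dest!: nonpos_Ints_Re_Im)
  have sub: "(\<lambda>s. 1 - s) ` S \<subseteq> S" by (auto simp: S_def)
  have "(\<lambda>s. gamma_factor (1 - s)) holomorphic_on S" "(\<lambda>s. zeta_num (1 - s)) holomorphic_on S"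
    by (intro holomorphic_on_compose_gen[OF _ gf sub, unfolded o_def]
         holomorphic_on_compose_gen[OF _ zn sub, unfolded o_def] holomorphic_intros)+
  then have fh: "f holomorphic_on S"
    unfolding f_def by (intro holomorphic_intros gf zn) (auto simp: S_def)
  \<comment> \<open>Identity theorem: the real interval from 0 to 1, where the equation is known,
    accumulates at \<open>1 / 2\<close>.\<close>
  have "f s = 0"
  proof (rule analytic_continuation[OF fh opS convex_connected[OF cvS]])
    show "complex_of_real ` {0<..<1} \<subseteq> S" by (auto simp: S_def)
    show "1/2 \<in> S" by (simp add: S_def)
    have "(1/2::real) islimpt {0<..<1}" by (rule islimpt_greaterThanLessThan1[THEN islimpt_subset, of "1/2" 1]) auto
    then show "(1/2::complex) islimpt complex_of_real ` {0<..<1}"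
      using islimpt_isCont_image[of "1/2::real" "{0<..<1}" complex_of_real]
      by (auto simp: eventually_at_filter complex_eq_iff intro!: always_eventually)
    show "f z = 0" if "z \<in> complex_of_real ` {0<..<1}" for z
      using that functional_equation_real_symmetric by (auto simp: f_def)
    show "s \<in> S" using assms by (simp add: S_def)
  qed
  then show ?thesis by (simp add: f_def)
qed

text \<open>The functional equation solved for zeta. Since \<open>1 / (s * Gamma (s / 2))\<close> is
  the entire function \<open>rGamma (s / 2 + 1) / 2\<close>, this form is holomorphic also at 0 and
  at the negative even integers, where \<open>gamma_factor\<close> has its poles.\<close>

definition zeta_left :: "complex \<Rightarrow> complex" where
  "zeta_left s = - (1 / 2) * of_real pi powr (s - 1 / 2) * Gamma ((1 - s) / 2) * rGamma (s / 2 + 1) * zeta_num (1 - s)"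

lemma gamma_factor_nonzero: "s / 2 \<notin> \<int>\<^sub>\<le>\<^sub>0 \<Longrightarrow> gamma_factor s \<noteq> 0"
  by (simp add: gamma_factor_def Gamma_eq_zero_iff)

lemma gamma_factor_zeta_left:
  assumes "s / 2 \<notin> \<int>\<^sub>\<le>\<^sub>0"
  shows "gamma_factor s * zeta_left s = - gamma_factor (1 - s) * zeta_num (1 - s) / s"
proof -
  have s0: "s \<noteq> 0" using assms by auto
  have "Gamma (s / 2) * rGamma (s / 2 + 1) * (s / 2) = 1"
  proof -
    have "Gamma (s / 2) * rGamma (s / 2 + 1) * (s / 2) = Gamma (s / 2) * rGamma (s / 2)"
      by (subst rGamma_plus1[of "s / 2", symmetric]) (simp only: mult_ac)
    also have "\<dots> = 1" using assms by (simp add: rGamma_inverse_Gamma Gamma_eq_zero_iff)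
    finally show ?thesis .
  qed
  then have r: "Gamma (s / 2) * rGamma (s / 2 + 1) = 2 / s" using s0 by (simp add: field_simps)
  have p: "of_real pi powr (- s / 2) * of_real pi powr (s - 1/2) = (of_real pi powr (- (1 - s) / 2) :: complex)"
  proof -
    have "- s / 2 + (s - 1/2) = - (1 - s) / 2" by (simp add: field_simps)
    then show ?thesis by (simp only: powr_add[symmetric])
  qed
  have "gamma_factor s * zeta_left s = - (1/2) * (of_real pi powr (- s / 2) * of_real pi powr (s - 1/2)) *
     (Gamma (s / 2) * rGamma (s / 2 + 1)) * Gamma ((1 - s) / 2) * zeta_num (1 - s)"
    by (simp add: gamma_factor_def zeta_left_def mult_ac)
  also have "\<dots> = - gamma_factor (1 - s) * zeta_num (1 - s) / s"
    unfolding r p by (simp add: gamma_factor_def field_simps)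
  finally show ?thesis .
qed

lemma zeta_left_eq:
  assumes "0 < Re s" "Re s < 1"
  shows "zeta_left s = zeta_num s / (s - 1)"
proof -
  have s: "s / 2 \<notin> \<int>\<^sub>\<le>\<^sub>0" using assms by (auto dest!: nonpos_Ints_Re_Im)
  have "s \<noteq> 1" using assms by auto
  have "gamma_factor s * zeta_left s = - (gamma_factor s * zeta_num s / (1 - s))"
    unfolding gamma_factor_zeta_left[OF s] functional_equation_strip[OF assms] by simp
  also have "\<dots> = gamma_factor s * (zeta_num s / (s - 1))"
    by (simp add: minus_divide_right)
  finally show ?thesis using gamma_factor_nonzero[OF s] by (simp only: mult_cancel_left) simp
qed

lemma holomorphic_zeta_left: "zeta_left holomorphic_on {s. Re s < 1}"
proof -
  have zn: "(\<lambda>s. zeta_num (1 - s)) holomorphic_on {s. Re s < 1}"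
    by (rule holomorphic_on_compose_gen[OF _ holomorphic_zeta_num, unfolded o_def])
       (auto intro!: holomorphic_intros)
  show ?thesis unfolding zeta_left_def
    by (intro holomorphic_intros zn) (auto simp: complex_nonpos_Reals_iff dest!: nonpos_Ints_Re_Im)
qed

text \<open>At \<open>s = 1\<close> division by zero yields 0, in accordance with the convention in
  \<open>zeta\<close>.\<close>

definition zeta_cont :: "complex \<Rightarrow> complex" where
  "zeta_cont s = (if Re s > 0 then zeta_num s / (s - 1) else zeta_left s)"

lemma holomorphic_zeta_cont: "zeta_cont holomorphic_on - {1}"
proof -
  have "zeta_cont holomorphic_on ({s. Re s > 0} - {1}) \<union> {s. Re s < 1}"
  proof (rule holomorphic_on_Un)
    have "(\<lambda>s. zeta_num s / (s - 1)) holomorphic_on {s. Re s > 0} - {1}"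
      by (intro holomorphic_intros holomorphic_on_subset[OF holomorphic_zeta_num]) auto
    then show "zeta_cont holomorphic_on {s. Re s > 0} - {1}"
      by (rule holomorphic_transform) (auto simp: zeta_cont_def)
    show "zeta_cont holomorphic_on {s. Re s < 1}"
      by (rule holomorphic_transform[OF holomorphic_zeta_left]) (auto simp: zeta_cont_def zeta_left_eq)
  qed (auto intro: open_halfspace_Re_gt open_halfspace_Re_lt)
  then show ?thesis by (rule holomorphic_on_subset) auto
qed

text \<open>Uniqueness is the identity theorem on the connected set \<open>- {1}\<close>, started
  from the half-plane where the series converges; the value at 1 is compared separately.\<close>

lemma zeta_eq_zeta_cont: "zeta = zeta_cont"
  unfolding zeta_def
proof (rule the_equality)
  have "zeta_cont s = (\<Sum>k. of_nat (Suc k) powr (- s))" if "Re s > 1" for s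
    using that zeta_num_eq_Re_gt_1[OF that] by (auto simp: zeta_cont_def)
  then show Z: "zeta_cont holomorphic_on - {1} \<and>
      (\<forall>s. 1 < Re s \<longrightarrow> zeta_cont s = (\<Sum>k. of_nat (Suc k) powr - s)) \<and> zeta_cont 1 = 0"
    using holomorphic_zeta_cont by (simp add: zeta_cont_def)
  fix f assume f: "f holomorphic_on - {1} \<and> (\<forall>s. 1 < Re s \<longrightarrow> f s = (\<Sum>k. of_nat (Suc k) powr - s)) \<and> f 1 = 0"
  have "f s = zeta_cont s" if "s \<noteq> 1" for s
  proof (rule analytic_continuation_open[of "{s. Re s > 1}" "- {1}" f zeta_cont])
    show "connected (- {1::complex})" by (rule connected_punctured_universe) simp
    show "{s. Re s > 1} \<noteq> {}" by (auto intro!: exI[of _ 2])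
  qed (use that f Z in \<open>auto intro: open_halfspace_Re_gt\<close>)
  moreover have "f 1 = zeta_cont 1" using f Z by simp
  ultimately show "f = zeta_cont" by (intro ext) (case_tac "x = 1", auto)
qed

lemma holomorphic_zeta: "1 \<notin> A \<Longrightarrow> zeta holomorphic_on A"
  unfolding zeta_eq_zeta_cont by (rule holomorphic_on_subset[OF holomorphic_zeta_cont]) auto

lemma zeta_Re_gt_0: "Re s > 0 \<Longrightarrow> zeta s = zeta_num s / (s - 1)"
  by (simp add: zeta_eq_zeta_cont zeta_cont_def)

lemma zeta_Re_gt_1: "Re s > 1 \<Longrightarrow> zeta s = (\<Sum>k. of_nat (Suc k) powr (- s))"
  using zeta_num_eq_Re_gt_1 by (auto simp: zeta_Re_gt_0)

text \<open>For nonreal \<open>s\<close> neither gamma factor has a pole. The case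
  \<open>Re s < 1\<close> comes from \<open>zeta_left\<close>; exchanging \<open>s\<close> and
  \<open>1 - s\<close> reaches the rest.\<close>

lemma functional_equation:
  assumes "Im s \<noteq> 0"
  shows "gamma_factor s * zeta s = gamma_factor (1 - s) * zeta (1 - s)"
proof -
  have *: "gamma_factor s * zeta s = gamma_factor (1 - s) * zeta (1 - s)" if "Re s < 1" "Im s \<noteq> 0" for s
  proof -
    have s: "s / 2 \<notin> \<int>\<^sub>\<le>\<^sub>0" using that by (auto dest!: nonpos_Ints_Re_Im)
    have "zeta s = zeta_left s"
      using that zeta_left_eq[of s] by (auto simp: zeta_eq_zeta_cont zeta_cont_def)
    moreover have "zeta (1 - s) = - zeta_num (1 - s) / s"
      using that by (subst zeta_Re_gt_0) auto
    ultimately show ?thesis using gamma_factor_zeta_left[OF s] by simp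
  qed
  show ?thesis using *[of s] *[of "1 - s"] assms by (cases "Re s < 1") auto
qed

lemma cnj_zeta_num: "Re s > 0 \<Longrightarrow> zeta_num (cnj s) = cnj (zeta_num s)"
proof -
  assume s: "Re s > 0"
  have "zeta_term k (cnj s) = cnj (zeta_term k s)" for k
    unfolding zeta_term_def by (simp add: cnj_powr complex_is_Real_iff)
  moreover have "(\<lambda>k. cnj (zeta_term k s)) sums cnj (\<Sum>k. zeta_term k s)"
    using summable_zeta_term[OF s] by (simp add: sums_cnj summable_sums)
  ultimately show ?thesis unfolding zeta_num_def by (simp add: sums_iff)
qed

lemma cnj_gamma_factor: "gamma_factor (cnj s) = cnj (gamma_factor s)"
  unfolding gamma_factor_def
  by (simp add: cnj_powr cnj_Gamma complex_is_Real_iff)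

text \<open>On the critical line \<open>1 - s\<close> is the conjugate of \<open>s\<close>, so the
  completed function equals its own conjugate. This ties the argument of zeta to
  \<open>- theta\<close> modulo \<open>pi\<close>.\<close>

lemma gamma_factor_zeta_critical_line_real:
  assumes "t \<noteq> 0"
  shows "gamma_factor (Complex (1/2) t) * zeta (Complex (1/2) t) \<in> \<real>"
proof -
  let ?s = "Complex (1/2) t"
  have c: "1 - ?s = cnj ?s" by (simp add: complex_eq_iff)
  have "cnj (zeta ?s) = zeta (cnj ?s)"
    by (simp add: zeta_Re_gt_0 cnj_zeta_num del: cnj.code complex_cnj)
  then have "cnj (gamma_factor ?s * zeta ?s) = gamma_factor (1 - ?s) * zeta (1 - ?s)"
    unfolding c by (simp add: cnj_gamma_factor)
  also have "\<dots> = gamma_factor ?s * zeta ?s" using functional_equation[of ?s] assms by simp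
  finally show ?thesis by (simp only: Reals_cnj_iff)
qed

section \<open>The Dirichlet series of the logarithm\<close>

definition log_zeta_coeff :: "nat \<Rightarrow> real" where
  "log_zeta_coeff n = mangoldt n / ln (real n)"

definition log_zeta :: "complex \<Rightarrow> complex" where
  "log_zeta s = (\<Sum>n. of_real (log_zeta_coeff n) * of_nat n powr (- s))"

lemma log_zeta_coeff_prime_power:
  assumes "prime p" "m > 0"
  shows "log_zeta_coeff (p ^ m) = 1 / real m"
proof -
  have "ln (real p) > 0" using prime_gt_1_nat[OF assms(1)] by (intro ln_gt_zero) auto
  then show ?thesis using assms prime_gt_0_nat[OF assms(1)]
    by (simp add: log_zeta_coeff_def ln_realpow)
qed

lemma log_zeta_coeff_prime [simp]: "prime p \<Longrightarrow> log_zeta_coeff p = 1"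
  using log_zeta_coeff_prime_power[of p 1] by simp

lemma log_zeta_coeff_eq_0: "\<not> primepow n \<Longrightarrow> log_zeta_coeff n = 0"
  by (simp add: log_zeta_coeff_def mangoldt_def)

lemma log_zeta_coeff_bounds: "0 \<le> log_zeta_coeff n" "log_zeta_coeff n \<le> 1"
proof -
  have "0 \<le> log_zeta_coeff n \<and> log_zeta_coeff n \<le> 1"
  proof (cases "primepow n")
    case True
    then obtain p m where "prime p" "m > 0" "n = p ^ m" by (auto simp: primepow_def)
    then show ?thesis by (simp add: log_zeta_coeff_prime_power)
  qed (simp add: log_zeta_coeff_eq_0)
  then show "0 \<le> log_zeta_coeff n" "log_zeta_coeff n \<le> 1" by auto
qed

lemma log_zeta_coeff_01 [simp]: "log_zeta_coeff 0 = 0" "log_zeta_coeff (Suc 0) = 0"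
  by (simp_all add: log_zeta_coeff_def)

lemma norm_nat_powr: "norm (of_nat n powr (- s) :: complex) = real n powr (- Re s)"
  using norm_of_real_powr[of "real n" "- s"] by (cases "n = 0") auto

lemma summable_nat_powr: "Re s > 1 \<Longrightarrow> summable (\<lambda>n. norm (of_nat n powr (- s) :: complex))"
  unfolding norm_nat_powr by (subst summable_real_powr_iff) auto

lemma norm_log_zeta_term_le:
  "norm (of_real (log_zeta_coeff n) * of_nat n powr (- s) :: complex) \<le> norm (of_nat n powr (- s) :: complex)"
  using log_zeta_coeff_bounds[of n] by (simp add: norm_mult mult_left_le_one_le)

lemma summable_norm_log_zeta:
  "Re s > 1 \<Longrightarrow> summable (\<lambda>n. norm (of_real (log_zeta_coeff n) * of_nat n powr (- s) :: complex))"
  by (rule summable_comparison_test'[OF summable_nat_powr, of s 0])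
     (simp_all only: norm_log_zeta_term_le real_norm_def abs_norm_cancel)

section \<open>The Euler product by sieving\<close>

definition sifted :: "nat \<Rightarrow> nat set" where
  "sifted k = {n. n \<ge> 1 \<and> (\<forall>p. prime p \<and> p < k \<longrightarrow> \<not> p dvd n)}"

lemma sifted_Suc_prime:
  assumes "prime k"
  shows "sifted (Suc k) = sifted k - (\<lambda>n. k * n) ` sifted k" and "(\<lambda>n. k * n) ` sifted k \<subseteq> sifted k"
proof -
  show sub: "(\<lambda>n. k * n) ` sifted k \<subseteq> sifted k"
  proof
    fix n assume "n \<in> (\<lambda>n. k * n) ` sifted k"
    then obtain m where m: "m \<in> sifted k" "n = k * m" by auto
    have "\<not> p dvd n" if "prime p" "p < k" for p
      using that m assms primes_dvd_imp_eq[of p k] by (auto simp: sifted_def prime_dvd_mult_iff)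
    then show "n \<in> sifted k" using m prime_gt_0_nat[OF assms] by (auto simp: sifted_def)
  qed
  show "sifted (Suc k) = sifted k - (\<lambda>n. k * n) ` sifted k"
  proof (intro set_eqI iffI)
    fix n assume n: "n \<in> sifted (Suc k)"
    then have "\<not> k dvd n" using assms by (auto simp: sifted_def)
    then have "n \<notin> (\<lambda>n. k * n) ` sifted k" by auto
    then show "n \<in> sifted k - (\<lambda>n. k * n) ` sifted k" using n by (auto simp: sifted_def)
  next
    fix n assume n: "n \<in> sifted k - (\<lambda>n. k * n) ` sifted k"
    have "\<not> k dvd n"
    proof
      assume "k dvd n"
      then obtain m where m: "n = k * m" by blast
      then have "m \<in> sifted k" using n by (auto simp: sifted_def)
      with m n show False by auto
    qed
    then show "n \<in> sifted (Suc k)" using n by (auto simp: sifted_def less_Suc_eq)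
  qed
qed

lemma sifted_Suc_not_prime: "\<not> prime k \<Longrightarrow> sifted (Suc k) = sifted k"
  by (auto simp: sifted_def less_Suc_eq)

text \<open>Raising \<open>k\<close> past a prime deletes \<open>k\<close> times the previous set,
  and by complete multiplicativity this multiplies the sum by \<open>1 - k powr (- s)\<close>. This
  is Euler's own argument.\<close>

lemma infsum_sifted:
  assumes s: "Re s > 1"
  shows "(\<Sum>\<^sub>\<infinity>n\<in>sifted k. of_nat n powr (- s)) = zeta s * (\<Prod>p | prime p \<and> p < k. 1 - of_nat p powr (- s))"
proof (induction k)
  let ?f = "\<lambda>n. of_nat n powr (- s) :: complex"
  case 0
  have "(\<lambda>k. ?f (Suc k)) sums zeta s"
    using summable_Suc_powr_complex[OF s] by (simp add: zeta_Re_gt_1[OF s] summable_sums del: of_nat_Suc)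
  then have "?f sums zeta s" by (subst (asm) sums_Suc_iff) simp
  then have "(?f has_sum zeta s) UNIV"
    by (intro norm_summable_imp_has_sum summable_nat_powr s)
  then have "(?f has_sum zeta s) (sifted 0)"
    by (subst (asm) has_sum_cong_neutral[where T = "sifted 0" and g = ?f]) (auto simp: sifted_def)
  then show ?case by (simp add: infsumI)
next
  case (Suc k)
  let ?f = "\<lambda>n. of_nat n powr (- s) :: complex"
  have sm: "?f summable_on A" for A
    by (rule summable_on_subset_banach[of _ UNIV]) (use norm_summable_imp_summable_on[OF summable_nat_powr[OF s]] in auto)
  show ?case
  proof (cases "prime k")
    case True
    have k0: "k > 0" using prime_gt_0_nat[OF True] .
    have "infsum ?f (sifted (Suc k)) = infsum ?f (sifted k) - infsum ?f ((\<lambda>n. k * n) ` sifted k)"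
      unfolding sifted_Suc_prime(1)[OF True] by (intro infsum_Diff sm sifted_Suc_prime(2) True)
    also have "infsum ?f ((\<lambda>n. k * n) ` sifted k) = infsum (?f \<circ> (\<lambda>n. k * n)) (sifted k)"
      using k0 by (intro infsum_reindex) (auto intro!: inj_onI)
    also have "?f \<circ> (\<lambda>n. k * n) = (\<lambda>n. ?f k * ?f n)"
      by (rule ext) (simp add: powr_times_real)
    also have "infsum (\<lambda>n. ?f k * ?f n) (sifted k) = ?f k * infsum ?f (sifted k)"
      by (rule infsum_cmult_right')
    finally have "infsum ?f (sifted (Suc k)) = (1 - ?f k) * infsum ?f (sifted k)"
      by (simp add: algebra_simps)
    moreover have "{p. prime p \<and> p < Suc k} = insert k {p. prime p \<and> p < k}"
      using True by (auto simp: less_Suc_eq)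
    ultimately show ?thesis using Suc by (simp add: mult_ac)
  next
    case False
    then have "{p. prime p \<and> p < Suc k} = {p. prime p \<and> p < k}" by (auto simp: less_Suc_eq)
    then show ?thesis using Suc False by (simp add: sifted_Suc_not_prime)
  qed
qed

lemma sifted_subset: "k \<ge> 2 \<Longrightarrow> sifted k - {1} \<subseteq> {k..}" "k \<ge> 2 \<Longrightarrow> 1 \<in> sifted k"
proof -
  assume k: "k \<ge> 2"
  show "1 \<in> sifted k" by (auto simp: sifted_def)
  show "sifted k - {1} \<subseteq> {k..}"
  proof
    fix n assume n: "n \<in> sifted k - {1}"
    then obtain p where p: "prime p" "p dvd n" using prime_factor_nat[of n] by auto
    then have "p \<ge> k" using n by (force simp: sifted_def)
    moreover have "p \<le> n" using p n by (auto simp: sifted_def dest: dvd_imp_le)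
    ultimately show "n \<in> {k..}" by simp
  qed
qed

text \<open>Besides 1 only numbers from \<open>k\<close> on survive the sieve, so the distance to 1
  is at most a tail of the absolutely convergent series.\<close>

lemma infsum_sifted_tendsto:
  assumes s: "Re s > 1"
  shows "(\<lambda>k. \<Sum>\<^sub>\<infinity>n\<in>sifted k. of_nat n powr (- s) :: complex) \<longlonglongrightarrow> 1"
proof -
  let ?f = "\<lambda>n. of_nat n powr (- s) :: complex"
  have nsm: "(\<lambda>n. norm (?f n)) summable_on A" for A
    by (rule summable_on_subset_banach[of _ UNIV]) (use norm_summable_imp_summable_on[of "\<lambda>n. norm (?f n)"] summable_nat_powr[OF s] in auto)
  have sm: "?f summable_on A" for A by (rule abs_summable_summable[OF nsm])
  have tail: "(\<lambda>k. \<Sum>n. norm (?f (n + k))) \<longlonglongrightarrow> 0"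
    using suminf_exist_split2[OF summable_nat_powr[OF s]] by simp
  have bound: "norm (infsum ?f (sifted k) - 1) \<le> (\<Sum>n. norm (?f (n + k)))" if k: "k \<ge> 2" for k
  proof -
    have "infsum ?f (sifted k - {1}) = infsum ?f (sifted k) - infsum ?f {1}"
      by (rule infsum_Diff) (use sm sifted_subset(2)[OF k] in auto)
    then have "infsum ?f (sifted k) - 1 = infsum ?f (sifted k - {1})" by simp
    also have "norm \<dots> \<le> infsum (\<lambda>n. norm (?f n)) (sifted k - {1})"
      by (rule norm_infsum_bound[OF nsm])
    also have "\<dots> \<le> infsum (\<lambda>n. norm (?f n)) {k..}"
      by (rule infsum_mono2[OF nsm nsm sifted_subset(1)[OF k]]) auto
    also have "{k..} = (\<lambda>n. n + k) ` UNIV" by (auto simp: image_def le_iff_add add.commute)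
    also have "infsum (\<lambda>n. norm (?f n)) ((\<lambda>n. n + k) ` UNIV) = infsum ((\<lambda>n. norm (?f n)) \<circ> (\<lambda>n. n + k)) UNIV"
      by (rule infsum_reindex) auto
    also have "\<dots> = (\<Sum>n. norm (?f (n + k)))"
    proof -
      have "summable (\<lambda>n. norm (?f (n + k)))"
        using summable_nat_powr[OF s] by (subst summable_iff_shift)
      then show ?thesis
        by (intro infsumI norm_summable_imp_has_sum) (auto simp: o_def summable_sums)
    qed
    finally show ?thesis .
  qed
  have "(\<lambda>k. infsum ?f (sifted k) - 1) \<longlonglongrightarrow> 0"
    by (rule Lim_null_comparison[OF _ tail]) (use bound in \<open>auto simp: eventually_sequentially\<close>)
  then show ?thesis by (simp add: LIM_zero_iff)
qed

lemma prime_powr_lt_1: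
  assumes "prime p" "Re s > 1"
  shows "norm (of_nat p powr (- s) :: complex) \<le> 1 / 2"
proof -
  have "real p powr (- Re s) \<le> real p powr (- 1)"
    using assms prime_ge_1_nat[OF assms(1)] by (intro powr_mono) auto
  also have "\<dots> \<le> 1 / 2" using prime_ge_2_nat[OF assms(1)] by (auto simp: powr_minus field_simps)
  finally show ?thesis by (simp add: norm_nat_powr)
qed

text \<open>The coefficients live on prime powers, each belonging to one prime and one exponent;
  grouping by the prime turns the inner sums into the series of \<open>- ln (1 - w)\<close>.\<close>

lemma log_zeta_eq_sum_primes:
  assumes s: "Re s > 1"
  shows "((\<lambda>p. - ln (1 - of_nat p powr (- s))) has_sum log_zeta s) {p. prime p}"
proof -
  let ?g = "\<lambda>n. of_real (log_zeta_coeff n) * of_nat n powr (- s) :: complex"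
  let ?h = "\<lambda>(p, m). p ^ m :: nat"
  let ?I = "Sigma {p::nat. prime p} (\<lambda>_. {1::nat..})"
  have "(?g has_sum log_zeta s) UNIV"
    unfolding log_zeta_def using summable_norm_log_zeta[OF s]
    by (intro norm_summable_imp_has_sum summable_sums) (auto intro: summable_norm_cancel)
  then have "(?g has_sum log_zeta s) (?h ` ?I)"
  proof (subst (asm) has_sum_cong_neutral[where T = "?h ` ?I" and g = ?g])
    show "?g n = 0" if "n \<in> UNIV - ?h ` ?I" for n
    proof -
      have "\<not> primepow n"
      proof
        assume "primepow n"
        then obtain p m where "prime p" "m > 0" "n = p ^ m" by (auto simp: primepow_def)
        then have "n = ?h (p, m)" "(p, m) \<in> ?I" by auto
        with that show False by blast
      qed
      then show ?thesis by (simp add: log_zeta_coeff_eq_0)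
    qed
  qed auto
  then have "(?g \<circ> ?h has_sum log_zeta s) ?I"
  proof (subst (asm) has_sum_reindex)
    show "inj_on ?h ?I"
    proof (rule inj_onI)
      fix x y assume xy: "x \<in> ?I" "y \<in> ?I" "?h x = ?h y"
      obtain p m q n where "x = (p, m)" "y = (q, n)" by (meson surj_pair)
      with xy prime_power_inj'[of p q m n] show "x = y" by simp
    qed
  qed
  then show ?thesis
  proof (rule has_sum_Sigma[OF isUCont_plus])
    fix p :: nat assume "p \<in> {p. prime p}"
    then have p: "prime p" by simp
    define w where "w = (of_nat p powr (- s) :: complex)"
    have w: "norm w < 1" using prime_powr_lt_1[OF p s] by (simp add: w_def)
    have eq: "(?g \<circ> ?h) (p, m) = w ^ m / of_nat m" if "m \<in> {1..}" for m
    proof -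
      have "of_nat (p ^ m) powr (- s) = (w ^ m :: complex)"
      proof -
        have l: "ln (real (p ^ m)) = real m * ln (real p)"
          using prime_gt_0_nat[OF p] by (simp add: ln_realpow)
        show ?thesis using prime_gt_0_nat[OF p] unfolding w_def
          by (simp add: powr_def Ln_of_nat l mult_ac flip: exp_of_nat_mult of_nat_power)
      qed
      then show ?thesis using that p by (simp add: log_zeta_coeff_prime_power)
    qed
    \<comment> \<open>The term at \<open>n = 0\<close> is \<open>1 / 0 = 0\<close>, so summation
      over \<open>UNIV\<close> agrees with summation from 1.\<close>
    have S: "(\<lambda>n. w ^ n / of_nat n) sums (- ln (1 - w))"
      using sums_minus[OF Ln_series'[of "- w"]] w by simp
    have "summable (\<lambda>n. norm (w ^ n / of_nat n))"
    proof (rule summable_comparison_test'[OF summable_geometric[of "norm w"], of 0])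
      show "norm (norm (w ^ n / of_nat n)) \<le> norm w ^ n" for n
        by (cases "n = 0") (auto simp: norm_divide norm_power divide_le_eq mult_le_cancel_left1)
    qed (use w in auto)
    then have "((\<lambda>n. w ^ n / of_nat n) has_sum (- ln (1 - w))) UNIV"
      using S by (rule norm_summable_imp_has_sum)
    then show "((\<lambda>m. (?g \<circ> ?h) (p, m)) has_sum - ln (1 - of_nat p powr - s)) {1..}"
      unfolding w_def[symmetric]
      by (subst has_sum_cong_neutral[where T = UNIV and g = "\<lambda>n. w ^ n / of_nat n"])
         (use eq in auto)
  qed
qed

text \<open>Exponentiating minus the sum over primes gives the partial products of
  \<open>1 - p powr (- s)\<close>. By the sieve, these times \<open>zeta s\<close> tend to 1, which
  also shows that \<open>zeta s\<close> is nonzero.\<close>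

lemma exp_log_zeta:
  assumes s: "Re s > 1"
  shows "exp (log_zeta s) = zeta s"
proof -
  let ?l = "\<lambda>p. - ln (1 - of_nat p powr (- s)) :: complex"
  have "((\<lambda>p. if prime p then ?l p else 0) has_sum log_zeta s) UNIV"
    using log_zeta_eq_sum_primes[OF s]
    by (subst has_sum_cong_neutral[where T = "{p. prime p}" and g = ?l]) auto
  then have "(\<lambda>k. \<Sum>p<k. if prime p then ?l p else 0) \<longlonglongrightarrow> log_zeta s"
    using has_sum_imp_sums sums_def by blast
  then have L: "(\<lambda>k. exp (- (\<Sum>p<k. if prime p then ?l p else 0))) \<longlonglongrightarrow> exp (- log_zeta s)"
    by (intro tendsto_intros)
  have "exp (- (\<Sum>p<k. if prime p then ?l p else 0)) = (\<Prod>p | prime p \<and> p < k. 1 - of_nat p powr (- s))" for k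
  proof -
    have "(\<Sum>p<k. if prime p then ?l p else 0) = (\<Sum>p | prime p \<and> p < k. ?l p)"
      by (rule sum.mono_neutral_cong_right) auto
    then have "exp (- (\<Sum>p<k. if prime p then ?l p else 0)) = (\<Prod>p | prime p \<and> p < k. exp (- ?l p))"
      by (simp add: exp_sum sum_negf[symmetric])
    also have "\<dots> = (\<Prod>p | prime p \<and> p < k. 1 - of_nat p powr (- s))"
    proof (rule prod.cong)
      fix p assume "p \<in> {p. prime p \<and> p < k}"
      then have "norm (of_nat p powr (- s) :: complex) \<le> 1 / 2" using prime_powr_lt_1 s by auto
      then have "1 - of_nat p powr (- s) \<noteq> (0::complex)" by auto
      then show "exp (- ?l p) = 1 - of_nat p powr (- s)" by simp
    qed simp
    finally show ?thesis .
  qed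
  then have "(\<lambda>k. zeta s * (\<Prod>p | prime p \<and> p < k. 1 - of_nat p powr (- s))) \<longlonglongrightarrow> zeta s * exp (- log_zeta s)"
    using tendsto_mult[OF tendsto_const L, of "zeta s"] by simp
  moreover have "(\<lambda>k. zeta s * (\<Prod>p | prime p \<and> p < k. 1 - of_nat p powr (- s))) \<longlonglongrightarrow> 1"
    using infsum_sifted_tendsto[OF s] unfolding infsum_sifted[OF s] .
  ultimately have "zeta s * exp (- log_zeta s) = 1" using LIMSEQ_unique by blast
  then show ?thesis by (simp add: exp_minus field_simps)
qed

section \<open>Zeros outside the critical line\<close>

lemma zeta_nonzero_Re_gt_1: "Re s > 1 \<Longrightarrow> zeta s \<noteq> 0"
  using exp_log_zeta[of s] by (metis exp_not_eq_zero)

lemma nat_powr_Complex: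
  "of_nat n powr (- Complex \<sigma> \<tau>) = of_real (real n powr (- \<sigma>)) * cis (- \<tau> * ln (real n))"
proof (cases "n = 0")
  case False
  have e: "- Complex \<sigma> \<tau> * complex_of_real (ln (real n)) =
        complex_of_real (- \<sigma> * ln (real n)) + \<i> * complex_of_real (- \<tau> * ln (real n))"
    by (simp add: complex_eq_iff)
  have "of_nat n powr (- Complex \<sigma> \<tau>) = exp (- Complex \<sigma> \<tau> * complex_of_real (ln (real n)))"
    using False by (simp add: powr_def Ln_of_nat)
  also have "\<dots> = complex_of_real (exp (- \<sigma> * ln (real n))) * cis (- \<tau> * ln (real n))"
    unfolding e exp_add cis_conv_exp exp_of_real by simp
  also have "exp (- \<sigma> * ln (real n)) = real n powr (- \<sigma>)" using False by (simp add: powr_def)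
  finally show ?thesis .
qed auto

text \<open>Mertens: \<open>3 + 4 * cos a + cos (2 * a) = 2 * (1 + cos a)\<^sup>2\<close> is
  nonnegative, hence so is every term of the corresponding combination of real parts of
  \<open>log_zeta\<close>.\<close>

lemma three_four_one:
  assumes \<sigma>: "\<sigma> > 1"
  shows "norm (zeta (Complex \<sigma> 0)) ^ 3 * norm (zeta (Complex \<sigma> t)) ^ 4 * norm (zeta (Complex \<sigma> (2 * t))) \<ge> 1"
proof -
  have S: "(\<lambda>n. log_zeta_coeff n * (real n powr (- \<sigma>) * cos (\<tau> * ln (real n)))) sums Re (log_zeta (Complex \<sigma> \<tau>))" for \<tau>
  proof -
    have "(\<lambda>n. of_real (log_zeta_coeff n) * of_nat n powr (- Complex \<sigma> \<tau>)) sums log_zeta (Complex \<sigma> \<tau>)"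
      unfolding log_zeta_def using summable_norm_log_zeta[of "Complex \<sigma> \<tau>"] \<sigma>
      by (intro summable_sums summable_norm_cancel[OF summable_norm_log_zeta]) auto
    from sums_Re[OF this] show ?thesis unfolding nat_powr_Complex by simp
  qed
  have "(\<lambda>n. 3 * (log_zeta_coeff n * (real n powr (- \<sigma>) * cos (0 * ln (real n)))) +
     4 * (log_zeta_coeff n * (real n powr (- \<sigma>) * cos (t * ln (real n)))) +
     log_zeta_coeff n * (real n powr (- \<sigma>) * cos (2 * t * ln (real n)))) sums
     (3 * Re (log_zeta (Complex \<sigma> 0)) + 4 * Re (log_zeta (Complex \<sigma> t)) + Re (log_zeta (Complex \<sigma> (2 * t))))"
    by (intro sums_add sums_mult S)
  note sums = this
  have pos: "3 * (log_zeta_coeff n * (real n powr (- \<sigma>) * cos (0 * ln (real n)))) +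
     4 * (log_zeta_coeff n * (real n powr (- \<sigma>) * cos (t * ln (real n)))) +
     log_zeta_coeff n * (real n powr (- \<sigma>) * cos (2 * t * ln (real n))) \<ge> 0" for n
  proof -
    define a where "a = t * ln (real n)"
    have c2: "cos (2 * t * ln (real n)) = 2 * (cos a)\<^sup>2 - 1"
      unfolding a_def using cos_double_cos[of "t * ln (real n)"] by (simp add: mult.assoc)
    have "3 * (log_zeta_coeff n * (real n powr (- \<sigma>) * cos (0 * ln (real n)))) +
     4 * (log_zeta_coeff n * (real n powr (- \<sigma>) * cos (t * ln (real n)))) +
     log_zeta_coeff n * (real n powr (- \<sigma>) * cos (2 * t * ln (real n)))
      = log_zeta_coeff n * real n powr (- \<sigma>) * (2 * (1 + cos a)\<^sup>2)"
      unfolding c2 a_def[symmetric] by (simp add: power2_eq_square algebra_simps)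
    also have "\<dots> \<ge> 0" using log_zeta_coeff_bounds[of n] by simp
    finally show ?thesis .
  qed
  have nn: "3 * Re (log_zeta (Complex \<sigma> 0)) + 4 * Re (log_zeta (Complex \<sigma> t)) + Re (log_zeta (Complex \<sigma> (2 * t))) \<ge> 0"
    by (rule sums_le[OF pos sums_zero sums])
  have e: "norm (zeta (Complex \<sigma> \<tau>)) = exp (Re (log_zeta (Complex \<sigma> \<tau>)))" for \<tau>
    using exp_log_zeta[of "Complex \<sigma> \<tau>"] \<sigma> by (metis complex.sel(1) norm_exp_eq_Re)
  have "norm (zeta (Complex \<sigma> 0)) ^ 3 * norm (zeta (Complex \<sigma> t)) ^ 4 * norm (zeta (Complex \<sigma> (2 * t)))
    = exp (3 * Re (log_zeta (Complex \<sigma> 0)) + 4 * Re (log_zeta (Complex \<sigma> t)) + Re (log_zeta (Complex \<sigma> (2 * t))))"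
    unfolding e exp_add by (simp add: exp_of_nat_mult[symmetric])
  then show ?thesis using nn by simp
qed

lemma isCont_zeta_num: "Re s > 0 \<Longrightarrow> isCont zeta_num s"
  using holomorphic_on_imp_continuous_on[OF holomorphic_zeta_num] open_halfspace_Re_gt[of 0]
  by (subst (asm) continuous_on_eq_continuous_at) auto

lemma isCont_zeta: "s \<noteq> 1 \<Longrightarrow> isCont zeta s"
proof -
  have "continuous_on (- {1}) zeta"
    by (intro holomorphic_on_imp_continuous_on holomorphic_zeta) auto
  then show "s \<noteq> 1 \<Longrightarrow> isCont zeta s" by (subst (asm) continuous_on_eq_continuous_at) auto
qed

lemma tendsto_Complex_at_right: "((\<lambda>\<sigma>. Complex \<sigma> t) \<longlongrightarrow> Complex a t) (at_right a)"
  by (intro tendsto_Complex tendsto_intros)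

text \<open>A zero here would enter \<open>three_four_one\<close> with the fourth power and outweigh
  the third power of the pole at 1: the product would tend to 0 instead of staying at least
  1.\<close>

lemma zeta_nonzero_Re_eq_1:
  assumes t: "t \<noteq> 0"
  shows "zeta (Complex 1 t) \<noteq> 0"
proof
  assume z: "zeta (Complex 1 t) = 0"
  have ne: "Complex 1 t \<noteq> 1" "Complex 1 (2 * t) \<noteq> 1" using t by (auto simp: complex_eq_iff)
  \<comment> \<open>The same product in terms of functions with finite limits: the cube of zeta
    costs three factors \<open>\<sigma> - 1\<close>, the fourth power at the assumed zero supplies
    four, and one remains.\<close>
  let ?P = "\<lambda>\<sigma>. norm (zeta_num (Complex \<sigma> 0)) ^ 3 *
     norm ((zeta (Complex \<sigma> t) - zeta (Complex 1 t)) / (Complex \<sigma> t - Complex 1 t)) ^ 4 * norm (zeta (Complex \<sigma> (2 * t))) * (\<sigma> - 1)"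
  have "(zeta has_field_derivative deriv zeta (Complex 1 t)) (at (Complex 1 t))"
    using holomorphic_zeta[of "- {1}"] ne by (intro holomorphic_derivI[of _ "- {1}"]) auto
  then have D: "((\<lambda>y. (zeta y - zeta (Complex 1 t)) / (y - Complex 1 t)) \<longlongrightarrow> deriv zeta (Complex 1 t)) (at (Complex 1 t))"
    by (simp add: has_field_derivative_iff)
  have F: "filterlim (\<lambda>\<sigma>. Complex \<sigma> t) (at (Complex 1 t)) (at_right 1)"
    unfolding filterlim_at using tendsto_Complex_at_right[of t 1]
    by (auto simp: eventually_at_filter complex_eq_iff)
  have "(?P \<longlongrightarrow> norm (zeta_num (Complex 1 0)) ^ 3 * norm (deriv zeta (Complex 1 t)) ^ 4 * norm (zeta (Complex 1 (2 * t))) * (1 - 1)) (at_right 1)"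
    by (intro tendsto_intros isCont_tendsto_compose[OF isCont_zeta_num] isCont_tendsto_compose[OF isCont_zeta]
        filterlim_compose[OF D F] tendsto_Complex_at_right ne) auto
  then have "(?P \<longlongrightarrow> 0) (at_right 1)" by simp
  then have "eventually (\<lambda>\<sigma>. ?P \<sigma> < 1) (at_right 1)" by (rule order_tendstoD) simp
  moreover have "eventually (\<lambda>\<sigma>. \<sigma> > 1) (at_right (1::real))" by (rule eventually_at_right_less)
  ultimately have "eventually (\<lambda>\<sigma>::real. False) (at_right 1)"
  proof eventually_elim
    case (elim \<sigma>)
    define d where "d = \<sigma> - 1"
    have d: "d > 0" using elim by (simp add: d_def)
    have c: "Complex \<sigma> t - Complex 1 t = of_real d" "Complex \<sigma> 0 - 1 = of_real d"
      by (auto simp: complex_eq_iff d_def)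
    have n: "norm (zeta (Complex \<sigma> 0)) = norm (zeta_num (Complex \<sigma> 0)) / d"
      using elim d by (simp add: zeta_Re_gt_0 c norm_divide)
    have "?P \<sigma> = norm (zeta (Complex \<sigma> 0)) ^ 3 * norm (zeta (Complex \<sigma> t)) ^ 4 * norm (zeta (Complex \<sigma> (2 * t)))"
      unfolding n z c d_def[symmetric] using d
      by (simp add: norm_divide power_divide field_simps power_numeral_reduce)
    with three_four_one[of \<sigma> t] elim show False by simp
  qed
  then show False by simp
qed

lemma zeta_nonzero_Re_ge_1: "Re s \<ge> 1 \<Longrightarrow> Im s \<noteq> 0 \<Longrightarrow> zeta s \<noteq> 0"
  using zeta_nonzero_Re_gt_1[of s] zeta_nonzero_Re_eq_1[of "Im s"] complex_eq[of s] Complex_eq[of 1 "Im s"]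
  by (cases "Re s = 1") auto

lemma zeta_nonzero_Re_le_0:
  assumes "Re s \<le> 0" "Im s \<noteq> 0"
  shows "zeta s \<noteq> 0"
proof
  assume "zeta s = 0"
  then have "gamma_factor (1 - s) * zeta (1 - s) = 0" using functional_equation[of s] assms by simp
  moreover have "zeta (1 - s) \<noteq> 0" using assms by (intro zeta_nonzero_Re_ge_1) auto
  moreover have "gamma_factor (1 - s) \<noteq> 0"
    using assms by (intro gamma_factor_nonzero) (auto dest!: nonpos_Ints_Re_Im)
  ultimately show False by simp
qed

text \<open>\<open>Riemann_hypothesis\<close> speaks of the open strip only, whereas
  \<open>zeta_ordinate\<close> counts zeros on whole horizontal lines; the zero-free regions on both
  sides close the gap.\<close>

lemma Riemann_hypothesis_zeros:
  assumes Riemann_hypothesis "zeta s = 0" "Im s \<noteq> 0"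
  shows "Re s = 1 / 2"
proof -
  have "0 < Re s" "Re s < 1"
    using assms(2,3) zeta_nonzero_Re_le_0[of s] zeta_nonzero_Re_ge_1[of s] not_le by blast+
  then show ?thesis using assms(1,2) by (simp add: Riemann_hypothesis_def)
qed

lemma zeta_num_one: "zeta_num (Complex 1 0) = 1"
proof -
  have "Complex 1 0 = 1" by (simp add: complex_eq_iff)
  moreover have "zeta_term k 1 = 0" for k by (simp add: zeta_term_def del: of_nat_Suc)
  ultimately show ?thesis by (simp add: zeta_num_def)
qed

text \<open>A bound \<open>B\<close> on the sums would bound zeta by \<open>exp (2 * B)\<close> on
  the real axis right of 1, so \<open>zeta_num\<close> would tend to 0 at 1; but its value there is
  1.\<close>

lemma prime_reciprocals_unbounded: "\<exists>X. (\<Sum>p | prime p \<and> p < X. 1 / real p) > B"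
proof (rule ccontr)
  assume "\<not> ?thesis"
  then have B: "(\<Sum>p | prime p \<and> p < X. 1 / real p) \<le> B" for X by (simp add: not_less)
  have bnd: "norm (zeta_num (Complex \<sigma> 0)) \<le> exp (2 * B) * (\<sigma> - 1)" if \<sigma>: "\<sigma> > 1" for \<sigma>
  proof -
    let ?s = "Complex \<sigma> 0"
    have s: "Re ?s > 1" using \<sigma> by simp
    have "((\<lambda>p. - ln (1 - of_nat p powr (- ?s))) has_sum log_zeta ?s) {p::nat. prime p}"
      by (rule log_zeta_eq_sum_primes[OF s])
    then have "((\<lambda>p. if prime p then - ln (1 - of_nat p powr (- ?s)) else 0) has_sum log_zeta ?s) (UNIV :: nat set)"
      by (subst has_sum_cong_neutral[where T = "{p. prime p}" and g = "\<lambda>p. - ln (1 - of_nat p powr (- ?s))"]) auto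
    then have "(\<lambda>k. \<Sum>p<k. if prime p then - ln (1 - of_nat p powr (- ?s)) else 0) \<longlonglongrightarrow> log_zeta ?s"
      using has_sum_imp_sums sums_def by blast
    from tendsto_Re[OF this]
    have L: "(\<lambda>k. Re (\<Sum>p<k. if prime p then - ln (1 - of_nat p powr (- ?s)) else 0)) \<longlonglongrightarrow> Re (log_zeta ?s)" .
    have "Re (log_zeta ?s) \<le> 2 * B"
    proof (rule LIMSEQ_le_const2[OF L], intro exI allI impI)
      fix k :: nat
      have "Re (\<Sum>p<k. if prime p then - ln (1 - of_nat p powr (- ?s)) else 0)
        = (\<Sum>p | prime p \<and> p < k. Re (- ln (1 - of_nat p powr (- ?s))))"
        unfolding Re_sum by (rule sum.mono_neutral_cong_right) auto
      also have "\<dots> \<le> (\<Sum>p | prime p \<and> p < k. 2 * (1 / real p))"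
      proof (rule sum_mono)
        fix p assume "p \<in> {p. prime p \<and> p < k}"
        then have p: "prime p" by simp
        define x where "x = real p powr (- \<sigma>)"
        have x: "x \<le> 1 / real p" "0 \<le> x" "x \<le> 1 / 2"
        proof -
          have "real p powr (- \<sigma>) \<le> real p powr (- 1)"
            using \<sigma> prime_ge_1_nat[OF p] by (intro powr_mono) auto
          then show "x \<le> 1 / real p" using prime_gt_0_nat[OF p] by (simp add: x_def powr_minus field_simps)
          show "x \<le> 1 / 2" using prime_powr_lt_1[OF p s] by (simp add: norm_nat_powr x_def)
        qed (simp add: x_def)
        have "of_nat p powr (- ?s) = complex_of_real x" by (simp add: nat_powr_Complex x_def)
        then have "1 - of_nat p powr (- ?s) = complex_of_real (1 - x)" by simp
        then have "Re (- ln (1 - of_nat p powr (- ?s))) = - ln (1 - x)"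
          using x by (simp add: Ln_of_real del: of_real_diff)
        also have "\<dots> = ln (1 / (1 - x))" using x by (simp add: ln_div)
        also have "\<dots> \<le> 1 / (1 - x) - 1" using x by (intro ln_le_minus_one) auto
        also have "\<dots> \<le> 2 * x" using x mult_left_mono[of "2 * x" 1 x] by (simp add: field_simps)
        finally show "Re (- ln (1 - of_nat p powr (- ?s))) \<le> 2 * (1 / real p)" using x by linarith
      qed
      also have "\<dots> = 2 * (\<Sum>p | prime p \<and> p < k. 1 / real p)" by (simp add: sum_distrib_left)
      also have "\<dots> \<le> 2 * B" using B[of k] by simp
      finally show "Re (\<Sum>p<k. if prime p then - ln (1 - of_nat p powr (- ?s)) else 0) \<le> 2 * B" .
    qed
    then have "norm (zeta ?s) \<le> exp (2 * B)"
      using exp_log_zeta[OF s] by (metis exp_le_cancel_iff norm_exp_eq_Re)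
    moreover have "?s - 1 = of_real (\<sigma> - 1)" by (simp add: complex_eq_iff)
    ultimately show ?thesis using \<sigma> by (simp add: zeta_Re_gt_0 norm_divide divide_le_eq del: of_real_diff)
  qed
  have "((\<lambda>\<sigma>. exp (2 * B) * (\<sigma> - 1) - norm (zeta_num (Complex \<sigma> 0))) \<longlongrightarrow> exp (2 * B) * (1 - 1) - norm (zeta_num (Complex 1 0))) (at_right 1)"
    by (intro tendsto_intros isCont_tendsto_compose[OF isCont_zeta_num] tendsto_Complex_at_right) auto
  then have "exp (2 * B) * (1 - 1) - norm (zeta_num (Complex 1 0)) \<ge> 0"
    by (rule tendsto_lowerbound) (use bnd in \<open>auto simp: eventually_at_filter\<close>)
  then show False by (simp add: zeta_num_one)
qed

section \<open>The theta function and Gram points\<close>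

definition re_digamma :: "real \<Rightarrow> real" where
  "re_digamma y = Re (Digamma (Complex (1/4) y))"

text \<open>With \<open>a = n + 1/4\<close>, the n-th term in the series of
  \<open>Re (Digamma (1/4 + \<i> * y)) - Digamma (1/4)\<close>.\<close>

definition digamma_term :: "real \<Rightarrow> real \<Rightarrow> real" where
  "digamma_term y a = y\<^sup>2 / (a * (a\<^sup>2 + y\<^sup>2))"

lemma digamma_term_eq:
  assumes "a > 0"
  shows "digamma_term y a = 1 / a - a / (a\<^sup>2 + y\<^sup>2)"
proof -
  define K where "K = a\<^sup>2 + y\<^sup>2"
  have K: "K > 0" unfolding K_def using assms by (intro add_pos_nonneg) auto
  have "1 / a - a / K = (K - a * a) / (a * K)" using K assms by (simp add: diff_frac_eq)
  moreover have "K - a * a = y\<^sup>2" by (simp add: K_def power2_eq_square)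
  ultimately show ?thesis by (simp add: digamma_term_def K_def)
qed

lemma re_digamma_sums:
  "(\<lambda>n. digamma_term y (real n + 1/4)) sums (re_digamma y - Digamma (1/4))"
proof -
  define z where "z = Complex (1/4) y"
  have z: "z \<noteq> 0" by (auto simp: z_def complex_eq_iff)
  have "(\<lambda>m. Re (of_real (ln (real m)) - (\<Sum>n<m. inverse (z + of_nat n))) - (of_real (ln (real m)) - (\<Sum>n<m. inverse (1/4 + of_nat n))))
     \<longlonglongrightarrow> Re (Digamma z) - Digamma (1/4)"
    by (intro tendsto_diff tendsto_Re Digamma_LIMSEQ z) auto
  moreover have "Re (of_real (ln (real m)) - (\<Sum>n<m. inverse (z + of_nat n))) - (of_real (ln (real m)) - (\<Sum>n<m. inverse (1/4 + of_nat n)))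
     = (\<Sum>n<m. digamma_term y (real n + 1/4))" for m
  proof -
    have "inverse (1/4 + real n) - Re (inverse (z + of_nat n)) = digamma_term y (real n + 1/4)" for n
    proof -
      define a where "a = real n + 1/4"
      have a: "a > 0" by (simp add: a_def add_nonneg_pos)
      have "Re (inverse (z + of_nat n)) = a / (a\<^sup>2 + y\<^sup>2)"
        by (simp add: z_def a_def add.commute)
      moreover have "inverse (1/4 + real n) = 1 / a" by (simp add: a_def inverse_eq_divide add.commute)
      ultimately show ?thesis using digamma_term_eq[OF a, of y] by (simp add: a_def)
    qed
    then have "(\<Sum>n<m. digamma_term y (real n + 1/4)) = (\<Sum>n<m. inverse (1/4 + real n) - Re (inverse (z + of_nat n)))"
      by simp
    also have "\<dots> = (\<Sum>n<m. inverse (1/4 + real n)) - Re (\<Sum>n<m. inverse (z + of_nat n))"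
      unfolding sum_subtractf Re_sum ..
    finally show ?thesis by simp
  qed
  ultimately show ?thesis unfolding sums_def re_digamma_def z_def by simp
qed

lemma digamma_term_strict_mono:
  assumes "0 \<le> y" "y < z" "a > 0"
  shows "digamma_term y a < digamma_term z a"
proof -
  have sq: "y\<^sup>2 < z\<^sup>2" using assms by (intro power_strict_mono) auto
  have "0 < a\<^sup>2 + y\<^sup>2" "0 < a\<^sup>2 + z\<^sup>2" using assms by (auto intro: add_pos_nonneg)
  then have "a / (a\<^sup>2 + z\<^sup>2) < a / (a\<^sup>2 + y\<^sup>2)"
    using sq assms by (intro divide_strict_left_mono mult_pos_pos) auto
  then show ?thesis using assms by (simp add: digamma_term_eq)
qed

lemma re_digamma_strict_mono:
  assumes "0 \<le> y" "y < z"
  shows "re_digamma y < re_digamma z"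
proof -
  have "(\<lambda>n. digamma_term z (real n + 1/4) - digamma_term y (real n + 1/4)) sums
     ((re_digamma z - Digamma (1/4)) - (re_digamma y - Digamma (1/4)))"
    by (intro sums_diff re_digamma_sums)
  moreover have "digamma_term z (real n + 1/4) - digamma_term y (real n + 1/4) > 0" for n
    using digamma_term_strict_mono[OF assms, of "real n + 1/4"] by simp
  ultimately have "0 < (re_digamma z - Digamma (1/4)) - (re_digamma y - Digamma (1/4))"
    using suminf_pos[OF sums_summable] sums_unique by fastforce
  then show ?thesis by simp
qed

text \<open>Comparison of a sum with an integral: \<open>digamma_term y\<close> decreases in
  \<open>a\<close>, and \<open>\<Phi>\<close> is its antiderivative that vanishes at infinity. The
  sum exceeds \<open>- \<Phi> (1/4)\<close> by at most its first term, which is at most 4.\<close>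

lemma re_digamma_bounds:
  assumes y: "y > 0"
  shows "re_digamma y \<ge> Digamma (1/4) + ln 4 + ln (1/16 + y\<^sup>2) / 2"
    and "re_digamma y \<le> Digamma (1/4) + ln 4 + ln (1/16 + y\<^sup>2) / 2 + 4"
proof -
  define \<Phi> where "\<Phi> a = ln a - ln (a\<^sup>2 + y\<^sup>2) / 2" for a :: real
  have pos: "a\<^sup>2 + y\<^sup>2 > 0" for a using y by (intro add_nonneg_pos) auto
  have der: "(\<Phi> has_real_derivative digamma_term y a) (at a)" if a: "a > 0" for a
  proof -
    have "((\<lambda>a. ln (a\<^sup>2 + y\<^sup>2)) has_real_derivative (2 * a / (a\<^sup>2 + y\<^sup>2))) (at a)"
      using pos[of a] by (auto intro!: derivative_eq_intros)
    from DERIV_diff[OF DERIV_ln_divide[OF a] DERIV_cdivide[OF this, of 2]]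
    have "(\<Phi> has_real_derivative (1 / a - 2 * a / (a\<^sup>2 + y\<^sup>2) / 2)) (at a)" unfolding \<Phi>_def .
    moreover have "2 * a / K / 2 = a / K" for K :: real by simp
    ultimately show ?thesis unfolding digamma_term_eq[OF a] by metis
  qed
  have anti: "digamma_term y b \<le> digamma_term y a" if "0 < a" "a \<le> b" for a b
    unfolding digamma_term_def using that pos[of a] pos[of b] y
    by (intro divide_left_mono mult_mono add_mono power_mono mult_pos_pos) auto
  have step: "digamma_term y (a + 1) \<le> \<Phi> (a + 1) - \<Phi> a" "\<Phi> (a + 1) - \<Phi> a \<le> digamma_term y a" if a: "a > 0" for a
  proof -
    obtain c where c: "a < c" "c < a + 1" "\<Phi> (a + 1) - \<Phi> a = (a + 1 - a) * digamma_term y c"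
      using MVT2[of a "a + 1" \<Phi> "digamma_term y"] der a by auto
    then show "digamma_term y (a + 1) \<le> \<Phi> (a + 1) - \<Phi> a" "\<Phi> (a + 1) - \<Phi> a \<le> digamma_term y a"
      using anti[of c "a + 1"] anti[of a c] a by auto
  qed
  have lim: "(\<lambda>n. \<Phi> (real n + 1/4)) \<longlonglongrightarrow> 0"
    unfolding \<Phi>_def by real_asymp
  have tel: "(\<lambda>n. \<Phi> (real n + 1/4 + 1) - \<Phi> (real n + 1/4)) sums (0 - \<Phi> (1/4))"
    using telescope_sums[OF lim] by (simp add: add_ac)
  have P: "- \<Phi> (1/4) = ln 4 + ln (1/16 + y\<^sup>2) / 2"
    by (simp add: \<Phi>_def ln_div power2_eq_square)
  have "0 - \<Phi> (1/4) \<le> re_digamma y - Digamma (1/4)"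
    by (rule sums_le[OF _ tel re_digamma_sums]) (intro step(2), simp)
  then show "re_digamma y \<ge> Digamma (1/4) + ln 4 + ln (1/16 + y\<^sup>2) / 2" using P by simp
  have "(\<lambda>n. digamma_term y (real (Suc n) + 1/4)) sums (re_digamma y - Digamma (1/4) - digamma_term y (real 0 + 1/4))"
    by (subst sums_Suc_iff) (use re_digamma_sums[of y] in simp)
  then have "re_digamma y - Digamma (1/4) - digamma_term y (real 0 + 1/4) \<le> 0 - \<Phi> (1/4)"
  proof (rule sums_le[OF _ _ tel, rotated])
    show "digamma_term y (real (Suc n) + 1/4) \<le> \<Phi> (real n + 1/4 + 1) - \<Phi> (real n + 1/4)" for n
      using step(1)[of "real n + 1/4"] by (simp add: add_ac)
  qed
  moreover have "digamma_term y (1/4) \<le> 4"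
    using y pos[of "1/4"] by (simp add: digamma_term_def field_simps power2_eq_square)
  ultimately show "re_digamma y \<le> Digamma (1/4) + ln 4 + ln (1/16 + y\<^sup>2) / 2 + 4" using P by simp
qed

definition dtheta :: "real \<Rightarrow> real" where
  "dtheta t = re_digamma (t / 2) / 2 - ln pi / 2"

lemma theta_has_derivative: "(theta has_real_derivative dtheta t) (at t within S)"
proof -
  let ?g = "\<lambda>t. Complex (1/4) (t / 2)"
  have g: "?g = (\<lambda>t. of_real (1/4) + of_real t * (\<i> / 2))" by (auto simp: complex_eq_iff)
  have "(?g has_vector_derivative \<i> / 2) (at t)"
    unfolding g by (auto intro!: derivative_eq_intros simp: has_vector_derivative_def scaleR_conv_of_real)
  moreover have "(ln_Gamma has_field_derivative Digamma (?g t)) (at (?g t))"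
    by (intro has_field_derivative_ln_Gamma_complex) (auto simp: complex_nonpos_Reals_iff)
  ultimately have "(ln_Gamma \<circ> ?g has_vector_derivative (\<i> / 2 * Digamma (?g t))) (at t)"
    by (rule field_vector_diff_chain_at)
  then have "((\<lambda>t. Im ((ln_Gamma \<circ> ?g) t)) has_vector_derivative Im (\<i> / 2 * Digamma (?g t))) (at t)"
    by (rule bounded_linear.has_vector_derivative[OF bounded_linear_Im])
  then have "((\<lambda>t. Im (ln_Gamma (?g t))) has_real_derivative (re_digamma (t / 2) / 2)) (at t)"
    unfolding has_real_derivative_iff_has_vector_derivative by (simp add: re_digamma_def o_def)
  from DERIV_diff[OF this DERIV_cmult_right[OF DERIV_cdivide[OF DERIV_ident, of 2], of "ln pi"]]
  have "((\<lambda>t. Im (ln_Gamma (?g t)) - t / 2 * ln pi) has_real_derivative dtheta t) (at t)"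
    by (simp add: dtheta_def)
  then have "(theta has_real_derivative dtheta t) (at t)" by (simp add: theta_eq[abs_def])
  then show ?thesis by (rule has_field_derivative_at_within)
qed

lemma deriv_theta: "deriv theta t = dtheta t"
  by (rule DERIV_imp_deriv[OF theta_has_derivative])

lemma continuous_on_theta: "continuous_on S theta"
  using theta_has_derivative by (meson DERIV_continuous_on)

lemma theta_0: "theta 0 = 0"
proof -
  have "Complex (1/4) 0 = of_real (1/4)" by (simp add: complex_eq_iff)
  then show ?thesis by (simp add: theta_eq ln_Gamma_complex_of_real del: of_real_divide)
qed

lemma dtheta_strict_mono: "0 \<le> s \<Longrightarrow> s < t \<Longrightarrow> dtheta s < dtheta t"
  using re_digamma_strict_mono[of "s/2" "t/2"] by (simp add: dtheta_def)

lemma theta_diff_MVT: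
  assumes "s < t"
  obtains x where "s < x" "x < t" "theta t - theta s = (t - s) * dtheta x"
  using MVT2[of s t theta dtheta] theta_has_derivative assms by auto

lemma dtheta_bounds:
  obtains C where "\<And>t. t \<ge> 1 \<Longrightarrow> \<bar>dtheta t - ln t / 2\<bar> \<le> C"
proof
  fix t :: real assume t: "t \<ge> 1"
  define A where "A = Digamma (1/4 :: real) + ln 4"
  have r: "1/16 + (t/2)\<^sup>2 \<ge> (t/2)\<^sup>2" "1/16 + (t/2)\<^sup>2 \<le> t\<^sup>2" "(t/2)\<^sup>2 > 0"
    using t one_le_power[OF t, of 2] by (auto simp: power2_eq_square)
  have "ln (1/16 + (t/2)\<^sup>2) \<ge> ln ((t/2)\<^sup>2)" "ln (1/16 + (t/2)\<^sup>2) \<le> ln (t\<^sup>2)"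
    using r by (intro ln_mono; linarith)+
  moreover have "ln ((t/2)\<^sup>2) = 2 * ln t - 2 * ln 2" "ln (t\<^sup>2) = 2 * ln t"
    using t by (auto simp: ln_realpow ln_div)
  ultimately have "\<bar>re_digamma (t/2) - A - ln t\<bar> \<le> 4 + ln 2"
    using re_digamma_bounds[of "t/2"] t unfolding A_def by (auto simp: abs_le_iff)
  then show "\<bar>dtheta t - ln t / 2\<bar> \<le> (4 + ln 2 + \<bar>A\<bar> + ln pi) / 2"
  proof -
    have "0 \<le> ln pi" using pi_gt3 by (intro ln_ge_zero) linarith
    with \<open>\<bar>re_digamma (t/2) - A - ln t\<bar> \<le> 4 + ln 2\<close> show ?thesis
      unfolding dtheta_def abs_le_iff using abs_ge_self[of A] abs_ge_minus_self[of A] by argo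
  qed
qed

lemma dtheta_at_top: "filterlim dtheta at_top at_top"
proof -
  obtain C where C: "\<And>t. t \<ge> 1 \<Longrightarrow> \<bar>dtheta t - ln t / 2\<bar> \<le> C" by (rule dtheta_bounds) blast
  have "filterlim (\<lambda>t. ln t / 2 - C) at_top at_top" by real_asymp
  moreover have "eventually (\<lambda>t. ln t / 2 - C \<le> dtheta t) at_top"
    using eventually_ge_at_top[of "1::real"] by eventually_elim (use C in force)
  ultimately show ?thesis by (rule filterlim_at_top_mono)
qed

text \<open>\<open>dtheta\<close> increases on the nonnegative half-line, so \<open>theta\<close>,
  which may decrease at first, increases from the moment its derivative is nonnegative.\<close>

lemma theta_strict_mono_if:
  assumes "0 \<le> a" "dtheta a \<ge> 0" "a \<le> s" "s < t"
  shows "theta s < theta t"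
proof -
  obtain x where x: "s < x" "x < t" "theta t - theta s = (t - s) * dtheta x"
    using theta_diff_MVT[OF \<open>s < t\<close>] .
  have "dtheta x > 0" using dtheta_strict_mono[of a x] x assms by linarith
  then have "(t - s) * dtheta x > 0" using assms by simp
  then show ?thesis using x by simp
qed

text \<open>By convexity and \<open>theta 0 = 0\<close>, positive values occur only on the
  increasing branch; the uniqueness of Gram points comes from here.\<close>

lemma dtheta_pos_if:
  assumes "0 < t" "theta t > 0"
  shows "dtheta t > 0"
proof -
  obtain x where x: "0 < x" "x < t" "theta t - theta 0 = (t - 0) * dtheta x"
    using theta_diff_MVT[OF \<open>0 < t\<close>] .
  then have "dtheta x > 0" using assms by (simp add: theta_0 zero_less_mult_iff)
  then show ?thesis using dtheta_strict_mono[of x t] x by linarith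
qed

lemma theta_linear_growth: "eventually (\<lambda>t. theta t \<ge> B * t) at_top"
proof -
  have "eventually (\<lambda>t. dtheta t \<ge> \<bar>B\<bar> + 1) at_top" using dtheta_at_top by (simp add: filterlim_at_top)
  then obtain a where a: "\<And>t. t \<ge> a \<Longrightarrow> dtheta t \<ge> \<bar>B\<bar> + 1"
    unfolding eventually_at_top_linorder by blast
  define a' where "a' = max a 1"
  have "theta t \<ge> theta a' + (t - a') * (\<bar>B\<bar> + 1)" if t: "t > a'" for t
  proof -
    obtain x where x: "a' < x" "x < t" "theta t - theta a' = (t - a') * dtheta x"
      using theta_diff_MVT[OF t] .
    have "(t - a') * (\<bar>B\<bar> + 1) \<le> (t - a') * dtheta x"
      using a[of x] x t by (intro mult_left_mono) (auto simp: a'_def)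
    then show ?thesis using x by linarith
  qed
  then have "eventually (\<lambda>t. theta t \<ge> theta a' + (t - a') * (\<bar>B\<bar> + 1)) at_top"
    by (intro eventually_mono[OF eventually_gt_at_top[of a']])
  moreover have "eventually (\<lambda>t. theta a' + (t - a') * (\<bar>B\<bar> + 1) \<ge> B * t) at_top"
    using eventually_ge_at_top[of "\<bar>theta a'\<bar> + \<bar>a'\<bar> * (\<bar>B\<bar> + 1)"] eventually_ge_at_top[of 0]
  proof eventually_elim
    case (elim t)
    have "a' * (\<bar>B\<bar> + 1) \<le> \<bar>a'\<bar> * (\<bar>B\<bar> + 1)" by (intro mult_right_mono) auto
    moreover have "B * t \<le> \<bar>B\<bar> * t" using elim by (intro mult_right_mono) auto
    moreover have "(t - a') * (\<bar>B\<bar> + 1) = \<bar>B\<bar> * t + t - a' * (\<bar>B\<bar> + 1)" by (simp add: algebra_simps)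
    ultimately show ?case using elim by linarith
  qed
  ultimately show ?thesis by eventually_elim linarith
qed

text \<open>For \<open>n \<ge> 2\<close> the target value is positive, so every positive solution
  lies on the increasing branch, which contains exactly one.\<close>

lemma gram_point_properties:
  assumes n: "n \<ge> 2"
  shows "0 < gram_point n" "theta (gram_point n) = (real n - 1) * pi"
proof -
  define c where "c = (real n - 1) * pi"
  have c: "c > 0" using n by (simp add: c_def)
  have "eventually (\<lambda>t. theta t \<ge> c * t \<and> t \<ge> 1) at_top"
    using theta_linear_growth[of c] eventually_ge_at_top[of "1::real"] by eventually_elim auto
  then obtain b where b: "theta b \<ge> c * b" "b \<ge> 1" using eventually_happens[of _ at_top] trivial_limit_at_top_linorder by blast
  then have "theta b \<ge> c" using c mult_left_mono[of 1 b c] by linarith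
  then obtain t where t: "0 \<le> t" "t \<le> b" "theta t = c"
    using IVT'[of theta 0 c b] c b by (auto simp: theta_0 continuous_on_theta)
  have t0: "t > 0" using t c theta_0 by (cases "t = 0") auto
  have "0 < gram_point n \<and> theta (gram_point n) = c \<and> deriv theta (gram_point n) > 0"
    unfolding gram_point_def c_def[symmetric]
  proof (rule theI[of _ t])
    show "0 < t \<and> theta t = c \<and> deriv theta t > 0"
      using t0 t dtheta_pos_if[of t] c by (simp add: deriv_theta)
    fix x assume x: "0 < x \<and> theta x = c \<and> deriv theta x > 0"
    show "x = t"
      using theta_strict_mono_if[of x x t] theta_strict_mono_if[of t t x] x t t0 dtheta_pos_if[of t] c
      by (cases x t rule: linorder_cases) (auto simp: deriv_theta)
  qed
  then show "0 < gram_point n" "theta (gram_point n) = (real n - 1) * pi" by (auto simp: c_def)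
qed

lemma gram_point_less_iff:
  assumes n: "n \<ge> 2" and x: "x > 0"
  shows "gram_point n < x \<longleftrightarrow> (real n - 1) * pi < theta x"
proof -
  have c: "(real n - 1) * pi > 0" using n by simp
  note g = gram_point_properties[OF n]
  have dg: "dtheta (gram_point n) > 0" using dtheta_pos_if[of "gram_point n"] g c by simp
  show ?thesis
  proof
    assume "gram_point n < x"
    then show "(real n - 1) * pi < theta x"
      using theta_strict_mono_if[of "gram_point n" "gram_point n" x] dg g by simp
  next
    assume *: "(real n - 1) * pi < theta x"
    then have dx: "dtheta x > 0" using dtheta_pos_if[of x] x c by simp
    show "gram_point n < x"
    proof (rule ccontr)
      assume "\<not> gram_point n < x"
      then have "x < gram_point n" using * g by (cases "x = gram_point n") auto
      then have "theta x < theta (gram_point n)" using theta_strict_mono_if[of x x "gram_point n"] dx x by simp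
      then show False using * g by simp
    qed
  qed
qed

text \<open>Lying beyond the Gram points 1 and 2 rules out \<open>m = 1\<close> and
  \<open>m = 2\<close>. From \<open>m = 3\<close> on, \<open>gram_point_less_iff\<close> applies to
  both neighbours, and they enclose \<open>theta x / pi\<close> between \<open>m - 2\<close> and
  \<open>m - 1\<close>; hence the \<open>+ 1\<close>.\<close>

lemma gram_index_unique:
  assumes x: "x > 0" "x > gram_point 0" "x > gram_point 1" "x > gram_point 2"
  shows "(THE m. 1 \<le> m \<and> gram_point (m - 1) < x \<and> x \<le> gram_point m) = nat (\<lceil>theta x / pi\<rceil> + 1)"
    and "\<lceil>theta x / pi\<rceil> \<ge> 1"
proof -
  have "pi < theta x" using gram_point_less_iff[of 2 x] x by simp
  then have gt: "theta x / pi > 1" by (simp add: less_divide_eq)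
  then show c1: "\<lceil>theta x / pi\<rceil> \<ge> 1" by linarith
  define k where "k = nat (\<lceil>theta x / pi\<rceil> + 1)"
  have k2: "\<lceil>theta x / pi\<rceil> \<ge> 2" using gt by (simp add: le_ceiling_iff)
  have k: "k \<ge> 3" using k2 unfolding k_def by linarith
  have rk: "real k = of_int \<lceil>theta x / pi\<rceil> + 1"
  proof -
    have "0 \<le> \<lceil>theta x / pi\<rceil> + 1" using k2 by linarith
    then show ?thesis unfolding k_def by (simp only: of_nat_nat of_int_add of_int_1)
  qed
  have lt: "gram_point m < x \<longleftrightarrow> real m - 1 < theta x / pi" if "m \<ge> 2" for m
    unfolding gram_point_less_iff[OF that x(1)] by (simp only: pos_less_divide_eq[OF pi_gt_zero])
  have le: "x \<le> gram_point m \<longleftrightarrow> theta x / pi \<le> real m - 1" if "m \<ge> 2" for m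
    using lt[OF that] by linarith
  show "(THE m. 1 \<le> m \<and> gram_point (m - 1) < x \<and> x \<le> gram_point m) = nat (\<lceil>theta x / pi\<rceil> + 1)"
    unfolding k_def[symmetric]
  proof (rule the_equality)
    have "of_int \<lceil>theta x / pi\<rceil> - 1 < theta x / pi" "theta x / pi \<le> of_int \<lceil>theta x / pi\<rceil>"
      by (auto simp: ceiling_correct)
    then show "1 \<le> k \<and> gram_point (k - 1) < x \<and> x \<le> gram_point k"
      using k le[of k] lt[of "k - 1"] unfolding rk by (auto simp: of_nat_diff rk)
    fix m assume m: "1 \<le> m \<and> gram_point (m - 1) < x \<and> x \<le> gram_point m"
    have "m \<noteq> 1" "m \<noteq> 2" using m x by auto
    with m have m3: "m \<ge> 3" by linarith
    then have "theta x / pi \<le> real m - 1" "real m - 2 < theta x / pi"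
      using m le[of m] lt[of "m - 1"] by (auto simp: of_nat_diff)
    then have "\<lceil>theta x / pi\<rceil> = int m - 1" by (intro ceiling_unique) auto
    then show "m = k" using m3 by (simp add: k_def)
  qed
qed

section \<open>Enumeration by multiplicity\<close>

lemma finite_down_closed_eq_atLeastAtMost:
  fixes A :: "nat set"
  assumes fin: "finite A" and sub: "A \<subseteq> {1..}" and down: "\<And>k n. n \<in> A \<Longrightarrow> 1 \<le> k \<Longrightarrow> k \<le> n \<Longrightarrow> k \<in> A"
  shows "A = {1..card A}"
proof (cases "A = {}")
  case False
  have "A = {1..Max A}"
  proof
    show "A \<subseteq> {1..Max A}" using sub fin by auto
    show "{1..Max A} \<subseteq> A" using down[OF Max_in[OF fin False]] by auto
  qed
  then show ?thesis by (metis card_atLeastAtMost diff_Suc_1 plus_1_eq_Suc add.commute Suc_eq_plus1)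
qed simp

locale multiplicity_function =
  fixes m :: "real \<Rightarrow> nat"
  assumes locally_finite: "\<And>u. finite {x. 0 < x \<and> x \<le> u \<and> m x > 0}"
begin

definition support :: "real \<Rightarrow> real set" where
  "support u = {x. 0 < x \<and> x \<le> u \<and> m x > 0}"

definition counting :: "real \<Rightarrow> nat" where
  "counting u = (\<Sum>x\<in>support u. m x)"

text \<open>The predicate under the definite description of \<open>zeta_ordinate\<close>, with
  \<open>m x\<close> in place of the sum of the orders of the zeros.\<close>

definition is_enumeration :: "(nat \<Rightarrow> real) \<Rightarrow> bool" where
  "is_enumeration \<gamma> \<longleftrightarrow> \<gamma> 0 = 0 \<and> (\<forall>n\<ge>1. 0 < \<gamma> n) \<and> mono_on {1..} \<gamma> \<and>
     (\<forall>x>0. finite {n. 1 \<le> n \<and> \<gamma> n = x} \<and> card {n. 1 \<le> n \<and> \<gamma> n = x} = m x)"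

lemma finite_support [simp, intro]: "finite (support u)"
  unfolding support_def by (rule locally_finite)

lemma counting_mono: "u \<le> v \<Longrightarrow> counting u \<le> counting v"
  unfolding counting_def by (rule sum_mono2[OF finite_support]) (auto simp: support_def)

text \<open>By monotonicity the indices with \<open>\<gamma> n \<le> x\<close> form an initial
  segment, and the multiplicities give it \<open>counting x\<close> elements. Uniqueness and all
  later counting rest on this equivalence.\<close>

lemma enumeration_le_iff:
  assumes e: "is_enumeration \<gamma>" and "n \<ge> 1" "x > 0"
  shows "\<gamma> n \<le> x \<longleftrightarrow> n \<le> counting x"
proof -
  define A where "A = {n. 1 \<le> n \<and> \<gamma> n \<le> x}"
  have pos: "0 < \<gamma> n" if "n \<ge> 1" for n using e that by (auto simp: is_enumeration_def)
  have fin: "finite {n. 1 \<le> n \<and> \<gamma> n = y}" "card {n. 1 \<le> n \<and> \<gamma> n = y} = m y" if "y > 0" for y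
    using e that by (auto simp: is_enumeration_def)
  have A: "A = (\<Union>y\<in>support x. {n. 1 \<le> n \<and> \<gamma> n = y})"
  proof
    show "A \<subseteq> (\<Union>y\<in>support x. {n. 1 \<le> n \<and> \<gamma> n = y})"
    proof
      fix n assume n: "n \<in> A"
      then have g: "\<gamma> n > 0" using pos by (auto simp: A_def)
      have "n \<in> {k. 1 \<le> k \<and> \<gamma> k = \<gamma> n}" using n by (auto simp: A_def)
      then have "card {k. 1 \<le> k \<and> \<gamma> k = \<gamma> n} > 0"
        using fin(1)[OF g] unfolding card_gt_0_iff by blast
      then have "m (\<gamma> n) > 0" unfolding fin(2)[OF g] .
      then show "n \<in> (\<Union>y\<in>support x. {n. 1 \<le> n \<and> \<gamma> n = y})"
        using n g by (auto simp: A_def support_def)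
    qed
  qed (auto simp: A_def support_def)
  have sp: "y > 0" if "y \<in> support x" for y using that by (simp add: support_def)
  have finA: "finite A" unfolding A by (intro finite_UN_I finite_support fin(1) sp)
  have "card A = (\<Sum>y\<in>support x. card {n. 1 \<le> n \<and> \<gamma> n = y})"
    unfolding A
  proof (rule card_UN_disjoint[OF finite_support])
    show "\<forall>y\<in>support x. finite {n. 1 \<le> n \<and> \<gamma> n = y}" using fin(1) sp by blast
  qed auto
  also have "\<dots> = counting x" unfolding counting_def
  proof (rule sum.cong)
    show "card {n. 1 \<le> n \<and> \<gamma> n = y} = m y" if "y \<in> support x" for y using fin(2)[OF sp[OF that]] .
  qed simp
  finally have "A = {1..counting x}"
  proof -
    assume c: "card A = counting x"
    have "k \<in> A" if "n \<in> A" "1 \<le> k" "k \<le> n" for k n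
    proof -
      have "\<gamma> k \<le> \<gamma> n" using e that by (auto simp: is_enumeration_def A_def mono_on_def)
      then show ?thesis using that by (auto simp: A_def)
    qed
    note dc = this
    have "A = {1..card A}"
      by (rule finite_down_closed_eq_atLeastAtMost[OF finA _ dc]) (auto simp: A_def)
    then show ?thesis by (simp only: c)
  qed
  then show ?thesis using assms by (auto simp: A_def set_eq_iff)
qed

lemma counting_attained:
  assumes "counting u > 0"
  obtains x where "x \<in> support u" "counting x = counting u"
proof
  have ne: "support u \<noteq> {}" using assms by (auto simp: counting_def)
  define x where "x = Max (support u)"
  show "x \<in> support u" unfolding x_def by (rule Max_in[OF finite_support ne])
  then have "support x = support u" using Max_ge[OF finite_support, of _ u] by (fastforce simp: support_def x_def)
  then show "counting x = counting u" by (simp add: counting_def)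
qed

lemma counting_left:
  assumes x: "x > 0"
  shows "counting x = (\<Sum>y\<in>support x - {x}. m y) + m x"
proof (cases "x \<in> support x")
  case True
  then show ?thesis unfolding counting_def by (simp add: sum.remove[OF finite_support True] add.commute)
next
  case False
  then have "m x = 0" using x by (auto simp: support_def)
  then show ?thesis using False by (simp add: counting_def)
qed

text \<open>The n-th value is the least \<open>x\<close> with \<open>n \<le> counting x\<close>. The
  minimum exists because \<open>counting\<close> is a step function with finitely many jumps up to
  any bound.\<close>

lemma enumeration_exists:
  assumes unb: "\<And>k. \<exists>u. counting u \<ge> k"
  shows "\<exists>\<gamma>. is_enumeration \<gamma>"
proof -
  have "\<exists>g>0. \<forall>x>0. g \<le> x \<longleftrightarrow> n \<le> counting x" if n: "n \<ge> 1" for n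
  proof -
    obtain u where u: "counting u \<ge> n" using unb by blast
    then obtain x0 where x0: "x0 \<in> support u" "counting x0 = counting u"
      using counting_attained[of u] n by force
    define C where "C = {x \<in> support u. n \<le> counting x}"
    have C: "finite C" "C \<noteq> {}" using x0 u by (auto simp: C_def)
    define g where "g = Min C"
    have gC: "g \<in> C" unfolding g_def by (rule Min_in[OF C])
    show ?thesis
    proof (intro exI[of _ g] conjI allI impI iffI)
      show "g > 0" using gC by (auto simp: C_def support_def)
      show "n \<le> counting x" if "g \<le> x" for x using counting_mono[OF that] gC by (auto simp: C_def)
      fix x :: real assume x: "n \<le> counting x"
      then obtain y where y: "y \<in> support x" "counting y = counting x"
        using counting_attained[of x] n by force
      show "g \<le> x"
      proof (cases "y \<le> u")
        case True
        then have "y \<in> C" using y x by (auto simp: C_def support_def)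
        then have "g \<le> y" unfolding g_def using C by simp
        then show ?thesis using y by (auto simp: support_def)
      next
        case False
        then show ?thesis using gC y by (auto simp: C_def support_def)
      qed
    qed
  qed
  then obtain g where g: "\<And>n. n \<ge> 1 \<Longrightarrow> g n > 0" "\<And>n x. n \<ge> 1 \<Longrightarrow> x > 0 \<Longrightarrow> g n \<le> x \<longleftrightarrow> n \<le> counting x"
    by metis
  define \<gamma> where "\<gamma> n = (if n = 0 then 0 else g n)" for n
  have "is_enumeration \<gamma>"
    unfolding is_enumeration_def
  proof (intro conjI allI impI)
    show "\<gamma> 0 = 0" "\<And>n. 1 \<le> n \<Longrightarrow> 0 < \<gamma> n" using g(1) by (auto simp: \<gamma>_def)
    show "mono_on {1..} \<gamma>"
    proof (rule mono_onI)
      fix r s :: nat assume *: "r \<in> {1..}" "s \<in> {1..}" "r \<le> s"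
      then have "s \<le> counting (g s)" using g(1)[of s] g(2)[of s "g s"] by auto
      then show "\<gamma> r \<le> \<gamma> s" using * g(2)[of r "g s"] g(1)[of s] by (auto simp: \<gamma>_def)
    qed
    fix x :: real assume x: "x > 0"
    \<comment> \<open>\<open>M\<close> counts the values strictly below \<open>x\<close>, so the
      indices with value \<open>x\<close> are those from \<open>M + 1\<close> to
      \<open>counting x\<close>.\<close>
    define M where "M = (\<Sum>y\<in>support x - {x}. m y)"
    have lt: "g n < x \<longleftrightarrow> n \<le> M" if n: "n \<ge> 1" for n
    proof
      assume l: "g n < x"
      have "n \<le> counting (g n)" using g(1)[OF n] g(2)[OF n, of "g n"] by simp
      also have "\<dots> \<le> M" unfolding counting_def M_def using l by (intro sum_mono2 finite_Diff finite_support) (auto simp: support_def)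
      finally show "n \<le> M" .
    next
      assume l: "n \<le> M"
      have ne: "support x - {x} \<noteq> {}"
      proof
        assume e: "support x - {x} = {}"
        have "M = 0" unfolding M_def e by simp
        with l n show False by simp
      qed
      define y where "y = Max (support x - {x})"
      have yin: "y \<in> support x - {x}" unfolding y_def by (rule Max_in) (use ne in auto)
      have "support x - {x} \<subseteq> support y"
      proof
        fix w assume w: "w \<in> support x - {x}"
        then have "w \<le> y" unfolding y_def by (intro Max_ge) auto
        then show "w \<in> support y" using w by (auto simp: support_def)
      qed
      then have "M \<le> counting y" unfolding M_def counting_def by (intro sum_mono2) auto
      then have "g n \<le> y" using g(2)[OF n, of y] l yin by (auto simp: support_def)
      then show "g n < x" using yin by (auto simp: support_def)
    qed
    have "{n. 1 \<le> n \<and> \<gamma> n = x} = {M + 1..counting x}"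
    proof (rule set_eqI)
      fix n
      show "n \<in> {n. 1 \<le> n \<and> \<gamma> n = x} \<longleftrightarrow> n \<in> {M + 1..counting x}"
        using lt[of n] g(2)[of n x] x by (cases "n = 0") (auto simp: \<gamma>_def)
    qed
    then show "finite {n. 1 \<le> n \<and> \<gamma> n = x}" "card {n. 1 \<le> n \<and> \<gamma> n = x} = m x"
      using counting_left[OF x] by (auto simp: M_def)
  qed
  then show ?thesis by blast
qed

lemma enumeration_unique:
  assumes unb: "\<And>k. \<exists>u. counting u \<ge> k" and e: "is_enumeration \<gamma>" "is_enumeration \<delta>"
  shows "\<gamma> = \<delta>"
proof
  fix n
  show "\<gamma> n = \<delta> n"
  proof (cases "n = 0")
    case False
    then have n: "n \<ge> 1" by simp
    have p: "\<gamma> n > 0" "\<delta> n > 0" using e n by (auto simp: is_enumeration_def)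
    have "\<gamma> n \<le> x \<longleftrightarrow> \<delta> n \<le> x" if "x > 0" for x
      using enumeration_le_iff[OF e(1) n that] enumeration_le_iff[OF e(2) n that] by simp
    from this[OF p(1)] this[OF p(2)] show ?thesis by simp
  qed (use e in \<open>simp add: is_enumeration_def\<close>)
qed

end

section \<open>The logarithm of zeta under the Riemann hypothesis\<close>

lemma continuous_Ints_constant:
  fixes h :: "'a::metric_space \<Rightarrow> real"
  assumes "connected S" "continuous_on S h" "\<And>x. x \<in> S \<Longrightarrow> h x \<in> \<int>"
  shows "\<exists>k::int. \<forall>x\<in>S. h x = of_int k"
proof (cases "S = {}")
  case False
  have "h constant_on S"
  proof (rule continuous_discrete_range_constant[OF assms(1,2)])
    fix x assume x: "x \<in> S"
    have "1 \<le> norm (h y - h x)" if "y \<in> S" "h y \<noteq> h x" for y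
      using assms(3)[OF x] assms(3)[OF that(1)] that(2)
      by (metis Ints_diff Ints_nonzero_abs_ge1 eq_iff_diff_eq_0 real_norm_def)
    then show "\<exists>e>0. \<forall>y. y \<in> S \<and> h y \<noteq> h x \<longrightarrow> e \<le> norm (h y - h x)"
      by (intro exI[of _ 1]) auto
  qed
  then obtain c where c: "\<And>x. x \<in> S \<Longrightarrow> h x = c" by (auto simp: constant_on_def)
  obtain x where x: "x \<in> S" using False by auto
  obtain k where "h x = of_int k" using assms(3)[OF x] by (auto elim: Ints_cases)
  then have "\<forall>x\<in>S. h x = of_int k" using c x by auto
  then show ?thesis by blast
qed simp

text \<open>Two logarithms of the same number differ by an integer multiple of
  \<open>2 * pi * \<i>\<close>, and a continuous integer is constant on a connected set. All
  branches below are matched in this way.\<close>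

lemma exp_eq_imp_diff_constant:
  fixes f g :: "complex \<Rightarrow> complex"
  assumes "connected S" "continuous_on S f" "continuous_on S g" "\<And>z. z \<in> S \<Longrightarrow> exp (f z) = exp (g z)"
  shows "\<exists>k::int. \<forall>z\<in>S. f z = g z + of_real (2 * pi * of_int k) * \<i>"
proof -
  define h where "h z = Im (f z - g z) / (2 * pi)" for z
  have fg: "Re (f z) = Re (g z) \<and> h z \<in> \<int>" if z: "z \<in> S" for z
  proof -
    obtain n :: int where n: "f z = g z + of_real (of_int (2 * n) * pi) * \<i>"
      using assms(4)[OF z] unfolding exp_eq by blast
    then have "Re (f z) = Re (g z)" by simp
    moreover have "h z = of_int n" unfolding h_def n by simp
    ultimately show ?thesis by simp
  qed
  have "continuous_on S h" unfolding h_def by (intro continuous_intros assms) auto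
  from continuous_Ints_constant[OF assms(1) this] fg
  obtain k where k: "\<And>z. z \<in> S \<Longrightarrow> h z = of_int k" by blast
  have "f z = g z + of_real (2 * pi * of_int k) * \<i>" if z: "z \<in> S" for z
  proof -
    have "Im (f z) - Im (g z) = 2 * pi * of_int k" using k[OF z] by (simp add: h_def field_simps)
    then show ?thesis using fg[OF z] by (simp add: complex_eq_iff)
  qed
  then show ?thesis by blast
qed

lemma continuous_on_log_zeta:
  assumes \<delta>: "\<delta> > 1"
  shows "continuous_on {s. Re s \<ge> \<delta>} log_zeta"
proof (rule uniform_limit_theorem)
  show "uniform_limit {s. Re s \<ge> \<delta>} (\<lambda>n s. \<Sum>k<n. of_real (log_zeta_coeff k) * of_nat k powr (- s)) log_zeta sequentially"
    unfolding log_zeta_def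
  proof (rule Weierstrass_m_test)
    show "summable (\<lambda>n. real n powr (- \<delta>))" using \<delta> by (subst summable_real_powr_iff) auto
    fix n and s :: complex assume "s \<in> {s. Re s \<ge> \<delta>}"
    then have "real n powr (- Re s) \<le> real n powr (- \<delta>)" by (cases "n = 0") (auto intro!: powr_mono)
    then show "norm (of_real (log_zeta_coeff n) * of_nat n powr (- s) :: complex) \<le> real n powr (- \<delta>)"
      using norm_log_zeta_term_le[of n s] by (simp add: norm_nat_powr)
  qed
  show "\<forall>\<^sub>F n in sequentially. continuous_on {s. Re s \<ge> \<delta>} (\<lambda>s. \<Sum>k<n. of_real (log_zeta_coeff k) * of_nat k powr (- s))"
  proof (rule always_eventually, intro allI continuous_on_sum)
    fix n k :: nat assume "k \<in> {..<n}"
    show "continuous_on {s. Re s \<ge> \<delta>} (\<lambda>s. of_real (log_zeta_coeff k) * of_nat k powr (- s) :: complex)"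
    proof (cases "k = 0")
      case False
      then show ?thesis by (simp add: powr_def) (intro continuous_intros)
    qed simp
  qed
qed simp

locale RH =
  assumes RH: Riemann_hypothesis
begin

text \<open>Under the hypothesis this convex set contains no zero, and the pole at 1 lies outside,
  so a single branch of log zeta lives on all of it.\<close>

definition quarter :: "complex set" where
  "quarter = {s. Re s > 1/2 \<and> Im s > 0}"

lemma open_quarter: "open quarter"
  unfolding quarter_def Collect_conj_eq by (intro open_Int open_halfspace_Re_gt open_halfspace_Im_gt)

lemma convex_quarter: "convex quarter"
  unfolding quarter_def Collect_conj_eq by (intro convex_Int convex_halfspace_Re_gt convex_halfspace_Im_gt)

lemma zeta_zero_Re: "zeta s = 0 \<Longrightarrow> Im s > 0 \<Longrightarrow> Re s = 1/2"
  using Riemann_hypothesis_zeros[OF RH, of s] by simp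

text \<open>Convexity and the absence of zeros give some branch; adding a multiple of
  \<open>2 * pi * \<i>\<close> makes it agree with the Dirichlet series to the right of
  \<open>Re s = 3/2\<close>.\<close>

lemma log_branch_exists:
  "\<exists>F. F holomorphic_on quarter \<and> (\<forall>s\<in>quarter. exp (F s) = zeta s) \<and>
       (\<forall>s. Re s \<ge> 3/2 \<and> Im s > 0 \<longrightarrow> F s = log_zeta s)"
proof -
  have hz: "zeta holomorphic_on quarter" by (rule holomorphic_zeta) (auto simp: quarter_def)
  have nz: "zeta s \<noteq> 0" if "s \<in> quarter" for s
    using zeta_zero_Re[of s] that by (auto simp: quarter_def)
  obtain G where G: "G holomorphic_on quarter" "\<And>s. s \<in> quarter \<Longrightarrow> zeta s = exp (G s)"
    by (rule contractible_imp_holomorphic_log[OF hz convex_imp_contractible[OF convex_quarter], of thesis]) (use nz that in simp_all)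
  define V where "V = {s. Re s \<ge> 3/2 \<and> Im s > 0}"
  have V: "V \<subseteq> quarter" by (auto simp: V_def quarter_def)
  have "convex V" unfolding V_def Collect_conj_eq by (intro convex_Int convex_halfspace_Re_ge convex_halfspace_Im_gt)
  have "\<exists>k::int. \<forall>z\<in>V. log_zeta z = G z + of_real (2 * pi * of_int k) * \<i>"
  proof (rule exp_eq_imp_diff_constant[OF convex_connected[OF \<open>convex V\<close>]])
    show "continuous_on V log_zeta"
      by (rule continuous_on_subset[OF continuous_on_log_zeta[of "3/2"]]) (auto simp: V_def)
    show "continuous_on V G"
      by (rule continuous_on_subset[OF holomorphic_on_imp_continuous_on[OF G(1)] V])
    show "exp (log_zeta z) = exp (G z)" if "z \<in> V" for z
      using exp_log_zeta[of z] G(2)[of z] V that by (auto simp: V_def)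
  qed
  then obtain k :: int where k: "\<And>z. z \<in> V \<Longrightarrow> log_zeta z = G z + of_real (2 * pi * of_int k) * \<i>"
    by blast
  define F where "F s = G s + of_real (2 * pi * of_int k) * \<i>" for s
  have "exp (F s) = exp (G s)" for s
  proof -
    have "F s = G s + of_real (of_int (2 * k) * pi) * \<i>" by (simp add: F_def)
    then show ?thesis unfolding exp_eq by blast
  qed
  moreover have "F holomorphic_on quarter" unfolding F_def by (intro holomorphic_intros G)
  moreover have "F s = log_zeta s" if "Re s \<ge> 3/2" "Im s > 0" for s
    using k[of s] that by (simp add: F_def V_def)
  ultimately show ?thesis using G(2) by (intro exI[of _ F]) simp
qed

definition logz :: "complex \<Rightarrow> complex" where
  "logz = (SOME F. F holomorphic_on quarter \<and> (\<forall>s\<in>quarter. exp (F s) = zeta s) \<and>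
       (\<forall>s. Re s \<ge> 3/2 \<and> Im s > 0 \<longrightarrow> F s = log_zeta s))"

lemma logz_properties:
  "logz holomorphic_on quarter \<and> (\<forall>s\<in>quarter. exp (logz s) = zeta s) \<and>
     (\<forall>s. Re s \<ge> 3/2 \<and> Im s > 0 \<longrightarrow> logz s = log_zeta s)"
  unfolding logz_def by (rule someI_ex[OF log_branch_exists])

lemma logz: "logz holomorphic_on quarter" "s \<in> quarter \<Longrightarrow> exp (logz s) = zeta s"
  "Re s \<ge> 3/2 \<Longrightarrow> Im s > 0 \<Longrightarrow> logz s = log_zeta s"
  using logz_properties by blast+

definition zmult :: "real \<Rightarrow> nat" where
  "zmult x = (\<Sum>\<rho> | zeta \<rho> = 0 \<and> Im \<rho> = x. nat (zorder zeta \<rho>))"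

lemma zmult_eq:
  assumes "x > 0"
  shows "zmult x = (if zeta (Complex (1/2) x) = 0 then nat (zorder zeta (Complex (1/2) x)) else 0)"
proof -
  have "\<rho> = Complex (1/2) x" if "zeta \<rho> = 0" "Im \<rho> = x" for \<rho>
    using zeta_zero_Re[of \<rho>] that assms by (simp add: complex_eq_iff)
  note u = this
  show ?thesis
  proof (cases "zeta (Complex (1/2) x) = 0")
    case True
    then have "{\<rho>. zeta \<rho> = 0 \<and> Im \<rho> = x} = {Complex (1/2) x}"
      using u by (intro set_eqI iffI) (simp_all add: u)
    with True show ?thesis by (simp add: zmult_def)
  next
    case False
    then have e: "{\<rho>. zeta \<rho> = 0 \<and> Im \<rho> = x} = {}" using u by fastforce
    show ?thesis unfolding zmult_def e using False by simp
  qed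
qed

lemma local_factorization:
  assumes "x > 0"
  obtains r g where "r > 0" "r < x" "r \<le> 1/4" "g holomorphic_on ball (Complex (1/2) x) r"
    "\<And>s. s \<in> ball (Complex (1/2) x) r \<Longrightarrow> zeta s = g s * (s - Complex (1/2) x) ^ zmult x"
    "\<And>s. s \<in> ball (Complex (1/2) x) r \<Longrightarrow> g s \<noteq> 0"
    "zmult x > 0 \<longleftrightarrow> zeta (Complex (1/2) x) = 0"
proof -
  let ?z = "Complex (1/2) x"
  have 2: "\<exists>w\<in>- {1}. zeta w \<noteq> 0"
    using zeta_nonzero_Re_gt_1[of 2] by (intro bexI[of _ 2]) auto
  have z1: "?z \<in> - {1}" using assms by (auto simp: complex_eq_iff)
  have c: "connected (- {1::complex})" by (rule connected_punctured_universe) simp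
  have hz: "zeta holomorphic_on - {1}" by (rule holomorphic_zeta) simp
  note ex = zorder_exist_zero[OF hz open_Compl[OF closed_singleton] c z1 2]
  from ex have ord: "if zeta ?z = 0 then zorder zeta ?z > 0 else zorder zeta ?z = 0" by (rule conjunct1)
  from ex obtain r where r: "r > 0" "zor_poly zeta ?z holomorphic_on cball ?z r"
     "\<And>w. w \<in> cball ?z r \<Longrightarrow> zeta w = zor_poly zeta ?z w * (w - ?z) ^ nat (zorder zeta ?z) \<and> zor_poly zeta ?z w \<noteq> 0"
    by blast
  have m: "zmult x = nat (zorder zeta ?z)" using assms ord by (cases "zeta ?z = 0") (simp_all add: zmult_eq)
  \<comment> \<open>The bounds \<open>x / 2\<close> and \<open>1/4\<close> keep the ball in the
    upper half-plane and to the right of \<open>Re s = 0\<close>.\<close>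
  define r' where "r' = min r (min (x / 2) (1/4))"
  show ?thesis
  proof (rule that[of r' "zor_poly zeta ?z"])
    show "r' > 0" "r' < x" "r' \<le> 1/4" using r assms by (auto simp: r'_def)
    have sub: "ball ?z r' \<subseteq> cball ?z r" by (auto simp: r'_def)
    show "zor_poly zeta ?z holomorphic_on ball ?z r'" by (rule holomorphic_on_subset[OF r(2) sub])
    show "zeta s = zor_poly zeta ?z s * (s - ?z) ^ zmult x" "zor_poly zeta ?z s \<noteq> 0" if "s \<in> ball ?z r'" for s
      using r(3)[of s] that sub by (auto simp: m)
    show "zmult x > 0 \<longleftrightarrow> zeta ?z = 0" using ord by (cases "zeta ?z = 0") (simp_all add: m)
  qed
qed

sublocale multiplicity_function zmult
proof
  fix u :: real
  let ?f = "\<lambda>x. Complex (1/2) x"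
  have "finite {z \<in> ?f ` {0..u}. zeta z = 0}"
  proof (rule holomorphic_compact_finite_zeros[of zeta "- {1}"])
    show "zeta holomorphic_on - {1}" by (rule holomorphic_zeta) simp
    show "connected (- {1::complex})" by (rule connected_punctured_universe) simp
    show "compact (?f ` {0..u})"
      by (intro compact_continuous_image) (auto simp: Complex_eq intro!: continuous_intros)
    show "?f ` {0..u} \<subseteq> - {1}" by (auto simp: complex_eq_iff)
    \<comment> \<open>A constant value \<open>c\<close> would give
      \<open>zeta_num = c * (\<sigma> - 1)\<close> on the real axis, which tends to 0 at 1, against
      \<open>zeta_num_one\<close>.\<close>
    show "\<not> zeta constant_on - {1}"
    proof
      assume "zeta constant_on - {1}"
      then obtain c where c: "\<And>s. s \<noteq> 1 \<Longrightarrow> zeta s = c" by (auto simp: constant_on_def)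
      have "((\<lambda>\<sigma>. (\<sigma> - 1) * norm c - norm (zeta_num (Complex \<sigma> 0))) \<longlongrightarrow> (1 - 1) * norm c - norm (zeta_num (Complex 1 0))) (at_right 1)"
        by (intro tendsto_intros isCont_tendsto_compose[OF isCont_zeta_num] tendsto_Complex_at_right) auto
      moreover have "eventually (\<lambda>\<sigma>. (\<sigma> - 1) * norm c - norm (zeta_num (Complex \<sigma> 0)) = 0) (at_right (1::real))"
        using eventually_at_right_less[of 1]
      proof eventually_elim
        case (elim \<sigma>)
        have e: "Complex \<sigma> 0 - 1 = of_real (\<sigma> - 1)" by (simp add: complex_eq_iff)
        have "Complex \<sigma> 0 \<noteq> 1" using elim by (auto simp: complex_eq_iff)
        then have "zeta_num (Complex \<sigma> 0) / of_real (\<sigma> - 1) = c"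
          using c[of "Complex \<sigma> 0"] zeta_Re_gt_0[of "Complex \<sigma> 0"] elim unfolding e by simp
        then have "zeta_num (Complex \<sigma> 0) = c * of_real (\<sigma> - 1)" using elim
          by (simp add: field_simps del: of_real_diff)
        then show ?case using elim by (simp add: norm_mult del: of_real_diff)
      qed
      ultimately have "((\<lambda>\<sigma>::real. 0::real) \<longlongrightarrow> (1 - 1) * norm c - norm (zeta_num (Complex 1 0))) (at_right 1)"
        by (simp only: tendsto_cong)
      then show False by (simp add: tendsto_const_iff zeta_num_one)
    qed
  qed auto
  moreover have "?f ` {x. 0 < x \<and> x \<le> u \<and> zmult x > 0} \<subseteq> {z \<in> ?f ` {0..u}. zeta z = 0}"
    by (auto simp: zmult_eq split: if_splits)
  ultimately have "finite (?f ` {x. 0 < x \<and> x \<le> u \<and> zmult x > 0})" by (rule finite_subset[rotated])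
  then show "finite {x. 0 < x \<and> x \<le> u \<and> zmult x > 0}"
    by (rule finite_imageD) (auto intro!: inj_onI)
qed

end

section \<open>Growth of log zeta near the critical line\<close>

lemma borel_caratheodory:
  fixes f :: "complex \<Rightarrow> complex"
  assumes hol: "f holomorphic_on ball c R" and R: "R > 0" and M: "M > 0"
    and re: "\<And>z. z \<in> ball c R \<Longrightarrow> Re (f z) < M" and f0: "f c = 0" and z: "z \<in> ball c R"
  shows "norm (f z) \<le> 2 * M * dist c z / (R - dist c z)"
proof -
  define g where "g w = f (c + of_real R * w)" for w
  have maps: "c + of_real R * w \<in> ball c R" if "norm w < 1" for w
    using that R by (simp add: dist_norm norm_mult)
  have gh: "g holomorphic_on ball 0 1"
    unfolding g_def by (rule holomorphic_on_compose_gen[OF _ hol, unfolded o_def])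
      (use maps in \<open>auto intro!: holomorphic_intros\<close>)
  have reg: "Re (g w) < M" if "norm w < 1" for w unfolding g_def using re maps[OF that] by blast
  have den: "2 * of_real M - g w \<noteq> 0" if "norm w < 1" for w
    using reg[OF that] M by (auto simp: complex_eq_iff)
  \<comment> \<open>The Moebius map \<open>w / (2 * M - w)\<close> sends the half-plane
    \<open>Re w < M\<close> into the unit disc and fixes 0, so the Schwarz lemma applies to
    \<open>h\<close>.\<close>
  define h where "h w = g w / (2 * of_real M - g w)" for w
  have "h holomorphic_on ball 0 1"
    unfolding h_def by (intro holomorphic_intros gh) (use den in auto)
  moreover have "h 0 = 0" by (simp add: h_def g_def f0)
  moreover have "norm (h w) < 1" if w: "norm w < 1" for w
  proof -
    have "(norm (g w))\<^sup>2 < (norm (2 * of_real M - g w))\<^sup>2"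
    proof -
      have "(norm (2 * of_real M - g w))\<^sup>2 = (norm (g w))\<^sup>2 + 4 * M * (M - Re (g w))"
        unfolding cmod_power2 by (simp add: power2_eq_square algebra_simps)
      moreover have "4 * M * (M - Re (g w)) > 0" using reg[OF w] M by simp
      ultimately show ?thesis by simp
    qed
    then have "norm (g w) < norm (2 * of_real M - g w)" by (rule power2_less_imp_less) simp
    then show ?thesis using den[OF w] by (simp add: h_def norm_divide divide_less_eq)
  qed
  ultimately have sch: "norm (h w) \<le> norm w" if "norm w < 1" for w
    using Schwarz_Lemma(1)[of h w] that by auto
  define w where "w = (z - c) / of_real R"
  have nw: "norm w = dist c z / R" using R by (simp add: w_def norm_divide dist_norm norm_minus_commute)
  have w1: "norm w < 1" using z R by (simp add: nw)
  have fz: "f z = g w" using R by (simp add: g_def w_def)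
  have "g w = h w * (2 * of_real M - g w)" using den[OF w1] by (simp add: h_def)
  then have "g w = 2 * of_real M * h w - g w * h w" by (simp only: right_diff_distrib mult_ac)
  then have "norm (g w) = norm (2 * of_real M * h w - g w * h w)" by simp
  also have "\<dots> \<le> 2 * M * norm (h w) + norm (g w) * norm (h w)"
    using norm_triangle_ineq4[of "2 * of_real M * h w" "g w * h w"] M by (simp add: norm_mult)
  also have "\<dots> \<le> 2 * M * norm w + norm (g w) * norm w"
    using sch[OF w1] M by (intro add_mono mult_left_mono) auto
  finally have "norm (g w) * (1 - norm w) \<le> 2 * M * norm w" by (simp add: algebra_simps)
  then have "norm (g w) \<le> 2 * M * norm w / (1 - norm w)" using w1 by (simp add: le_divide_eq)
  also have "\<dots> = 2 * M * dist c z / (R - dist c z)"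
    using R z by (simp add: nw field_simps)
  finally show ?thesis by (simp add: fz)
qed

lemma norm_log_zeta_le:
  assumes "\<delta> > 1"
  obtains C where "\<And>s. Re s \<ge> \<delta> \<Longrightarrow> norm (log_zeta s) \<le> C" "C \<ge> 0"
proof
  have sm: "summable (\<lambda>n. real n powr (- \<delta>))" using assms by (subst summable_real_powr_iff) auto
  show "(\<Sum>n. real n powr (- \<delta>)) \<ge> 0" by (rule suminf_nonneg[OF sm]) simp
  fix s :: complex assume s: "Re s \<ge> \<delta>"
  show "norm (log_zeta s) \<le> (\<Sum>n. real n powr (- \<delta>))"
    unfolding log_zeta_def
  proof (rule norm_suminf_le[OF _ sm])
    fix n
    have "real n powr (- Re s) \<le> real n powr (- \<delta>)" using s by (cases "n = 0") (auto intro!: powr_mono)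
    then show "norm (of_real (log_zeta_coeff n) * of_nat n powr (- s) :: complex) \<le> real n powr (- \<delta>)"
      using norm_log_zeta_term_le[of n s] by (simp add: norm_nat_powr)
  qed
qed

context RH
begin

text \<open>Borel-Caratheodory in the disc of radius \<open>3/2\<close> about
  \<open>2 + \<i> * t\<close>, which touches the critical line. The real part of log zeta is
  \<open>ln (norm (zeta s))\<close>, at most \<open>ln t\<close> plus a constant there, and the
  point has distance \<open>\<sigma> - 1/2\<close> from the boundary of the disc.\<close>

lemma logz_bound:
  obtains C where "C > 0" "\<And>\<sigma> t. t \<ge> 3 \<Longrightarrow> 1/2 < \<sigma> \<Longrightarrow> \<sigma> \<le> 2 \<Longrightarrow> norm (logz (Complex \<sigma> t)) \<le> C * ln t / (\<sigma> - 1/2)"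
proof -
  obtain C where C: "\<And>s. Re s \<ge> 1/2 \<Longrightarrow> norm (zeta_num s) \<le> 1 + C * norm (s - 1) * norm s" "C \<ge> 0"
    using norm_zeta_num_le by blast
  obtain B where B: "\<And>s. Re s \<ge> 3/2 \<Longrightarrow> norm (log_zeta s) \<le> B" "B \<ge> 0"
    using norm_log_zeta_le[of "3/2"] by auto
  define C1 where "C1 = 2 + 7 * C"
  \<comment> \<open>Chosen so that \<open>D * ln t\<close> exceeds \<open>ln C1 + ln t + B\<close>
    as soon as \<open>ln t \<ge> 1\<close>; the last 1 makes the inequality strict.\<close>
  define D where "D = ln C1 + 1 + B + 1"
  have C1: "C1 \<ge> 1" using C by (simp add: C1_def)
  have D: "D \<ge> 1" using C1 B by (simp add: D_def)
  show ?thesis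
  proof (rule that[of "3 * D + 2 * B"])
    show "3 * D + 2 * B > 0" using D B by simp
    fix \<sigma> t :: real assume t: "t \<ge> 3" and \<sigma>: "1/2 < \<sigma>" "\<sigma> \<le> 2"
    have lt: "ln t \<ge> 1" using t exp_le by (subst ln_ge_iff) auto
    define c where "c = Complex 2 t"
    have inb: "Re s > 1/2 \<and> Re s < 7/2 \<and> Im s \<ge> 1 \<and> norm s \<le> t + 4" if "s \<in> ball c (3/2)" for s
    proof -
      have d: "norm (c - s) < 3/2" using that by (simp add: dist_norm)
      have "\<bar>Re (c - s)\<bar> < 3/2" "\<bar>Im (c - s)\<bar> < 3/2" using d abs_Re_le_cmod[of "c - s"] abs_Im_le_cmod[of "c - s"] by linarith+
      moreover have "norm s \<le> norm c + norm (s - c)" by (metis norm_triangle_sub)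
      moreover have "norm c \<le> 2 + t" using cmod_le[of c] t by (simp add: c_def)
      moreover have "Re (c - s) = 2 - Re s" "Im (c - s) = t - Im s" "norm (s - c) = norm (c - s)"
        by (simp_all add: c_def norm_minus_commute)
      ultimately show ?thesis using t d by (intro conjI) linarith+
    qed
    have sub: "ball c (3/2) \<subseteq> quarter" using inb by (fastforce simp: quarter_def)
    have up: "Re (logz s) \<le> ln C1 + ln t" if s: "s \<in> ball c (3/2)" for s
    proof -
      note i = inb[OF s]
      have s1: "norm (s - 1) \<ge> 1" using i abs_Im_le_cmod[of "s - 1"] by simp
      have "norm (zeta s) = norm (zeta_num s) / norm (s - 1)"
        using i by (simp add: zeta_Re_gt_0 norm_divide)
      also have "\<dots> \<le> (1 + C * norm (s - 1) * norm s) / norm (s - 1)"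
        using C(1)[of s] i by (intro divide_right_mono) auto
      also have "\<dots> = 1 / norm (s - 1) + C * norm s"
      proof -
        have "norm (s - 1) \<noteq> 0" using s1 by linarith
        then show ?thesis by (simp add: add_divide_distrib)
      qed
      also have "\<dots> \<le> 1 + C * (t + 4)"
        using s1 i C by (intro add_mono mult_left_mono) (auto simp: divide_le_eq_1)
      also have "\<dots> \<le> C1 * t"
      proof -
        have "C * (t + 4) \<le> C * (7 * t)" using t C by (intro mult_left_mono) auto
        then show ?thesis using t by (simp add: C1_def algebra_simps)
      qed
      finally have z: "norm (zeta s) \<le> C1 * t" .
      have "exp (Re (logz s)) = norm (zeta s)"
        using logz(2)[of s] s sub by (metis norm_exp_eq_Re subsetD)
      then have "Re (logz s) \<le> ln (C1 * t)" using z by (subst ln_ge_iff) (use C1 t in auto)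
      then show ?thesis using C1 t by (simp add: ln_mult)
    qed
    have lc: "norm (logz c) \<le> B" using logz(3)[of c] B(1)[of c] t by (simp add: c_def)
    define M where "M = D * ln t"
    have M: "M > 0" using D lt by (simp add: M_def)
    have M2: "ln C1 + ln t + B < M"
    proof -
      have "M = ln C1 * ln t + ln t + B * ln t + ln t" by (simp add: M_def D_def algebra_simps)
      moreover have "ln C1 * 1 \<le> ln C1 * ln t" using lt C1 by (intro mult_left_mono) auto
      moreover have "B * 1 \<le> B * ln t" using lt B by (intro mult_left_mono) auto
      ultimately show ?thesis using lt by linarith
    qed
    define z where "z = Complex \<sigma> t"
    have dz: "dist c z = 2 - \<sigma>"
    proof -
      have "c - z = of_real (2 - \<sigma>)" by (simp add: c_def z_def complex_eq_iff)
      then show ?thesis using \<sigma> unfolding dist_norm by (simp only: norm_of_real)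
    qed
    have zin: "z \<in> ball c (3/2)" using \<sigma> by (simp add: dz)
    have "norm (logz z - logz c) \<le> 2 * M * dist c z / (3/2 - dist c z)"
    proof (rule borel_caratheodory[where f = "\<lambda>s. logz s - logz c"])
      show "(\<lambda>s. logz s - logz c) holomorphic_on ball c (3/2)"
        by (intro holomorphic_intros holomorphic_on_subset[OF logz(1) sub])
      show "Re (logz s - logz c) < M" if "s \<in> ball c (3/2)" for s
        using up[OF that] lc abs_Re_le_cmod[of "logz c"] M2 by simp
    qed (use M zin in auto)
    also have "\<dots> \<le> 2 * M * (3/2) / (\<sigma> - 1/2)"
      unfolding dz using \<sigma> M by (intro frac_le mult_left_mono) auto
    finally have "norm (logz z - logz c) \<le> 3 * M / (\<sigma> - 1/2)" by simp
    moreover have "norm (logz z) \<le> norm (logz z - logz c) + norm (logz c)"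
      by (metis add.commute norm_triangle_sub)
    moreover have "B \<le> 2 * B * ln t / (\<sigma> - 1/2)"
    proof -
      have "B * (\<sigma> - 1/2) \<le> B * (2 * ln t)" using \<sigma> lt B by (intro mult_left_mono) auto
      then show ?thesis using \<sigma> by (simp add: le_divide_eq algebra_simps)
    qed
    ultimately have "norm (logz z) \<le> 3 * M / (\<sigma> - 1/2) + 2 * B * ln t / (\<sigma> - 1/2)" using lc by linarith
    also have "\<dots> = (3 * D + 2 * B) * ln t / (\<sigma> - 1/2)"
      by (simp add: M_def add_divide_distrib[symmetric] algebra_simps)
    finally show "norm (logz (Complex \<sigma> t)) \<le> (3 * D + 2 * B) * ln t / (\<sigma> - 1/2)" by (simp add: z_def)
  qed
qed

end

section \<open>Boundary values on the critical line\<close>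

definition log_gamma_factor :: "complex \<Rightarrow> complex" where
  "log_gamma_factor s = ln_Gamma (s / 2) - s / 2 * of_real (ln pi)"

lemma exp_log_gamma_factor: "Re s > 0 \<Longrightarrow> exp (log_gamma_factor s) = gamma_factor s"
proof -
  assume s: "Re s > 0"
  have "s / 2 \<notin> \<int>\<^sub>\<le>\<^sub>0" using s by (auto dest!: nonpos_Ints_Re_Im)
  then have "Gamma (s / 2) = exp (ln_Gamma (s / 2))" by (simp add: Gamma_complex_altdef)
  then have "gamma_factor s = exp (log_gamma_factor s)"
    by (simp add: gamma_factor_def log_gamma_factor_def powr_def Ln_of_real add.commute flip: exp_add)
  then show ?thesis ..
qed

lemma continuous_on_log_gamma_factor: "continuous_on {s. Re s > 0} log_gamma_factor"
proof -
  have "continuous_on {s. Re s > 0} (\<lambda>s. ln_Gamma (s / 2) :: complex)"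
    by (rule continuous_on_compose2[OF continuous_on_ln_Gamma_complex[of "- \<real>\<^sub>\<le>\<^sub>0"]])
       (auto intro!: continuous_intros simp: complex_nonpos_Reals_iff)
  then show ?thesis unfolding log_gamma_factor_def by (intro continuous_intros) auto
qed

lemma Im_log_gamma_factor: "Im (log_gamma_factor (Complex (1/2) t)) = theta t"
proof -
  have "Complex (1 / 2) t / 2 = Complex (1 / 4) (t / 2)" by (simp add: complex_eq_iff)
  then show ?thesis by (simp add: log_gamma_factor_def theta_eq)
qed

lemma Im_Ln_imaginary: "y \<noteq> 0 \<Longrightarrow> Im (Ln (Complex 0 y)) = sgn y * pi / 2"
proof -
  assume y: "y \<noteq> 0"
  have "Ln (Complex 0 y) = Complex (ln \<bar>y\<bar>) (sgn y * pi / 2)"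
  proof (rule Ln_unique)
    show "exp (Complex (ln \<bar>y\<bar>) (sgn y * pi / 2)) = Complex 0 y"
      using y by (cases "y > 0") (auto simp: exp_eq_polar complex_eq_iff)
    show "- pi < Im (Complex (ln \<bar>y\<bar>) (sgn y * pi / 2))" "Im (Complex (ln \<bar>y\<bar>) (sgn y * pi / 2)) \<le> pi"
      using pi_gt_zero by (auto simp: sgn_if)
  qed
  then show ?thesis by simp
qed

lemma tendsto_Complex_shift: "((\<lambda>\<epsilon>. Complex (a + \<epsilon>) u) \<longlongrightarrow> Complex a u) (at_right 0)"
proof -
  have "((\<lambda>\<epsilon>. Complex (a + \<epsilon>) u) \<longlongrightarrow> Complex (a + 0) u) (at_right 0)"
    by (intro tendsto_Complex tendsto_intros)
  then show ?thesis by simp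
qed

context RH
begin

lemma counting_right:
  assumes "x > 0" "x \<le> u" "\<And>y. x < y \<Longrightarrow> y \<le> u \<Longrightarrow> zmult y = 0"
  shows "counting u = counting x"
proof -
  have "support u = support x" using assms by (force simp: support_def)
  then show ?thesis by (simp add: counting_def)
qed

lemma counting_before:
  assumes "0 < u" "u < x" "\<And>y. u < y \<Longrightarrow> y < x \<Longrightarrow> zmult y = 0"
  shows "counting x = counting u + zmult x"
proof -
  have "support x - {x} = support u"
  proof (intro set_eqI iffI)
    fix y assume y: "y \<in> support x - {x}"
    then have "y \<le> u" using assms(3)[of y] by (force simp: support_def)
    then show "y \<in> support u" using y by (auto simp: support_def)
  qed (use assms in \<open>auto simp: support_def\<close>)
  then show ?thesis using counting_left[of x] assms by (simp add: counting_def)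
qed

text \<open>Near \<open>1/2 + i x\<close>, \<open>log zeta\<close> is \<open>zmult x\<close> times \<open>Ln (s - 1/2 - i x)\<close> plus a holomorphic function; since
  \<open>gamma_factor * zeta\<close> is real on the critical line, the argument is \<open>- theta\<close> up to a locally constant
  term that jumps by \<open>pi\<close> times the multiplicity.\<close>

lemma boundary_local:
  assumes x: "x > 0"
  shows "\<exists>\<delta> c B. \<delta> > 0 \<and> \<delta> < x \<and>
    (\<forall>u. \<bar>u - x\<bar> < \<delta> \<and> (u \<noteq> x \<or> zmult x = 0) \<longrightarrow>
      ((\<lambda>\<epsilon>. Im (logz (Complex (1/2 + \<epsilon>) u))) \<longlongrightarrow> c + real (zmult x) * (sgn (u - x) * pi / 2) - theta u) (at_right 0)) \<and>
    (\<forall>\<epsilon> u. 0 < \<epsilon> \<and> \<epsilon> < \<delta> \<and> \<bar>u - x\<bar> < \<delta> \<longrightarrow> \<bar>Im (logz (Complex (1/2 + \<epsilon>) u))\<bar> \<le> B) \<and>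
    (\<forall>u. \<bar>u - x\<bar> < \<delta> \<and> u \<noteq> x \<longrightarrow> zmult u = 0)"
proof -
  define z where "z = Complex (1/2) x"
  define m where "m = zmult x"
  obtain r g where r: "r > 0" "r < x" "r \<le> 1/4" and g: "g holomorphic_on ball z r"
    "\<And>s. s \<in> ball z r \<Longrightarrow> zeta s = g s * (s - z) ^ m"
    "\<And>s. s \<in> ball z r \<Longrightarrow> g s \<noteq> 0"
    by (rule local_factorization[OF x, folded z_def m_def]) (rule that)
  have inb: "Re s > 0 \<and> Im s > 0" if "s \<in> ball z r" for s
  proof -
    have "norm (z - s) < r" using that by (simp add: dist_norm)
    then have "\<bar>Re (z - s)\<bar> < r" "\<bar>Im (z - s)\<bar> < r"
      using abs_Re_le_cmod[of "z - s"] abs_Im_le_cmod[of "z - s"] by linarith+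
    moreover have "Re (z - s) = 1/2 - Re s" "Im (z - s) = x - Im s" by (simp_all add: z_def)
    ultimately show ?thesis using r by (intro conjI) linarith+
  qed
  have gf: "gamma_factor holomorphic_on ball z r"
    using inb by (intro holomorphic_gamma_factor) (force dest!: nonpos_Ints_Re_Im)
  have gf0: "gamma_factor s \<noteq> 0" if "s \<in> ball z r" for s
    using inb[OF that] by (intro gamma_factor_nonzero) (force dest!: nonpos_Ints_Re_Im)
  have hg: "(\<lambda>s. g s * gamma_factor s) holomorphic_on ball z r" by (intro holomorphic_intros g gf)
  have nzg: "g s * gamma_factor s \<noteq> 0" if "s \<in> ball z r" for s using g(3)[OF that] gf0[OF that] by simp
  obtain l where l: "l holomorphic_on ball z r" "\<And>s. s \<in> ball z r \<Longrightarrow> g s * gamma_factor s = exp (l s)"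
    by (rule contractible_imp_holomorphic_log[OF hg convex_imp_contractible[OF convex_ball], of thesis]) (use nzg that in simp_all)
  \<comment> \<open>On the right half of the ball \<open>logz\<close> is defined and
    \<open>Ln (s - z)\<close> is continuous, so the two logarithms of
    \<open>zeta * gamma_factor\<close> can be compared.\<close>
  define H where "H = ball z r \<inter> {s. Re s > 1/2}"
  have "convex H" unfolding H_def by (intro convex_Int convex_ball convex_halfspace_Re_gt)
  have Hq: "H \<subseteq> quarter" "H \<subseteq> {s. Re s > 0}" using inb by (auto simp: H_def quarter_def)
  have contl: "continuous_on (ball z r) l" by (rule holomorphic_on_imp_continuous_on[OF l(1)])
  have "\<exists>k::int. \<forall>s\<in>H. logz s + log_gamma_factor s = (l s + of_nat m * Ln (s - z)) + of_real (2 * pi * of_int k) * \<i>"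
  proof (rule exp_eq_imp_diff_constant[OF convex_connected[OF \<open>convex H\<close>]])
    show "continuous_on H (\<lambda>s. logz s + log_gamma_factor s)"
      by (intro continuous_intros continuous_on_subset[OF holomorphic_on_imp_continuous_on[OF logz(1)] Hq(1)]
           continuous_on_subset[OF continuous_on_log_gamma_factor Hq(2)])
    show "continuous_on H (\<lambda>s. l s + of_nat m * Ln (s - z))"
    proof (intro continuous_intros continuous_on_subset[OF contl])
      show "\<And>s. s \<in> H \<Longrightarrow> s - z \<notin> \<real>\<^sub>\<le>\<^sub>0" by (auto simp: H_def z_def complex_nonpos_Reals_iff)
    qed (auto simp: H_def)
    fix s assume s: "s \<in> H"
    have sz: "s - z \<noteq> 0" using s by (auto simp: H_def z_def)
    have sb: "s \<in> ball z r" using s by (simp add: H_def)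
    have "exp (logz s + log_gamma_factor s) = zeta s * gamma_factor s"
    proof -
      have "s \<in> quarter" "Re s > 0" using s Hq by auto
      then show ?thesis by (simp add: exp_add logz(2) exp_log_gamma_factor)
    qed
    also have "\<dots> = (g s * gamma_factor s) * (s - z) ^ m" using g(2)[OF sb] by simp
    also have "\<dots> = exp (l s) * exp (of_nat m * Ln (s - z))"
      using l(2)[OF sb] sz by (simp add: exp_of_nat_mult)
    finally show "exp (logz s + log_gamma_factor s) = exp (l s + of_nat m * Ln (s - z))" by (simp add: exp_add)
  qed
  then obtain k :: int where k: "\<And>s. s \<in> H \<Longrightarrow> logz s + log_gamma_factor s = (l s + of_nat m * Ln (s - z)) + of_real (2 * pi * of_int k) * \<i>"
    by blast
  define I where "I = {x - r<..<x + r}"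
  have Ib: "Complex (1/2) u \<in> ball z r" if "u \<in> I" for u
  proof -
    have "z - Complex (1/2) u = \<i> * of_real (x - u)" by (simp add: z_def complex_eq_iff)
    then have "dist z (Complex (1/2) u) = \<bar>x - u\<bar>" unfolding dist_norm by (simp add: norm_mult del: of_real_diff)
    then show ?thesis using that by (auto simp: I_def)
  qed
  \<comment> \<open>The argument of \<open>gamma_factor * zeta\<close> at height \<open>u\<close>,
    up to the sign of \<open>(u - x) ^ m\<close>: the m-th power of
    \<open>s - z = \<i> * (u - x)\<close> contributes \<open>m * pi / 2\<close>. As the function is
    real there, \<open>y\<close> is an integer multiple of \<open>pi\<close>, hence
    constant.\<close>
  define y where "y u = Im (l (Complex (1/2) u)) + real m * (pi / 2)" for u
  have conty: "continuous_on I y"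
    unfolding y_def
    by (intro continuous_intros continuous_on_compose2[OF contl]) (use Ib in \<open>auto simp: Complex_eq intro!: continuous_intros\<close>)
  have sin0: "sin (y u) = 0" if u: "u \<in> I" "u \<noteq> x" for u
  proof -
    let ?s = "Complex (1/2) u"
    have u0: "u \<noteq> 0" using u r by (auto simp: I_def)
    have "gamma_factor ?s * zeta ?s = exp (l ?s) * (?s - z) ^ m"
      using g(2)[OF Ib[OF u(1)]] l(2)[OF Ib[OF u(1)]] by (simp add: mult_ac)
    also have "?s - z = \<i> * of_real (u - x)" by (simp add: z_def complex_eq_iff)
    also have "exp (l ?s) * (\<i> * of_real (u - x)) ^ m = of_real (exp (Re (l ?s)) * (u - x) ^ m) * (cis (Im (l ?s)) * \<i> ^ m)"
      unfolding exp_eq_polar power_mult_distrib by (simp add: mult_ac)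
    also have "\<i> ^ m = cis (real m * (pi / 2))"
      using Complex.DeMoivre[of "pi / 2" m] by (simp only: cis_pi_half)
    also have "cis (Im (l ?s)) * cis (real m * (pi / 2)) = cis (y u)"
      by (simp add: cis_mult y_def)
    finally have "of_real (exp (Re (l ?s)) * (u - x) ^ m) * cis (y u) \<in> \<real>"
      using gamma_factor_zeta_critical_line_real[OF u0] by simp
    then have "Im (of_real (exp (Re (l ?s)) * (u - x) ^ m) * cis (y u)) = 0"
      unfolding complex_is_Real_iff .
    then have "exp (Re (l ?s)) * (u - x) ^ m * sin (y u) = 0" by (simp del: of_real_mult of_real_power of_real_diff)
    then show ?thesis using u by simp
  qed
  have xI: "x \<in> I" using r by (simp add: I_def)
  \<comment> \<open>At \<open>u = x\<close> zeta may vanish and leave the argument undetermined; the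
    value of \<open>y\<close> follows by continuity.\<close>
  have sin0': "sin (y u) = 0" if u: "u \<in> I" for u
  proof (cases "u = x")
    case True
    have "isCont y x" using conty xI by (simp add: I_def continuous_on_eq_continuous_at)
    then have "((\<lambda>u. sin (y u)) \<longlongrightarrow> sin (y x)) (at x)" by (intro tendsto_intros) (simp add: isCont_def)
    moreover have "eventually (\<lambda>u. u \<in> I \<and> u \<noteq> x) (at x)"
      unfolding eventually_at_topological using xI by (intro exI[of _ I]) (auto simp: I_def)
    then have "eventually (\<lambda>u. sin (y u) = 0) (at x)" by eventually_elim (use sin0 in auto)
    ultimately have "((\<lambda>u. 0) \<longlongrightarrow> sin (y x)) (at x)" by (simp only: tendsto_cong)
    then show ?thesis using True by (simp add: tendsto_const_iff)
  qed (use sin0 u in auto)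
  have "\<exists>k::int. \<forall>u\<in>I. y u / pi = of_int k"
  proof (rule continuous_Ints_constant)
    show "connected I" by (simp add: I_def)
    show "continuous_on I (\<lambda>u. y u / pi)" by (intro continuous_intros conty) auto
    show "y u / pi \<in> \<int>" if uI: "u \<in> I" for u
    proof -
      obtain i :: int where "y u = of_int i * pi" using sin0'[OF uI] by (auto simp: sin_zero_iff_int2)
      then show ?thesis by simp
    qed
  qed
  then obtain k2 :: int where k2: "\<And>u. u \<in> I \<Longrightarrow> y u / pi = of_int k2" by blast
  define c0 where "c0 = pi * of_int k2 - real m * (pi / 2)"
  have c0: "Im (l (Complex (1/2) u)) = c0" if "u \<in> I" for u
    using k2[OF that] by (simp add: y_def c0_def field_simps)
  \<comment> \<open>A quarter of \<open>r\<close> in both directions keeps the points in the compact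
    ball of radius \<open>r/2\<close>, where the continuous parts are bounded.\<close>
  have inH: "Complex (1/2 + \<epsilon>) u \<in> H \<and> Complex (1/2 + \<epsilon>) u \<in> cball z (r/2)" if "0 < \<epsilon>" "\<epsilon> < r/4" "\<bar>u - x\<bar> < r/4" for \<epsilon> u
  proof -
    have "dist z (Complex (1/2 + \<epsilon>) u) \<le> \<bar>\<epsilon>\<bar> + \<bar>u - x\<bar>"
      using cmod_le[of "z - Complex (1/2 + \<epsilon>) u"] by (simp add: dist_norm z_def abs_minus_commute)
    then show ?thesis using that r by (auto simp: H_def)
  qed
  have Imz: "Im (logz (Complex (1/2 + \<epsilon>) u)) = Im (l (Complex (1/2 + \<epsilon>) u)) + real m * Im (Ln (Complex \<epsilon> (u - x)))
      + 2 * pi * of_int k - Im (log_gamma_factor (Complex (1/2 + \<epsilon>) u))" if "0 < \<epsilon>" "\<epsilon> < r/4" "\<bar>u - x\<bar> < r/4" for \<epsilon> u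
  proof -
    have "Complex (1/2 + \<epsilon>) u - z = Complex \<epsilon> (u - x)" by (simp add: z_def complex_eq_iff)
    then have "Im (logz (Complex (1/2 + \<epsilon>) u) + log_gamma_factor (Complex (1/2 + \<epsilon>) u)) =
       Im (l (Complex (1/2 + \<epsilon>) u) + of_nat m * Ln (Complex \<epsilon> (u - x)) + of_real (2 * pi * of_int k) * \<i>)"
      using k[of "Complex (1/2 + \<epsilon>) u"] inH[OF that] by simp
    then show ?thesis by simp
  qed
  have lim: "((\<lambda>\<epsilon>. Im (logz (Complex (1/2 + \<epsilon>) u))) \<longlongrightarrow> (c0 + 2 * pi * of_int k) + real m * (sgn (u - x) * pi / 2) - theta u) (at_right 0)"
    if u: "\<bar>u - x\<bar> < r/4" "u \<noteq> x \<or> m = 0" for u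
  proof -
    have uI: "u \<in> I" unfolding I_def greaterThanLessThan_iff using u(1) r by (intro conjI) linarith+
    have "isCont l (Complex (1/2) u)"
      using contl Ib[OF uI] by (simp add: continuous_on_eq_continuous_at)
    then have t1: "((\<lambda>\<epsilon>. Im (l (Complex (1/2 + \<epsilon>) u))) \<longlongrightarrow> Im (l (Complex (1/2) u))) (at_right 0)"
      by (intro tendsto_intros isCont_tendsto_compose[OF _ tendsto_Complex_shift])
    have "isCont log_gamma_factor (Complex (1/2) u)"
      using continuous_on_log_gamma_factor open_halfspace_Re_gt[of 0] by (simp add: continuous_on_eq_continuous_at)
    then have t2: "((\<lambda>\<epsilon>. Im (log_gamma_factor (Complex (1/2 + \<epsilon>) u))) \<longlongrightarrow> Im (log_gamma_factor (Complex (1/2) u))) (at_right 0)"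
      by (intro tendsto_intros isCont_tendsto_compose[OF _ tendsto_Complex_shift])
    have t3: "((\<lambda>\<epsilon>. real m * Im (Ln (Complex \<epsilon> (u - x)))) \<longlongrightarrow> real m * (sgn (u - x) * pi / 2)) (at_right 0)"
    proof (cases "m = 0")
      case False
      then have ux: "u - x \<noteq> 0" using u by simp
      then have "isCont Ln (Complex 0 (u - x))"
        by (intro continuous_at_Ln) (auto simp: complex_nonpos_Reals_iff)
      then have "((\<lambda>\<epsilon>. Im (Ln (Complex (0 + \<epsilon>) (u - x)))) \<longlongrightarrow> Im (Ln (Complex 0 (u - x)))) (at_right 0)"
        by (intro tendsto_intros isCont_tendsto_compose[OF _ tendsto_Complex_shift])
      then show ?thesis unfolding Im_Ln_imaginary[OF ux] by (intro tendsto_intros) simp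
    qed simp
    have "((\<lambda>\<epsilon>. Im (l (Complex (1/2 + \<epsilon>) u)) + real m * Im (Ln (Complex \<epsilon> (u - x)))
      + 2 * pi * of_int k - Im (log_gamma_factor (Complex (1/2 + \<epsilon>) u))) \<longlongrightarrow>
      c0 + real m * (sgn (u - x) * pi / 2) + 2 * pi * of_int k - theta u) (at_right 0)"
      using tendsto_diff[OF tendsto_add[OF tendsto_add[OF t1 t3] tendsto_const] t2]
      unfolding c0[OF uI] Im_log_gamma_factor .
    moreover have "eventually (\<lambda>\<epsilon>. Im (l (Complex (1/2 + \<epsilon>) u)) + real m * Im (Ln (Complex \<epsilon> (u - x)))
      + 2 * pi * of_int k - Im (log_gamma_factor (Complex (1/2 + \<epsilon>) u)) = Im (logz (Complex (1/2 + \<epsilon>) u))) (at_right 0)"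
      using eventually_at_right_real[of 0 "r/4"] r
      by (auto elim!: eventually_mono simp: Imz[OF _ _ u(1)])
    ultimately have "((\<lambda>\<epsilon>. Im (logz (Complex (1/2 + \<epsilon>) u))) \<longlongrightarrow>
      c0 + real m * (sgn (u - x) * pi / 2) + 2 * pi * of_int k - theta u) (at_right 0)"
      by (rule Lim_transform_eventually)
    then show ?thesis by (simp only: add_ac)
  qed
  have cb: "cball z (r/2) \<subseteq> ball z r" using r by auto
  have "bounded ((\<lambda>s. Im (l s)) ` cball z (r/2))"
    by (intro compact_imp_bounded compact_continuous_image continuous_intros continuous_on_subset[OF contl cb]) auto
  then obtain B1 where bB1: "\<forall>y\<in>(\<lambda>s. Im (l s)) ` cball z (r/2). norm y \<le> B1" unfolding bounded_iff by blast
  have B1: "\<bar>Im (l s)\<bar> \<le> B1" if "s \<in> cball z (r/2)" for s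
    using bspec[OF bB1 imageI[OF that]] by simp
  have "bounded ((\<lambda>s. Im (log_gamma_factor s)) ` cball z (r/2))"
    using cb inb by (intro compact_imp_bounded compact_continuous_image continuous_intros continuous_on_subset[OF continuous_on_log_gamma_factor]) auto
  then obtain B2 where bB2: "\<forall>y\<in>(\<lambda>s. Im (log_gamma_factor s)) ` cball z (r/2). norm y \<le> B2" unfolding bounded_iff by blast
  have B2: "\<bar>Im (log_gamma_factor s)\<bar> \<le> B2" if "s \<in> cball z (r/2)" for s
    using bspec[OF bB2 imageI[OF that]] by simp
  \<comment> \<open>\<open>Ln\<close> is unbounded near the zero, but its imaginary part is at most
    \<open>pi\<close> in absolute value, so the bound is uniform as \<open>\<epsilon>\<close> tends
    to 0, even at the height of the zero.\<close>
  have bound: "\<bar>Im (logz (Complex (1/2 + \<epsilon>) u))\<bar> \<le> B1 + real m * pi + \<bar>2 * pi * of_int k\<bar> + B2"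
    if e: "0 < \<epsilon>" "\<epsilon> < r/4" "\<bar>u - x\<bar> < r/4" for \<epsilon> u
  proof -
    have nz: "Complex \<epsilon> (u - x) \<noteq> 0" using e by (auto simp: complex_eq_iff)
    have "\<bar>Im (Ln (Complex \<epsilon> (u - x)))\<bar> \<le> pi"
      using mpi_less_Im_Ln[OF nz] Im_Ln_le_pi[OF nz] by (simp add: abs_le_iff)
    then have "\<bar>real m * Im (Ln (Complex \<epsilon> (u - x)))\<bar> \<le> real m * pi"
      by (simp add: abs_mult mult_left_mono)
    then show ?thesis unfolding Imz[OF e]
      using B1[of "Complex (1/2 + \<epsilon>) u"] B2[of "Complex (1/2 + \<epsilon>) u"] inH[OF e] by linarith
  qed
  have iso: "zmult u = 0" if u: "\<bar>u - x\<bar> < r/4" "u \<noteq> x" for u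
  proof -
    have uI: "u \<in> I" unfolding I_def greaterThanLessThan_iff using u(1) r by (intro conjI) linarith+
    have u0: "u > 0" using u(1) r by linarith
    have "Complex (1/2) u - z \<noteq> 0" using u by (simp add: z_def complex_eq_iff)
    then have "zeta (Complex (1/2) u) \<noteq> 0" using g(2,3)[OF Ib[OF uI]] by simp
    then show ?thesis using zmult_eq[OF u0] by simp
  qed
  show ?thesis
  proof (intro exI conjI)
    show "0 < r/4" "r/4 < x" using r by auto
    show "\<forall>u. \<bar>u - x\<bar> < r/4 \<and> (u \<noteq> x \<or> zmult x = 0) \<longrightarrow>
      ((\<lambda>\<epsilon>. Im (logz (Complex (1/2 + \<epsilon>) u))) \<longlongrightarrow> (c0 + 2 * pi * of_int k) + real (zmult x) * (sgn (u - x) * pi / 2) - theta u) (at_right 0)"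
      using lim unfolding m_def by blast
    show "\<forall>\<epsilon> u. 0 < \<epsilon> \<and> \<epsilon> < r/4 \<and> \<bar>u - x\<bar> < r/4 \<longrightarrow>
       \<bar>Im (logz (Complex (1/2 + \<epsilon>) u))\<bar> \<le> B1 + real m * pi + \<bar>2 * pi * of_int k\<bar> + B2"
      using bound by blast
    show "\<forall>u. \<bar>u - x\<bar> < r/4 \<and> u \<noteq> x \<longrightarrow> zmult u = 0" using iso by blast
  qed
qed

end

section \<open>One additive constant for the whole critical line\<close>

context RH
begin

definition boundary_const_at :: "real \<Rightarrow> real \<Rightarrow> bool" where
  "boundary_const_at x v \<longleftrightarrow> (\<exists>\<delta>>0. \<forall>u. \<bar>u - x\<bar> < \<delta> \<and> (u \<noteq> x \<or> zmult x = 0) \<longrightarrow>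
     ((\<lambda>\<epsilon>. Im (logz (Complex (1/2 + \<epsilon>) u))) \<longlongrightarrow> pi * real (counting u) - theta u + v) (at_right 0))"

text \<open>The local formula jumps at \<open>x\<close> by \<open>pi * zmult x\<close>, and so does
  \<open>pi * counting u\<close>; once the latter is written in, one constant serves on both
  sides.\<close>

lemma boundary_const_at_exists:
  assumes x: "x > 0"
  shows "\<exists>v. boundary_const_at x v"
proof -
  obtain \<delta> c where \<delta>: "\<delta> > 0" "\<delta> < x" and
    lim: "\<And>u. \<bar>u - x\<bar> < \<delta> \<Longrightarrow> u \<noteq> x \<or> zmult x = 0 \<Longrightarrow>
      ((\<lambda>\<epsilon>. Im (logz (Complex (1/2 + \<epsilon>) u))) \<longlongrightarrow> c + real (zmult x) * (sgn (u - x) * pi / 2) - theta u) (at_right 0)"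
    and iso: "\<And>u. \<bar>u - x\<bar> < \<delta> \<Longrightarrow> u \<noteq> x \<Longrightarrow> zmult u = 0"
    using boundary_local[OF x] by blast
  have eq: "c + real (zmult x) * (sgn (u - x) * pi / 2) = pi * real (counting u) + (c + real (zmult x) * (pi / 2) - pi * real (counting x))"
    if u: "\<bar>u - x\<bar> < \<delta>" "u \<noteq> x \<or> zmult x = 0" for u
  proof (cases "u < x")
    case True
    have "counting x = counting u + zmult x"
      by (rule counting_before) (use True u \<delta> in \<open>auto intro!: iso\<close>)
    then show ?thesis using True by (simp add: algebra_simps)
  next
    case False
    have "counting u = counting x"
      by (rule counting_right) (use False u \<delta> x in \<open>auto intro!: iso\<close>)
    then show ?thesis using False u by (cases "u = x") (auto simp: algebra_simps)
  qed
  have "boundary_const_at x (c + real (zmult x) * (pi / 2) - pi * real (counting x))"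
    unfolding boundary_const_at_def
  proof (intro exI[of _ \<delta>] conjI allI impI)
    fix u assume u: "\<bar>u - x\<bar> < \<delta> \<and> (u \<noteq> x \<or> zmult x = 0)"
    then have e: "c + real (zmult x) * (sgn (u - x) * pi / 2) - theta u =
       pi * real (counting u) - theta u + (c + real (zmult x) * (pi / 2) - pi * real (counting x))"
      using eq[of u] by simp
    from lim[of u] u show "((\<lambda>\<epsilon>. Im (logz (Complex (1/2 + \<epsilon>) u))) \<longlongrightarrow>
       pi * real (counting u) - theta u + (c + real (zmult x) * (pi / 2) - pi * real (counting x))) (at_right 0)"
      unfolding e by blast
  qed (rule \<delta>)
  then show ?thesis by blast
qed

lemma boundary_const_at_unique:
  assumes "boundary_const_at x v" "boundary_const_at y w" "\<bar>x - y\<bar> < d"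
    and d: "d > 0" "\<And>u. \<bar>u - y\<bar> < d \<Longrightarrow> u \<noteq> y \<Longrightarrow>
     ((\<lambda>\<epsilon>. Im (logz (Complex (1/2 + \<epsilon>) u))) \<longlongrightarrow> pi * real (counting u) - theta u + w) (at_right 0)"
  shows "v = w"
proof -
  obtain \<delta> where \<delta>: "\<delta> > 0" "\<And>u. \<bar>u - x\<bar> < \<delta> \<Longrightarrow> u \<noteq> x \<Longrightarrow>
     ((\<lambda>\<epsilon>. Im (logz (Complex (1/2 + \<epsilon>) u))) \<longlongrightarrow> pi * real (counting u) - theta u + v) (at_right 0)"
    using assms(1) unfolding boundary_const_at_def by blast
  \<comment> \<open>One of \<open>x + e\<close> and \<open>x + e / 2\<close> differs from
    \<open>y\<close>; it lies in both neighbourhoods, and both limits hold there.\<close>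
  define e where "e = min \<delta> (d - \<bar>x - y\<bar>) / 2"
  have e: "e > 0" "e < \<delta>" "\<bar>x - y\<bar> + e < d" using \<delta> assms(3) by (auto simp: e_def min_def field_simps)
  obtain u where u: "u \<noteq> x" "u \<noteq> y" "\<bar>u - x\<bar> < \<delta>" "\<bar>u - y\<bar> < d"
  proof (cases "x + e = y")
    case True
    show thesis by (rule that[of "x + e / 2"]) (use e True in auto)
  next
    case False
    show thesis by (rule that[of "x + e"]) (use e False in auto)
  qed
  have "pi * real (counting u) - theta u + v = pi * real (counting u) - theta u + w"
    by (rule tendsto_unique[OF _ \<delta>(2)[OF u(3,1)] d(2)[OF u(4,2)]]) simp
  then show ?thesis by simp
qed

definition boundary_const :: real where
  "boundary_const = (SOME v. boundary_const_at 1 v)"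

text \<open>The constant attached to \<open>x\<close> is locally constant in \<open>x\<close>, and
  the positive half-line is connected.\<close>

lemma boundary_const_at_all:
  assumes x: "x > 0"
  shows "boundary_const_at x boundary_const"
proof -
  define f where "f x = (SOME v. boundary_const_at x v)" for x
  have f: "boundary_const_at x (f x)" if "x > 0" for x
    unfolding f_def using boundary_const_at_exists[OF that] by (rule someI_ex)
  have "f x = f 1"
  proof (rule connected_local_const[of "{0<..}" x 1 f])
    show "\<forall>a\<in>{0<..}. eventually (\<lambda>b. f a = f b) (at a within {0<..})"
    proof
      fix a :: real assume a: "a \<in> {0<..}"
      obtain d where d: "d > 0" "\<And>u. \<bar>u - a\<bar> < d \<Longrightarrow> u \<noteq> a \<Longrightarrow>
         ((\<lambda>\<epsilon>. Im (logz (Complex (1/2 + \<epsilon>) u))) \<longlongrightarrow> pi * real (counting u) - theta u + f a) (at_right 0)"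
        using f[of a] a unfolding boundary_const_at_def by auto
      have "f b = f a" if "b > 0" "\<bar>b - a\<bar> < d" for b
        by (rule boundary_const_at_unique[OF f[OF that(1)] f[of a] that(2) d]) (use a in auto)
      then show "eventually (\<lambda>b. f a = f b) (at a within {0<..})"
        unfolding eventually_at using d(1) by (intro exI[of _ d]) (auto simp: dist_real_def)
    qed
  qed (use x in auto)
  then show ?thesis using f[OF x] by (simp add: boundary_const_def f_def)
qed

lemma boundary_limit:
  assumes "x > 0" "zmult x = 0"
  shows "((\<lambda>\<epsilon>. Im (logz (Complex (1/2 + \<epsilon>) x))) \<longlongrightarrow> pi * real (counting x) - theta x + boundary_const) (at_right 0)"
  using boundary_const_at_all[OF assms(1)] assms(2) unfolding boundary_const_at_def by force

text \<open>Compactness of \<open>{a..b}\<close> makes the local bounds of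
  \<open>boundary_local\<close> uniform; \<open>boundary_integral\<close> needs this for dominated
  convergence.\<close>

lemma boundary_bounded:
  assumes "0 < a"
  shows "\<exists>\<delta>>0. \<exists>B. \<forall>\<epsilon> u. 0 < \<epsilon> \<and> \<epsilon> < \<delta> \<and> u \<in> {a..b} \<longrightarrow> \<bar>Im (logz (Complex (1/2 + \<epsilon>) u))\<bar> \<le> B"
proof -
  define P where "P x \<delta> B \<longleftrightarrow> \<delta> > 0 \<and> (\<forall>\<epsilon> u. 0 < \<epsilon> \<and> \<epsilon> < \<delta> \<and> \<bar>u - x\<bar> < \<delta> \<longrightarrow> \<bar>Im (logz (Complex (1/2 + \<epsilon>) u))\<bar> \<le> B)" for x \<delta> B :: real
  have "\<forall>x\<in>{a..b}. \<exists>\<delta> B. P x \<delta> B"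
  proof
    fix x assume "x \<in> {a..b}"
    then have "x > 0" using assms by auto
    from boundary_local[OF this] show "\<exists>\<delta> B. P x \<delta> B" unfolding P_def by blast
  qed
  then obtain d B where P: "\<And>x. x \<in> {a..b} \<Longrightarrow> P x (d x) (B x)" by metis
  have dB: "\<And>x. x \<in> {a..b} \<Longrightarrow> d x > 0"
     "\<And>x \<epsilon> u. x \<in> {a..b} \<Longrightarrow> 0 < \<epsilon> \<Longrightarrow> \<epsilon> < d x \<Longrightarrow> \<bar>u - x\<bar> < d x \<Longrightarrow> \<bar>Im (logz (Complex (1/2 + \<epsilon>) u))\<bar> \<le> B x"
    using P unfolding P_def by blast+
  obtain C where C: "C \<subseteq> {a..b}" "finite C" "{a..b} \<subseteq> (\<Union>x\<in>C. ball x (d x))"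
  proof (rule compactE_image[of "{a..b}" "{a..b}" "\<lambda>x. ball x (d x)"])
    show "{a..b} \<subseteq> (\<Union>x\<in>{a..b}. ball x (d x))" using dB(1) by auto
  qed auto
  define \<delta> where "\<delta> = Min (insert 1 (d ` C))"
  define M where "M = Max (insert 0 (B ` C))"
  have "\<delta> > 0" unfolding \<delta>_def using C dB(1) by (subst Min_gr_iff) auto
  moreover have "\<bar>Im (logz (Complex (1/2 + \<epsilon>) u))\<bar> \<le> M" if eu: "0 < \<epsilon>" "\<epsilon> < \<delta>" "u \<in> {a..b}" for \<epsilon> u
  proof -
    obtain x where x: "x \<in> C" "u \<in> ball x (d x)" using C(3) eu(3) by auto
    have "\<delta> \<le> d x" unfolding \<delta>_def using C x by (intro Min_le) auto
    then have "\<bar>Im (logz (Complex (1/2 + \<epsilon>) u))\<bar> \<le> B x"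
      using x eu C by (intro dB(2)) (auto simp: dist_real_def abs_minus_commute)
    also have "\<dots> \<le> M" unfolding M_def using C x by (intro Max_ge) auto
    finally show ?thesis .
  qed
  ultimately show ?thesis by blast
qed

lemma boundary_integral:
  fixes k :: "real \<Rightarrow> real"
  assumes a: "0 < a" and k: "continuous_on {a..b} k"
  shows "(\<lambda>u. k u * (pi * real (counting u) - theta u + boundary_const)) integrable_on {a..b} \<and>
    ((\<lambda>\<epsilon>. integral {a..b} (\<lambda>u. k u * Im (logz (Complex (1/2 + \<epsilon>) u)))) \<longlongrightarrow>
      integral {a..b} (\<lambda>u. k u * (pi * real (counting u) - theta u + boundary_const))) (at_right 0)"
proof -
  let ?g = "\<lambda>u. k u * (pi * real (counting u) - theta u + boundary_const)"
  let ?f = "\<lambda>\<epsilon> u. k u * Im (logz (Complex (1/2 + \<epsilon>) u))"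
  obtain \<delta> B where \<delta>: "\<delta> > 0" "\<And>\<epsilon> u. 0 < \<epsilon> \<Longrightarrow> \<epsilon> < \<delta> \<Longrightarrow> u \<in> {a..b} \<Longrightarrow> \<bar>Im (logz (Complex (1/2 + \<epsilon>) u))\<bar> \<le> B"
    using boundary_bounded[OF a] by blast
  \<comment> \<open>The limit is not controlled at the ordinates themselves; only finitely many lie
    up to \<open>b\<close>, a negligible set.\<close>
  define N where "N = support b"
  have N: "negligible N" unfolding N_def by (rule negligible_finite) simp
  have cont: "continuous_on {a..b} (?f \<epsilon>)" if "\<epsilon> > 0" for \<epsilon>
  proof (intro continuous_on_mult continuous_on_Im k continuous_on_compose2[OF holomorphic_on_imp_continuous_on[OF logz(1)]])
    show "continuous_on {a..b} (\<lambda>u. Complex (1/2 + \<epsilon>) u)" by (auto simp: Complex_eq intro!: continuous_intros)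
    show "(\<lambda>u. Complex (1/2 + \<epsilon>) u) ` {a..b} \<subseteq> quarter" using that a by (auto simp: quarter_def)
  qed
  have main: "?g integrable_on {a..b} \<and> (\<lambda>j. integral {a..b} (?f (e j))) \<longlonglongrightarrow> integral {a..b} ?g"
    if e: "\<And>j::nat. 0 < e j" "\<And>j. e j < \<delta>" "e \<longlonglongrightarrow> 0" for e
  proof -
    let ?f' = "\<lambda>j u. if u \<in> N then 0 else ?f (e j) u"
    let ?g' = "\<lambda>u. if u \<in> N then 0 else ?g u"
    have int: "integral {a..b} (?f' j) = integral {a..b} (?f (e j))" for j
      by (rule integral_spike[OF N]) auto
    have i1: "?f' j integrable_on {a..b}" for j
      by (rule integrable_spike[OF integrable_continuous_real[OF cont[OF e(1)[of j]]] N]) auto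
    have i2: "(\<lambda>u. \<bar>k u\<bar> * \<bar>B\<bar>) integrable_on {a..b}"
      by (intro integrable_continuous_real continuous_intros k)
    have i3: "norm (?f' j u) \<le> \<bar>k u\<bar> * \<bar>B\<bar>" if "u \<in> {a..b}" for j u
      using \<delta>(2)[OF e(1,2) that, of j] by (auto simp: abs_mult intro!: mult_left_mono)
    have i4: "(\<lambda>j. ?f' j u) \<longlonglongrightarrow> ?g' u" if u: "u \<in> {a..b}" for u
    proof (cases "u \<in> N")
      case False
      have u0: "u > 0" using u a by auto
      have "zmult u = 0" using False u u0 by (auto simp: N_def support_def)
      from boundary_limit[OF u0 this]
      have L: "((\<lambda>\<epsilon>. Im (logz (Complex (1/2 + \<epsilon>) u))) \<longlongrightarrow> pi * real (counting u) - theta u + boundary_const) (at_right 0)" .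
      have "filterlim e (at_right 0) sequentially"
      proof -
        have "e j \<in> {0<..} \<and> e j \<noteq> 0" for j using e(1)[of j] by simp
        then show ?thesis by (simp add: filterlim_at e(3))
      qed
      from filterlim_compose[OF L this] show ?thesis using False by (auto intro!: tendsto_intros)
    qed simp
    have DC: "?g' integrable_on {a..b} \<and> (\<lambda>j. integral {a..b} (?f' j)) \<longlonglongrightarrow> integral {a..b} ?g'"
      using dominated_convergence[of ?f' "{a..b}" "\<lambda>u. \<bar>k u\<bar> * \<bar>B\<bar>" ?g', OF i1 i2 i3 i4] by blast
    have "?g integrable_on {a..b}"
      by (rule integrable_spike[OF conjunct1[OF DC] N]) auto
    moreover have "integral {a..b} ?g' = integral {a..b} ?g" by (rule integral_spike[OF N]) auto
    ultimately show ?thesis using DC int by simp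
  qed
  have "?g integrable_on {a..b}"
  proof -
    have "(\<lambda>j. \<delta> / (real j + 2)) \<longlonglongrightarrow> 0" by real_asymp
    moreover have "0 < \<delta> / (real j + 2)" "\<delta> / (real j + 2) < \<delta>" for j
      using \<delta>(1) by (simp_all add: divide_less_eq algebra_simps add_pos_nonneg)
    ultimately show ?thesis using main[of "\<lambda>j. \<delta> / (real j + 2)"] by blast
  qed
  moreover have "((\<lambda>\<epsilon>. integral {a..b} (?f \<epsilon>)) \<longlongrightarrow> integral {a..b} ?g) (at_right 0)"
  proof (rule tendsto_at_right_sequentially[of 0 \<delta>])
    show "0 < \<delta>" by (rule \<delta>)
    fix e :: "nat \<Rightarrow> real" assume "\<And>n. 0 < e n" "\<And>n. e n < \<delta>" "decseq e" "e \<longlonglongrightarrow> 0"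
    then show "(\<lambda>n. integral {a..b} (?f (e n))) \<longlonglongrightarrow> integral {a..b} ?g" using main[of e] by simp
  qed
  ultimately show ?thesis by blast
qed

end

section \<open>Smoothing with a rapidly decaying kernel\<close>

text \<open>Cauchy's theorem for a rectangle, through a primitive on the convex set: the two
  vertical integrals differ by two horizontal ones, each at most \<open>B * (b - a)\<close>.\<close>

lemma vertical_shift_bound:
  fixes f :: "complex \<Rightarrow> complex"
  assumes S: "convex S" "open S" and f: "f holomorphic_on S"
    and sub: "\<And>\<sigma> u. a \<le> \<sigma> \<Longrightarrow> \<sigma> \<le> b \<Longrightarrow> p \<le> u \<Longrightarrow> u \<le> q \<Longrightarrow> Complex \<sigma> u \<in> S"
    and ab: "a \<le> b" and pq: "p \<le> q"
    and B: "\<And>\<sigma>. a \<le> \<sigma> \<Longrightarrow> \<sigma> \<le> b \<Longrightarrow> norm (f (Complex \<sigma> p)) \<le> B"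
           "\<And>\<sigma>. a \<le> \<sigma> \<Longrightarrow> \<sigma> \<le> b \<Longrightarrow> norm (f (Complex \<sigma> q)) \<le> B"
  shows "norm (integral {p..q} (\<lambda>u. f (Complex a u)) - integral {p..q} (\<lambda>u. f (Complex b u))) \<le> 2 * B * (b - a)"
proof -
  obtain G where G: "\<And>x. x \<in> S \<Longrightarrow> (G has_field_derivative f x) (at x within S)"
    by (rule holomorphic_convex_primitive'[OF S f]) (rule that)
  have G': "(G has_field_derivative f x) (at x)" if "x \<in> S" for x
    using G[OF that] at_within_open[OF that S(2)] by simp
  have vert: "integral {p..q} (\<lambda>u. f (Complex \<sigma> u)) = - \<i> * G (Complex \<sigma> q) - - \<i> * G (Complex \<sigma> p)"
    if \<sigma>: "a \<le> \<sigma>" "\<sigma> \<le> b" for \<sigma>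
  proof (rule integral_unique[OF fundamental_theorem_of_calculus[OF pq]])
    fix u assume u: "u \<in> {p..q}"
    have c: "Complex \<sigma> = (\<lambda>u. of_real \<sigma> + of_real u * \<i>)" by (auto simp: complex_eq_iff)
    have "(Complex \<sigma> has_vector_derivative \<i>) (at u)"
      unfolding c by (auto intro!: derivative_eq_intros simp: has_vector_derivative_def scaleR_conv_of_real)
    from field_vector_diff_chain_at[OF this G'[OF sub[OF \<sigma>]]] u
    have "(G \<circ> Complex \<sigma> has_vector_derivative \<i> * f (Complex \<sigma> u)) (at u)" by auto
    from has_vector_derivative_mult_right[OF this, of "- \<i>"]
    have "((\<lambda>u. - \<i> * (G \<circ> Complex \<sigma>) u) has_vector_derivative f (Complex \<sigma> u)) (at u)"
      by (simp add: mult.assoc[symmetric])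
    then show "((\<lambda>u. - \<i> * G (Complex \<sigma> u)) has_vector_derivative f (Complex \<sigma> u)) (at u within {p..q})"
      by (simp add: o_def has_vector_derivative_at_within)
  qed
  have horiz: "norm (G (Complex a u) - G (Complex b u)) \<le> B * (b - a)"
    if u: "p \<le> u" "u \<le> q" and Bu: "\<And>\<sigma>. a \<le> \<sigma> \<Longrightarrow> \<sigma> \<le> b \<Longrightarrow> norm (f (Complex \<sigma> u)) \<le> B" for u
  proof -
    let ?S = "closed_segment (Complex a u) (Complex b u)"
    have seg: "\<exists>\<sigma>. a \<le> \<sigma> \<and> \<sigma> \<le> b \<and> z = Complex \<sigma> u" if zS: "z \<in> ?S" for z
    proof -
      obtain w where w: "z = (1 - w) *\<^sub>R Complex a u + w *\<^sub>R Complex b u" "0 \<le> w" "w \<le> 1"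
        using zS unfolding in_segment by blast
      have "0 \<le> w * (b - a)" "0 \<le> (1 - w) * (b - a)" using w ab by simp_all
      then have "a \<le> (1 - w) * a + w * b" "(1 - w) * a + w * b \<le> b"
        by (simp_all add: left_diff_distrib right_diff_distrib)
      moreover have "z = Complex ((1 - w) * a + w * b) u" unfolding w(1) by (simp add: complex_eq_iff algebra_simps)
      ultimately show ?thesis by blast
    qed
    have "norm (G (Complex a u) - G (Complex b u)) \<le> B * norm (Complex a u - Complex b u)"
    proof (rule field_differentiable_bound[of ?S])
      fix z assume "z \<in> ?S"
      then obtain \<sigma> where z: "a \<le> \<sigma>" "\<sigma> \<le> b" "z = Complex \<sigma> u" using seg by blast
      show "(G has_field_derivative f z) (at z within ?S)"
        unfolding z(3) by (rule has_field_derivative_at_within[OF G'[OF sub[OF z(1,2) u]]])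
      show "norm (f z) \<le> B" unfolding z(3) by (rule Bu[OF z(1,2)])
    qed auto
    moreover have "Complex a u - Complex b u = of_real (a - b)" by (simp add: complex_eq_iff)
    then have "norm (Complex a u - Complex b u) = b - a" using ab by (simp only: norm_of_real)
    ultimately show ?thesis by simp
  qed
  have "integral {p..q} (\<lambda>u. f (Complex a u)) - integral {p..q} (\<lambda>u. f (Complex b u)) =
     - \<i> * (G (Complex a q) - G (Complex b q)) + \<i> * (G (Complex a p) - G (Complex b p))"
    using vert[of a] vert[of b] ab by (simp add: algebra_simps)
  also have "norm \<dots> \<le> norm (- \<i> * (G (Complex a q) - G (Complex b q))) + norm (\<i> * (G (Complex a p) - G (Complex b p)))"
    by (rule norm_triangle_ineq)
  also have "\<dots> \<le> B * (b - a) + B * (b - a)"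
    using horiz[of q] horiz[of p] B pq by (intro add_mono) (simp_all add: norm_mult)
  finally show ?thesis by simp
qed

text \<open>The factor \<open>exp (- A cosh w)\<close> is positive on the real line and at most \<open>exp (- A exp L / 4)\<close> for
  \<open>Re w = L\<close>, \<open>Im w \<in> {-1..0}\<close>. With \<open>L = ln ln ln T\<close> and large \<open>A\<close> this beats the factor \<open>ln t\<close> in
  the bound \<open>C ln t / (\<sigma> - 1/2)\<close> for \<open>log zeta\<close>, which is what permits windows this short. The quadratic
  factor vanishes at \<open>w = - L\<close> and \<open>w = L\<close>, which cancels \<open>\<sigma> - 1/2\<close>.\<close>

definition kern :: "real \<Rightarrow> complex \<Rightarrow> complex" where
  "kern A w = exp (- of_real A * cosh w)"

definition kernel_cut :: "real \<Rightarrow> real \<Rightarrow> complex \<Rightarrow> complex" where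
  "kernel_cut A L w = (1 - w\<^sup>2 / of_real (L\<^sup>2)) * kern A w"

lemma holomorphic_kern: "kern A holomorphic_on S"
  unfolding kern_def cosh_field_def by (intro holomorphic_intros) auto

lemma holomorphic_kernel_cut: "L \<noteq> 0 \<Longrightarrow> kernel_cut A L holomorphic_on S"
  unfolding kernel_cut_def by (intro holomorphic_intros holomorphic_kern) auto

lemma Re_cosh: "Re (cosh w) = cosh (Re w) * cos (Im w)"
proof -
  have "Re (exp w) = exp (Re w) * cos (Im w)" "Re (exp (- w)) = exp (- Re w) * cos (Im w)" by (simp_all add: Re_exp)
  then have "Re (cosh w) = (exp (Re w) * cos (Im w) + exp (- Re w) * cos (Im w)) / 2"
    unfolding cosh_field_def by simp
  then show ?thesis unfolding cosh_field_def by (simp add: distrib_right)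
qed

lemma norm_kern: "norm (kern A w) = exp (- (A * (cosh (Re w) * cos (Im w))))"
  unfolding kern_def by (simp add: Re_cosh norm_exp_eq_Re)

lemma cos_ge_half: "0 \<le> y \<Longrightarrow> y \<le> 1 \<Longrightarrow> cos y \<ge> 1/2" for y :: real
proof -
  assume y: "0 \<le> y" "y \<le> 1"
  have "cos (pi / 3) \<le> cos y" using y pi_gt3 by (intro cos_monotone_0_pi_le) auto
  then show ?thesis by (simp add: cos_60)
qed

text \<open>Since \<open>1 < pi / 3\<close>, the cosine in \<open>norm_kern\<close> stays at least
  \<open>1/2\<close> in the strip, so half of the exponent survives the shift by 1.\<close>

lemma norm_kern_le:
  assumes "A \<ge> 0" "0 \<le> y" "y \<le> 1"
  shows "norm (kern A (Complex v (- y))) \<le> exp (- (A * cosh v / 2))"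
proof -
  have "cosh v * (1/2) \<le> cosh v * cos y"
    using cos_ge_half[OF assms(2,3)] by (intro mult_left_mono) auto
  then have "A * (cosh v * (1/2)) \<le> A * (cosh v * cos y)" using assms by (intro mult_left_mono) auto
  then show ?thesis by (simp add: norm_kern)
qed

lemma kern_of_real: "kern A (of_real v) = of_real (exp (- (A * cosh v)))"
proof -
  have "exp (- complex_of_real v) = of_real (exp (- v))" by (metis exp_of_real of_real_minus)
  then have "cosh (complex_of_real v) = of_real (cosh v)" by (simp add: cosh_field_def exp_of_real)
  then have "- complex_of_real A * cosh (of_real v) = of_real (- (A * cosh v))" by simp
  then show ?thesis unfolding kern_def by (simp only: exp_of_real)
qed

definition kcut :: "real \<Rightarrow> real \<Rightarrow> real \<Rightarrow> real" where
  "kcut A L v = (1 - v\<^sup>2 / L\<^sup>2) * exp (- (A * cosh v))"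

lemma kernel_cut_of_real: "kernel_cut A L (of_real v) = of_real (kcut A L v)"
  unfolding kernel_cut_def kcut_def kern_of_real
  by (simp only: of_real_mult of_real_diff of_real_divide of_real_power of_real_1)

lemma norm_kernel_cut_corner:
  assumes "A \<ge> 0" "0 \<le> y" "y \<le> 1" "L \<ge> 1" "\<bar>v\<bar> = L"
  shows "norm (kernel_cut A L (Complex v (- y))) \<le> 3 * y / L * exp (- (A * cosh L / 2))"
proof -
  have v2: "v\<^sup>2 = L\<^sup>2" using assms by (metis power2_abs)
  have L0: "L > 0" using assms by simp
  have "1 - (Complex v (- y))\<^sup>2 / of_real (L\<^sup>2) = Complex (y\<^sup>2) (2 * v * y) / of_real (L\<^sup>2)"
  proof -
    have "of_real (L\<^sup>2) - (Complex v (- y))\<^sup>2 = Complex (y\<^sup>2) (2 * v * y)"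
      using v2 by (simp add: complex_eq_iff power2_eq_square)
    moreover have "1 - (Complex v (- y))\<^sup>2 / of_real (L\<^sup>2) = (of_real (L\<^sup>2) - (Complex v (- y))\<^sup>2) / of_real (L\<^sup>2)"
      using L0 by (simp add: diff_divide_distrib)
    ultimately show ?thesis by simp
  qed
  then have "norm (1 - (Complex v (- y))\<^sup>2 / of_real (L\<^sup>2)) = norm (Complex (y\<^sup>2) (2 * v * y)) / L\<^sup>2"
    by (simp add: norm_divide norm_power)
  also have "\<dots> \<le> (y\<^sup>2 + 2 * L * y) / L\<^sup>2"
  proof (rule divide_right_mono)
    show "norm (Complex (y\<^sup>2) (2 * v * y)) \<le> y\<^sup>2 + 2 * L * y"
      using cmod_le[of "Complex (y\<^sup>2) (2 * v * y)"] assms by (simp add: abs_mult)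
  qed simp
  also have "\<dots> \<le> (L * y + 2 * L * y) / L\<^sup>2"
    using assms by (intro divide_right_mono add_mono) (auto simp: power2_eq_square intro!: mult_right_mono)
  also have "\<dots> = 3 * y / L" using L0 by (simp add: field_simps power2_eq_square)
  finally have 1: "norm (1 - (Complex v (- y))\<^sup>2 / of_real (L\<^sup>2)) \<le> 3 * y / L" .
  have cv: "cosh v = cosh L" using assms by (metis cosh_real_abs)
  have 2: "norm (kern A (Complex v (- y))) \<le> exp (- (A * cosh L / 2))"
    using norm_kern_le[OF assms(1-3), of v] unfolding cv .
  show ?thesis unfolding kernel_cut_def norm_mult
    using 1 2 assms by (intro mult_mono) auto
qed

text \<open>With \<open>s = 1/2 + \<i> * (t + w)\<close> the line \<open>Re s = 3/2\<close> becomes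
  \<open>Im w = - 1\<close>: this is the smoothed integral after the shift.\<close>

definition shifted_integral :: "real \<Rightarrow> real \<Rightarrow> real \<Rightarrow> complex" where
  "shifted_integral A L t = integral {- L..L} (\<lambda>v. log_zeta (Complex (3/2) (t + v)) * kernel_cut A L (Complex v (- 1)))"

context RH
begin

text \<open>The contour keeps the distance \<open>\<epsilon>\<close> from the critical line, so that
  it runs where \<open>logz\<close> is holomorphic; the error is uniform in
  \<open>\<epsilon>\<close>, which may then tend to 0.\<close>

lemma smoothed_shift:
  obtains C where "C > 0" "\<And>A L t \<epsilon>. A \<ge> 0 \<Longrightarrow> L \<ge> 1 \<Longrightarrow> t - L \<ge> 3 \<Longrightarrow> 0 < \<epsilon> \<Longrightarrow> \<epsilon> < 1/2 \<Longrightarrow>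
    \<bar>integral {t - L..t + L} (\<lambda>u. kcut A L (u - t) * Im (logz (Complex (1/2 + \<epsilon>) u)))
      - Im (integral {- L..L} (\<lambda>v. log_zeta (Complex (3/2 + \<epsilon>) (t + v)) * kernel_cut A L (Complex v (- 1))))\<bar>
     \<le> C * ln (t + L) / L * exp (- (A * cosh L / 2))"
proof -
  obtain C where C: "C > 0" "\<And>\<sigma> t. t \<ge> 3 \<Longrightarrow> 1/2 < \<sigma> \<Longrightarrow> \<sigma> \<le> 2 \<Longrightarrow> norm (logz (Complex \<sigma> t)) \<le> C * ln t / (\<sigma> - 1/2)"
    by (rule logz_bound) (rule that)
  show ?thesis
  proof (rule that[of "6 * C"])
    show "6 * C > 0" using C by simp
    fix A L t \<epsilon> :: real
    assume A: "A \<ge> 0" and L: "L \<ge> 1" and t: "t - L \<ge> 3" and \<epsilon>: "0 < \<epsilon>" "\<epsilon> < 1/2"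
    \<comment> \<open>The kernel at \<open>w = - \<i> * (s - 1/2 - \<epsilon>) - t\<close>, which is
      real on the left line and has imaginary part \<open>- 1\<close> on the right one.\<close>
    define K where "K s = kernel_cut A L (- \<i> * (s - of_real (1/2 + \<epsilon>)) - of_real t)" for s
    have K: "K (Complex (1/2 + \<epsilon> + y) u) = kernel_cut A L (Complex (u - t) (- y))" for y u
    proof -
      have "- \<i> * (Complex (1/2 + \<epsilon> + y) u - of_real (1/2 + \<epsilon>)) - of_real t = Complex (u - t) (- y)"
        by (simp add: complex_eq_iff)
      then show ?thesis by (simp add: K_def)
    qed
    have holK: "K holomorphic_on quarter"
      unfolding K_def
    proof (rule holomorphic_on_compose_gen[OF _ holomorphic_kernel_cut[of L A UNIV], unfolded o_def])
      show "(\<lambda>s. - \<i> * (s - of_real (1/2 + \<epsilon>)) - of_real t) holomorphic_on quarter" by (intro holomorphic_intros)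
    qed (use L in auto)
    define E where "E = C * ln (t + L) * (3 / L * exp (- (A * cosh L / 2)))"
    have corner: "norm (logz (Complex \<sigma> u) * K (Complex \<sigma> u)) \<le> E"
      if \<sigma>: "1/2 + \<epsilon> \<le> \<sigma>" "\<sigma> \<le> 3/2 + \<epsilon>" and u: "u = t - L \<or> u = t + L" for \<sigma> u
    proof -
      define y where "y = \<sigma> - 1/2 - \<epsilon>"
      have y: "0 \<le> y" "y \<le> 1" "\<sigma> = 1/2 + \<epsilon> + y" using \<sigma> by (auto simp: y_def)
      have u3: "u \<ge> 3" "u \<le> t + L" "\<bar>u - t\<bar> = L" using u t L by auto
      have l0: "0 \<le> ln u" "ln u \<le> ln (t + L)" using u3 by auto
      have "norm (logz (Complex \<sigma> u)) \<le> C * ln u / (\<sigma> - 1/2)" using C(2)[OF u3(1), of \<sigma>] \<sigma> \<epsilon> by simp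
      also have "\<dots> \<le> C * ln (t + L) / (\<sigma> - 1/2)"
        using l0 C \<sigma> \<epsilon> by (intro divide_right_mono mult_left_mono) auto
      finally have 1: "norm (logz (Complex \<sigma> u)) \<le> C * ln (t + L) / (\<sigma> - 1/2)" .
      have 2: "norm (K (Complex \<sigma> u)) \<le> 3 * y / L * exp (- (A * cosh L / 2))"
        unfolding y(3) K by (rule norm_kernel_cut_corner[OF A y(1,2) L u3(3)])
      have "norm (logz (Complex \<sigma> u) * K (Complex \<sigma> u)) \<le> C * ln (t + L) / (\<sigma> - 1/2) * (3 * y / L * exp (- (A * cosh L / 2)))"
        unfolding norm_mult using 1 2 l0 C \<sigma> \<epsilon> by (intro mult_mono) auto
      also have "\<dots> = C * ln (t + L) * (3 / L * exp (- (A * cosh L / 2))) * (y / (\<sigma> - 1/2))"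
        by (simp add: mult_ac)
      also have "\<dots> \<le> C * ln (t + L) * (3 / L * exp (- (A * cosh L / 2))) * 1"
      proof (rule mult_left_mono)
        show "y / (\<sigma> - 1/2) \<le> 1" unfolding y(3) using y(1) \<epsilon> by (simp add: divide_le_eq_1)
        have "0 \<le> C * ln (t + L)" using C l0 by simp
        then show "0 \<le> C * ln (t + L) * (3 / L * exp (- (A * cosh L / 2)))" using L by simp
      qed
      finally show ?thesis by (simp add: E_def)
    qed
    have "norm (integral {t - L..t + L} (\<lambda>u. logz (Complex (1/2 + \<epsilon>) u) * K (Complex (1/2 + \<epsilon>) u))
        - integral {t - L..t + L} (\<lambda>u. logz (Complex (3/2 + \<epsilon>) u) * K (Complex (3/2 + \<epsilon>) u))) \<le> 2 * E * (3/2 + \<epsilon> - (1/2 + \<epsilon>))"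
    proof (rule vertical_shift_bound[OF convex_quarter open_quarter, where f = "\<lambda>s. logz s * K s"])
      show "(\<lambda>s. logz s * K s) holomorphic_on quarter" by (intro holomorphic_intros logz(1) holK)
      show "Complex \<sigma> u \<in> quarter" if "1/2 + \<epsilon> \<le> \<sigma>" "t - L \<le> u" for \<sigma> u
        using that \<epsilon> t by (auto simp: quarter_def)
      show "norm (logz (Complex \<sigma> (t - L)) * K (Complex \<sigma> (t - L))) \<le> E"
        "norm (logz (Complex \<sigma> (t + L)) * K (Complex \<sigma> (t + L))) \<le> E" if "1/2 + \<epsilon> \<le> \<sigma>" "\<sigma> \<le> 3/2 + \<epsilon>" for \<sigma>
        using corner[OF that] by blast+
    qed (use L in auto)
    then have main: "norm (integral {t - L..t + L} (\<lambda>u. logz (Complex (1/2 + \<epsilon>) u) * K (Complex (1/2 + \<epsilon>) u))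
        - integral {t - L..t + L} (\<lambda>u. logz (Complex (3/2 + \<epsilon>) u) * K (Complex (3/2 + \<epsilon>) u))) \<le> 2 * E" by simp
    have K1: "K (Complex (1/2 + \<epsilon>) u) = of_real (kcut A L (u - t))" for u
    proof -
      have "Complex (u - t) (- 0) = of_real (u - t)" by (simp add: complex_eq_iff)
      then show ?thesis using K[of 0 u] kernel_cut_of_real[of A L "u - t"] by simp
    qed
    have K2: "K (Complex (3/2 + \<epsilon>) u) = kernel_cut A L (Complex (u - t) (- 1))" for u
      using K[of 1 u] by (simp add: add_ac)
    have cont: "continuous_on {t - L..t + L} (\<lambda>u. logz (Complex (1/2 + \<epsilon>) u) * K (Complex (1/2 + \<epsilon>) u))"
    proof (rule continuous_on_compose2[of quarter "\<lambda>s. logz s * K s" _ "Complex (1/2 + \<epsilon>)"])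
      show "continuous_on quarter (\<lambda>s. logz s * K s)"
        by (intro holomorphic_on_imp_continuous_on holomorphic_intros logz(1) holK)
      show "continuous_on {t - L..t + L} (Complex (1/2 + \<epsilon>))" by (auto simp: Complex_eq intro!: continuous_intros)
      show "Complex (1/2 + \<epsilon>) ` {t - L..t + L} \<subseteq> quarter" using \<epsilon> t by (auto simp: quarter_def)
    qed
    have "Im (integral {t - L..t + L} (\<lambda>u. logz (Complex (1/2 + \<epsilon>) u) * K (Complex (1/2 + \<epsilon>) u)))
       = integral {t - L..t + L} (\<lambda>u. Im (logz (Complex (1/2 + \<epsilon>) u) * K (Complex (1/2 + \<epsilon>) u)))"
      using integral_linear[OF integrable_continuous_real[OF cont] bounded_linear_Im] by (simp add: o_def)
    also have "\<dots> = integral {t - L..t + L} (\<lambda>u. kcut A L (u - t) * Im (logz (Complex (1/2 + \<epsilon>) u)))"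
      unfolding K1 by (simp add: mult.commute)
    finally have I1: "Im (integral {t - L..t + L} (\<lambda>u. logz (Complex (1/2 + \<epsilon>) u) * K (Complex (1/2 + \<epsilon>) u)))
      = integral {t - L..t + L} (\<lambda>u. kcut A L (u - t) * Im (logz (Complex (1/2 + \<epsilon>) u)))" .
    have "integral {t - L..t + L} (\<lambda>u. logz (Complex (3/2 + \<epsilon>) u) * K (Complex (3/2 + \<epsilon>) u))
      = integral {t - L..t + L} (\<lambda>u. log_zeta (Complex (3/2 + \<epsilon>) u) * kernel_cut A L (Complex (u - t) (- 1)))"
      unfolding K2 by (rule integral_cong) (use \<epsilon> t in \<open>simp add: logz(3)\<close>)
    also have "\<dots> = integral {- L..L} (\<lambda>v. log_zeta (Complex (3/2 + \<epsilon>) (v + t)) * kernel_cut A L (Complex v (- 1)))"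
      using integral_shift_real_ivl[of "t - L" t "t + L" "\<lambda>u. log_zeta (Complex (3/2 + \<epsilon>) u) * kernel_cut A L (Complex (u - t) (- 1))"]
      by simp
    finally have I2: "integral {t - L..t + L} (\<lambda>u. logz (Complex (3/2 + \<epsilon>) u) * K (Complex (3/2 + \<epsilon>) u))
      = integral {- L..L} (\<lambda>v. log_zeta (Complex (3/2 + \<epsilon>) (t + v)) * kernel_cut A L (Complex v (- 1)))"
      by (simp add: add.commute)
    have "\<bar>integral {t - L..t + L} (\<lambda>u. kcut A L (u - t) * Im (logz (Complex (1/2 + \<epsilon>) u)))
      - Im (integral {- L..L} (\<lambda>v. log_zeta (Complex (3/2 + \<epsilon>) (t + v)) * kernel_cut A L (Complex v (- 1))))\<bar> \<le> 2 * E"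
      using main abs_Im_le_cmod[of "integral {t - L..t + L} (\<lambda>u. logz (Complex (1/2 + \<epsilon>) u) * K (Complex (1/2 + \<epsilon>) u))
        - integral {t - L..t + L} (\<lambda>u. logz (Complex (3/2 + \<epsilon>) u) * K (Complex (3/2 + \<epsilon>) u))"]
      unfolding minus_complex.sel I1 I2 by linarith
    then show "\<bar>integral {t - L..t + L} (\<lambda>u. kcut A L (u - t) * Im (logz (Complex (1/2 + \<epsilon>) u)))
      - Im (integral {- L..L} (\<lambda>v. log_zeta (Complex (3/2 + \<epsilon>) (t + v)) * kernel_cut A L (Complex v (- 1))))\<bar>
     \<le> 6 * C * ln (t + L) / L * exp (- (A * cosh L / 2))"
      by (simp add: E_def)
  qed
qed

lemma continuous_shifted_integral:
  assumes "L \<ge> 1"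
  shows "((\<lambda>\<epsilon>. integral {- L..L} (\<lambda>v. log_zeta (Complex (3/2 + \<epsilon>) (t + v)) * kernel_cut A L (Complex v (- 1)))) \<longlongrightarrow>
     shifted_integral A L t) (at_right 0)"
proof -
  let ?f = "\<lambda>\<epsilon> v. log_zeta (Complex (3/2 + \<epsilon>) (t + v)) * kernel_cut A L (Complex v (- 1))"
  have "continuous_on {0..1} (\<lambda>\<epsilon>. integral (cbox (- L) L) (?f \<epsilon>))"
  proof (rule integral_continuous_on_param)
    have "continuous_on ({0..1} \<times> cbox (- L) L) (\<lambda>p. log_zeta (Complex (3/2 + fst p) (t + snd p)))"
    proof (rule continuous_on_compose2[OF continuous_on_log_zeta[of "3/2"]])
      show "continuous_on ({0..1} \<times> cbox (- L) L) (\<lambda>p. Complex (3/2 + fst p) (t + snd p))"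
        by (intro continuous_intros)
    qed auto
    moreover have "continuous_on ({0..1} \<times> cbox (- L) L) (\<lambda>p. kernel_cut A L (Complex (snd p) (- 1)))"
    proof (rule continuous_on_compose2[OF holomorphic_on_imp_continuous_on[OF holomorphic_kernel_cut[of L A UNIV]]])
      show "continuous_on ({0..1} \<times> cbox (- L) L) (\<lambda>p. Complex (snd p) (- 1))"
        by (intro continuous_intros)
    qed (use assms in auto)
    ultimately show "continuous_on ({0..1} \<times> cbox (- L) L) (\<lambda>(\<epsilon>, v). ?f \<epsilon> v)"
      unfolding case_prod_unfold by (rule continuous_on_mult)
  qed
  then have "\<forall>x\<in>{0..1}. ((\<lambda>\<epsilon>. integral (cbox (- L) L) (?f \<epsilon>)) \<longlongrightarrow> integral (cbox (- L) L) (?f x)) (at x within {0..1})"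
    unfolding continuous_on_def .
  then have "((\<lambda>\<epsilon>. integral (cbox (- L) L) (?f \<epsilon>)) \<longlongrightarrow> integral (cbox (- L) L) (?f 0)) (at 0 within {0..1})"
    by (rule bspec) simp
  then have "((\<lambda>\<epsilon>. integral (cbox (- L) L) (?f \<epsilon>)) \<longlongrightarrow> integral (cbox (- L) L) (?f 0)) (at_right 0)"
    by (simp only: at_within_Icc_at_right[OF zero_less_one])
  then show ?thesis by (simp add: shifted_integral_def)
qed

text \<open>Here \<open>\<epsilon>\<close> tends to 0: the left integral converges by
  \<open>boundary_integral\<close>, the right one by continuity of the Dirichlet series.\<close>

lemma smoothed_identity:
  obtains C where "C > 0" "\<And>A L t. A \<ge> 0 \<Longrightarrow> L \<ge> 1 \<Longrightarrow> t - L \<ge> 3 \<Longrightarrow>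
    \<bar>integral {t - L..t + L} (\<lambda>u. kcut A L (u - t) * (pi * real (counting u) - theta u + boundary_const))
      - Im (shifted_integral A L t)\<bar> \<le> C * ln (t + L) / L * exp (- (A * cosh L / 2))"
proof -
  obtain C where C: "C > 0" "\<And>A L t \<epsilon>. A \<ge> 0 \<Longrightarrow> L \<ge> 1 \<Longrightarrow> t - L \<ge> 3 \<Longrightarrow> 0 < \<epsilon> \<Longrightarrow> \<epsilon> < 1/2 \<Longrightarrow>
    \<bar>integral {t - L..t + L} (\<lambda>u. kcut A L (u - t) * Im (logz (Complex (1/2 + \<epsilon>) u)))
      - Im (integral {- L..L} (\<lambda>v. log_zeta (Complex (3/2 + \<epsilon>) (t + v)) * kernel_cut A L (Complex v (- 1))))\<bar>
     \<le> C * ln (t + L) / L * exp (- (A * cosh L / 2))"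
    by (rule smoothed_shift) (rule that)
  show ?thesis
  proof (rule that[OF C(1)])
    fix A L t :: real assume A: "A \<ge> 0" and L: "L \<ge> 1" and t: "t - L \<ge> 3"
    have "continuous_on {t - L..t + L} (\<lambda>u. kcut A L (u - t))"
      unfolding kcut_def using L by (intro continuous_intros) auto
    from conjunct2[OF boundary_integral[OF _ this]] t
    have 1: "((\<lambda>\<epsilon>. integral {t - L..t + L} (\<lambda>u. kcut A L (u - t) * Im (logz (Complex (1/2 + \<epsilon>) u)))) \<longlongrightarrow>
      integral {t - L..t + L} (\<lambda>u. kcut A L (u - t) * (pi * real (counting u) - theta u + boundary_const))) (at_right 0)"
      by simp
    note 2 = tendsto_Im[OF continuous_shifted_integral[OF L, of t A]]
    show "\<bar>integral {t - L..t + L} (\<lambda>u. kcut A L (u - t) * (pi * real (counting u) - theta u + boundary_const))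
      - Im (shifted_integral A L t)\<bar> \<le> C * ln (t + L) / L * exp (- (A * cosh L / 2))"
    proof (rule tendsto_upperbound[OF tendsto_rabs[OF tendsto_diff[OF 1 2]]])
      show "\<forall>\<^sub>F \<epsilon> in at_right 0. \<bar>integral {t - L..t + L} (\<lambda>u. kcut A L (u - t) * Im (logz (Complex (1/2 + \<epsilon>) u)))
      - Im (integral {- L..L} (\<lambda>v. log_zeta (Complex (3/2 + \<epsilon>) (t + v)) * kernel_cut A L (Complex v (- 1))))\<bar>
     \<le> C * ln (t + L) / L * exp (- (A * cosh L / 2))"
      proof (rule eventually_mono[OF eventually_at_right_real[of 0 "1/2"]])
        fix \<epsilon> :: real assume "\<epsilon> \<in> {0<..<1/2}"
        then show "\<bar>integral {t - L..t + L} (\<lambda>u. kcut A L (u - t) * Im (logz (Complex (1/2 + \<epsilon>) u)))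
          - Im (integral {- L..L} (\<lambda>v. log_zeta (Complex (3/2 + \<epsilon>) (t + v)) * kernel_cut A L (Complex v (- 1))))\<bar>
         \<le> C * ln (t + L) / L * exp (- (A * cosh L / 2))"
          by (intro C(2) A L t) auto
      qed simp
    qed simp
  qed
qed

end

section \<open>The kernel on the whole line and its Fourier transform\<close>

lemma integrable_exp_abs: "(\<lambda>v::real. exp (- 2 * \<bar>v\<bar>)) integrable_on UNIV"
proof -
  have "(\<lambda>v::real. exp (- 2 * v)) integrable_on {0..}"
    using integrable_on_exp_minus_to_infinity[of 2 0] by simp
  then have 1: "(\<lambda>v::real. exp (- 2 * \<bar>v\<bar>)) integrable_on {0..}"
    by (rule integrable_eq) auto
  have "(\<lambda>v::real. \<bar>- 1\<bar> *\<^sub>R exp (- 2 * \<bar>- v\<bar>)) absolutely_integrable_on {0..}"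
    using 1 by (intro nonnegative_absolutely_integrable_1) auto
  then have "(\<lambda>v::real. exp (- 2 * \<bar>v\<bar>)) absolutely_integrable_on uminus ` {0..}"
    by (subst absolutely_integrable_change_of_variables_real[where h = "\<lambda>_. - 1"])
       (auto intro!: derivative_eq_intros)
  moreover have "uminus ` {0..} = {..0::real}" by (auto intro!: image_eqI[of _ _ "- x" for x])
  ultimately have 2: "(\<lambda>v::real. exp (- 2 * \<bar>v\<bar>)) integrable_on {..0}"
    by (simp add: absolutely_integrable_on_def)
  have "(\<lambda>v::real. exp (- 2 * \<bar>v\<bar>)) integrable_on ({..0} \<union> {0..})"
    by (rule integrable_Un[OF _ 2 1]) (auto intro: negligible_subset[of "{0}"])
  moreover have "{..0} \<union> {0..} = (UNIV :: real set)" by auto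
  ultimately show ?thesis by simp
qed

definition exp_abs_mass :: real where
  "exp_abs_mass = integral UNIV (\<lambda>v::real. exp (- 2 * \<bar>v\<bar>))"

text \<open>The one majorant \<open>exp (- 2 * \<bar>v\<bar>)\<close> serves all kernels with
  \<open>A \<ge> 8\<close>, whose integrals are thus bounded independently of
  \<open>A\<close>.\<close>

lemma integrable_by_exp_abs:
  fixes h :: "real \<Rightarrow> 'a::euclidean_space"
  assumes "continuous_on UNIV h" "\<And>v. norm (h v) \<le> C * exp (- 2 * \<bar>v\<bar>)"
  shows "h integrable_on UNIV" "norm (integral UNIV h) \<le> C * exp_abs_mass"
proof -
  show i: "h integrable_on UNIV"
  proof (rule measurable_bounded_by_integrable_imp_integrable)
    show "h \<in> borel_measurable (lebesgue_on UNIV)"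
      using assms(1) by (intro continuous_imp_measurable_on_sets_lebesgue) auto
    show "(\<lambda>v. C * exp (- 2 * \<bar>v\<bar>)) integrable_on UNIV"
      by (intro integrable_on_mult_right integrable_exp_abs)
  qed (use assms in auto)
  have "norm (integral UNIV h) \<le> integral UNIV (\<lambda>v. C * exp (- 2 * \<bar>v\<bar>))"
    by (rule integral_norm_bound_integral[OF i]) (intro integrable_on_mult_right integrable_exp_abs assms)+
  then show "norm (integral UNIV h) \<le> C * exp_abs_mass" by (simp add: exp_abs_mass_def)
qed

lemma integral_tendsto_UNIV:
  fixes h :: "real \<Rightarrow> 'a::euclidean_space"
  assumes c: "continuous_on UNIV h" and b: "\<And>v. norm (h v) \<le> C * exp (- 2 * \<bar>v\<bar>)"
  shows "(\<lambda>n. integral {- real n..real n} h) \<longlonglongrightarrow> integral UNIV h"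
proof -
  let ?f = "\<lambda>n v. if v \<in> {- real n..real n} then h v else 0"
  have "(\<lambda>n. integral UNIV (?f n)) \<longlonglongrightarrow> integral UNIV h"
  proof (rule dominated_convergence(2)[where h = "\<lambda>v. C * exp (- 2 * \<bar>v\<bar>)"])
    show "?f n integrable_on UNIV" for n
      unfolding integrable_restrict_UNIV by (rule integrable_continuous_real) (rule continuous_on_subset[OF c], simp)
    show "(\<lambda>v. C * exp (- 2 * \<bar>v\<bar>)) integrable_on UNIV" by (intro integrable_on_mult_right integrable_exp_abs)
    show "norm (?f n v) \<le> C * exp (- 2 * \<bar>v\<bar>)" for n v
    proof -
      have "0 \<le> C * exp (- 2 * \<bar>v\<bar>)" using b[of v] norm_ge_zero order_trans by blast
      then show ?thesis using b[of v] by simp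
    qed
    show "(\<lambda>n. ?f n v) \<longlonglongrightarrow> h v" for v
    proof (rule tendsto_eventually)
      obtain N :: nat where N: "\<bar>v\<bar> \<le> real N" using real_arch_simple by blast
      show "\<forall>\<^sub>F n in sequentially. ?f n v = h v"
        using eventually_ge_at_top[of N] by eventually_elim (use N in auto)
    qed
  qed
  then show ?thesis by (simp only: integral_restrict_UNIV)
qed

lemma sinh_ge_self: "x \<ge> 0 \<Longrightarrow> x \<le> sinh x" for x :: real
proof -
  assume x: "x \<ge> 0"
  have "(\<lambda>x. sinh x - x) 0 \<le> (\<lambda>x. sinh x - x) x"
    by (rule DERIV_nonneg_imp_nondecreasing[OF x])
       (auto intro!: exI derivative_eq_intros simp: cosh_real_ge_1)
  then show ?thesis by simp
qed

lemma cosh_ge_square: "1 + v\<^sup>2 / 2 \<le> cosh v" for v :: real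
proof -
  have *: "1 + v\<^sup>2 / 2 \<le> cosh v" if "v \<ge> 0" for v :: real
  proof -
    have "(\<lambda>x. cosh x - (1 + x\<^sup>2 / 2)) 0 \<le> (\<lambda>x. cosh x - (1 + x\<^sup>2 / 2)) v"
      by (rule DERIV_nonneg_imp_nondecreasing[OF that])
         (auto intro!: exI derivative_eq_intros sinh_ge_self)
    then show ?thesis by simp
  qed
  show ?thesis using *[of "\<bar>v\<bar>"] by (cases "v \<ge> 0") (auto simp: abs_if)
qed

lemma abs_le_cosh: "\<bar>v\<bar> \<le> cosh v" for v :: real
proof -
  have "0 \<le> (\<bar>v\<bar> - 1)\<^sup>2" by simp
  then have "\<bar>v\<bar> \<le> 1 + v\<^sup>2 / 2" by (simp add: power2_eq_square algebra_simps)
  then show ?thesis using cosh_ge_square[of v] by linarith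
qed

text \<open>With \<open>c = cosh v\<close> the exponent \<open>A * c / 2\<close> is at least
  \<open>4 * c\<close>: one half pays for
  \<open>v\<^sup>2 + 1 \<le> 2 * c \<le> exp (2 * c)\<close>, the other half gives
  \<open>exp (- 2 * \<bar>v\<bar>)\<close>. This is the origin of the bound 8.\<close>

lemma kernel_majorant:
  fixes A v :: real
  assumes "A \<ge> 8"
  shows "(v\<^sup>2 + 1) * exp (- (A * cosh v / 2)) \<le> exp (- 2 * \<bar>v\<bar>)"
proof -
  define c where "c = cosh v"
  have c: "v\<^sup>2 + 1 \<le> 2 * c" "\<bar>v\<bar> \<le> c" "c \<ge> 1"
    using cosh_ge_square[of v] abs_le_cosh[of v] cosh_real_ge_1[of v] by (auto simp: c_def)
  have "(v\<^sup>2 + 1) * exp (- (A * c / 2)) \<le> (2 * c) * exp (- (A * c / 2))"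
    using c by (intro mult_right_mono) auto
  also have "2 * c \<le> exp (2 * c)" using exp_ge_add_one_self[of "2 * c"] by linarith
  then have "(2 * c) * exp (- (A * c / 2)) \<le> exp (2 * c) * exp (- (A * c / 2))" by (intro mult_right_mono) auto
  also have "\<dots> = exp (2 * c - A * c / 2)" by (simp flip: exp_add)
  also have "\<dots> \<le> exp (- 2 * \<bar>v\<bar>)"
  proof -
    have "8 * c \<le> A * c" using assms c by (intro mult_right_mono) auto
    then have "2 * c - A * c / 2 \<le> - 2 * \<bar>v\<bar>" using c by linarith
    then show ?thesis by (simp only: exp_le_cancel_iff)
  qed
  finally show ?thesis by (simp add: c_def)
qed

lemma kernel_majorant':
  fixes A v :: real
  assumes "A \<ge> 8"
  shows "exp (- (A * cosh v / 2)) \<le> exp (- 2 * \<bar>v\<bar>)" "exp (- (A * cosh v)) \<le> exp (- 2 * \<bar>v\<bar>)"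
proof -
  have "1 * exp (- (A * cosh v / 2)) \<le> (v\<^sup>2 + 1) * exp (- (A * cosh v / 2))"
    by (intro mult_right_mono) auto
  then show 1: "exp (- (A * cosh v / 2)) \<le> exp (- 2 * \<bar>v\<bar>)" using kernel_majorant[OF assms, of v] by linarith
  have "A * cosh v \<ge> 0" using assms by simp
  then have "exp (- (A * cosh v)) \<le> exp (- (A * cosh v / 2))" by simp
  then show "exp (- (A * cosh v)) \<le> exp (- 2 * \<bar>v\<bar>)" using 1 by linarith
qed

lemma norm_kern_majorant:
  assumes "A \<ge> 8" "0 \<le> y" "y \<le> 1"
  shows "norm (kern A (Complex v (- y))) \<le> exp (- 2 * \<bar>v\<bar>)"
  using norm_kern_le[of A y v] kernel_majorant'(1)[OF assms(1), of v] assms by linarith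

text \<open>The Fourier transform of the even kernel; as a function of \<open>x\<close> it is twice
  the modified Bessel function of the second kind of order \<open>\<i> * x\<close> at
  \<open>A\<close>.\<close>

definition khat :: "real \<Rightarrow> real \<Rightarrow> real" where
  "khat A x = integral UNIV (\<lambda>v. cos (x * v) * exp (- (A * cosh v)))"

lemma khat_tendsto:
  assumes "A \<ge> 8"
  shows "(\<lambda>n. integral {- real n..real n} (\<lambda>v. cos (x * v) * exp (- (A * cosh v)))) \<longlonglongrightarrow> khat A x"
  unfolding khat_def
proof (rule integral_tendsto_UNIV[where C = 1])
  show "continuous_on UNIV (\<lambda>v. cos (x * v) * exp (- (A * cosh v)))" by (intro continuous_intros)
  show "norm (cos (x * v) * exp (- (A * cosh v))) \<le> 1 * exp (- 2 * \<bar>v\<bar>)" for v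
    using kernel_majorant'(2)[OF assms, of v] mult_mono[of "\<bar>cos (x * v)\<bar>" 1 "exp (- (A * cosh v))" "exp (- 2 * \<bar>v\<bar>)"]
    by (simp add: abs_mult)
qed

text \<open>Moving the line of integration from \<open>Im w = - 1\<close> back to the real axis
  multiplies by \<open>exp x\<close>, and the odd sine part integrates to 0. For
  \<open>x = ln n\<close> this turns \<open>n powr (- 3/2)\<close> into
  \<open>n powr (- 1/2)\<close>.\<close>

lemma khat_shift:
  assumes A: "A \<ge> 8" and x: "x \<ge> 0"
  shows "integral UNIV (\<lambda>v. cis (- (x * v)) * kern A (Complex v (- 1))) = of_real (exp x * khat A x)"
proof -
  \<comment> \<open>In the variable \<open>s = \<i> * w\<close>, so that the vertical lines
    \<open>Re s = 0\<close> and \<open>Re s = 1\<close> of \<open>vertical_shift_bound\<close> are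
    \<open>Im w = 0\<close> and \<open>Im w = - 1\<close>.\<close>
  define f where "f s = exp (- \<i> * of_real x * (- \<i> * s)) * kern A (- \<i> * s)" for s
  have iy: "- \<i> * Complex y v = Complex v (- y)" for y v by (simp add: complex_eq_iff)
  have fy: "f (Complex y v) = of_real (exp (- (x * y))) * cis (- (x * v)) * kern A (Complex v (- y))" for y v
  proof -
    have "- \<i> * of_real x * (- \<i> * Complex y v) = of_real (- (x * y)) + \<i> * of_real (- (x * v))"
      by (simp add: complex_eq_iff)
    then have "exp (- \<i> * of_real x * (- \<i> * Complex y v)) = of_real (exp (- (x * y))) * cis (- (x * v))"
      by (simp only: exp_add exp_of_real cis_conv_exp)
    then show ?thesis by (simp only: f_def iy)
  qed
  have fh: "f holomorphic_on UNIV"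
    unfolding f_def
    by (intro holomorphic_intros holomorphic_on_compose_gen[OF _ holomorphic_kern[of A UNIV], unfolded o_def]) auto
  have contf: "continuous_on UNIV (\<lambda>v. f (Complex y v))" for y
    by (rule continuous_on_compose2[OF holomorphic_on_imp_continuous_on[OF fh]])
       (auto simp: Complex_eq intro!: continuous_intros)
  have nf: "norm (f (Complex y v)) \<le> exp (- (A * cosh v / 2))" if "0 \<le> y" "y \<le> 1" for y v
  proof -
    have "norm (f (Complex y v)) = exp (- (x * y)) * norm (kern A (Complex v (- y)))"
      by (simp add: fy norm_mult)
    also have "\<dots> \<le> 1 * exp (- (A * cosh v / 2))"
      using norm_kern_le[of A y v] that x A by (intro mult_mono) auto
    finally show ?thesis by simp
  qed
  have bf: "norm (f (Complex y v)) \<le> 1 * exp (- 2 * \<bar>v\<bar>)" if "0 \<le> y" "y \<le> 1" for y v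
    using order_trans[OF nf[OF that, of v] kernel_majorant'(1)[OF A, of v]] by simp
  have lim: "(\<lambda>n. integral {- real n..real n} (\<lambda>v. f (Complex y v))) \<longlonglongrightarrow> integral UNIV (\<lambda>v. f (Complex y v))" if "0 \<le> y" "y \<le> 1" for y
    by (rule integral_tendsto_UNIV[OF contf bf[OF that]])
  have D0: "(\<lambda>n. integral {- real n..real n} (\<lambda>v. f (Complex 0 v)) - integral {- real n..real n} (\<lambda>v. f (Complex 1 v))) \<longlonglongrightarrow> 0"
  proof (rule Lim_null_comparison)
    show "\<forall>\<^sub>F n in sequentially. norm (integral {- real n..real n} (\<lambda>v. f (Complex 0 v)) - integral {- real n..real n} (\<lambda>v. f (Complex 1 v)))
       \<le> 2 * exp (- 2 * real n) * (1 - 0)"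
    proof (rule always_eventually, rule allI)
      fix n
      show "norm (integral {- real n..real n} (\<lambda>v. f (Complex 0 v)) - integral {- real n..real n} (\<lambda>v. f (Complex 1 v)))
         \<le> 2 * exp (- 2 * real n) * (1 - 0)"
      proof (rule vertical_shift_bound[OF convex_UNIV open_UNIV fh])
        show "norm (f (Complex y (- real n))) \<le> exp (- 2 * real n)" "norm (f (Complex y (real n))) \<le> exp (- 2 * real n)"
          if "0 \<le> y" "y \<le> 1" for y
          using bf[OF that, of "- real n"] bf[OF that, of "real n"] by simp_all
      qed simp_all
    qed
    show "(\<lambda>n. 2 * exp (- 2 * real n) * (1 - 0)) \<longlonglongrightarrow> 0" by real_asymp
  qed
  have D1: "(\<lambda>n. integral {- real n..real n} (\<lambda>v. f (Complex 0 v)) - integral {- real n..real n} (\<lambda>v. f (Complex 1 v)))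
     \<longlonglongrightarrow> integral UNIV (\<lambda>v. f (Complex 0 v)) - integral UNIV (\<lambda>v. f (Complex 1 v))"
    by (intro tendsto_diff lim) auto
  have eq: "integral UNIV (\<lambda>v. f (Complex 0 v)) = integral UNIV (\<lambda>v. f (Complex 1 v))"
    using LIMSEQ_unique[OF D1 D0] by simp
  have f0: "f (Complex 0 v) = Complex (cos (x * v) * exp (- (A * cosh v))) (- (sin (x * v) * exp (- (A * cosh v))))" for v
  proof -
    have c: "Complex v (- 0) = of_real v" by (simp add: complex_eq_iff)
    show ?thesis unfolding fy c kern_of_real by (simp add: complex_eq_iff)
  qed
  have int: "integral {- real n..real n} (\<lambda>v. f (Complex 0 v)) = of_real (integral {- real n..real n} (\<lambda>v. cos (x * v) * exp (- (A * cosh v))))" for n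
  proof -
    have c1: "(\<lambda>v. f (Complex 0 v)) integrable_on {- real n..real n}"
      by (rule integrable_continuous_real[OF continuous_on_subset[OF contf]]) simp
    have "Re (integral {- real n..real n} (\<lambda>v. f (Complex 0 v))) = integral {- real n..real n} (\<lambda>v. cos (x * v) * exp (- (A * cosh v)))"
      using integral_linear[OF c1 bounded_linear_Re] by (simp add: o_def f0)
    moreover have "Im (integral {- real n..real n} (\<lambda>v. f (Complex 0 v))) = integral {- real n..real n} (\<lambda>v. - (sin (x * v) * exp (- (A * cosh v))))"
      using integral_linear[OF c1 bounded_linear_Im] by (simp add: o_def f0)
    moreover have "integral {- real n..real n} (\<lambda>v. - (sin (x * v) * exp (- (A * cosh v)))) = 0"
    proof -
      let ?g = "\<lambda>v. - (sin (x * v) * exp (- (A * cosh v)))"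
      have "integral {- real n..- (- real n)} (\<lambda>v. ?g (- v)) = integral {- real n..real n} ?g"
        using Henstock_Kurzweil_Integration.integral_reflect_real[of "real n" "- real n" ?g] by simp
      moreover have "(\<lambda>v. ?g (- v)) = (\<lambda>v. - ?g v)" by auto
      ultimately have "- integral {- real n..real n} ?g = integral {- real n..real n} ?g" by simp
      then show ?thesis by simp
    qed
    ultimately show ?thesis by (simp add: complex_eq_iff)
  qed
  have D2: "(\<lambda>n. integral {- real n..real n} (\<lambda>v. f (Complex 0 v))) \<longlonglongrightarrow> of_real (khat A x)"
    unfolding int by (intro tendsto_of_real khat_tendsto A)
  have 0: "integral UNIV (\<lambda>v. f (Complex 0 v)) = of_real (khat A x)"
    by (rule LIMSEQ_unique[OF lim D2]) simp_all
  have "integral UNIV (\<lambda>v. f (Complex 1 v)) = of_real (exp (- x)) * integral UNIV (\<lambda>v. cis (- (x * v)) * kern A (Complex v (- 1)))"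
    unfolding fy by (simp add: mult.assoc)
  then have "of_real (khat A x) = complex_of_real (exp (- x)) * integral UNIV (\<lambda>v. cis (- (x * v)) * kern A (Complex v (- 1)))"
    using 0 eq by simp
  then have "complex_of_real (exp x) * of_real (khat A x) = complex_of_real (exp x * exp (- x)) * integral UNIV (\<lambda>v. cis (- (x * v)) * kern A (Complex v (- 1)))"
    by (simp only: of_real_mult mult.assoc)
  also have "exp x * exp (- x) = 1" by (simp flip: exp_add)
  finally show ?thesis by simp
qed

lemma cos_ge_quadratic: "1 - x\<^sup>2 / 2 \<le> cos x" for x :: real
proof -
  have "\<bar>sin (x / 2)\<bar>\<^sup>2 \<le> \<bar>x / 2\<bar>\<^sup>2" by (intro power_mono abs_sin_x_le_abs_x) auto
  then have "(sin (x / 2))\<^sup>2 \<le> x\<^sup>2 / 4" by (simp add: power_divide)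
  then show ?thesis using cos_double_sin[of "x / 2"] by simp
qed

text \<open>Since \<open>cos y \<ge> 1 - y\<^sup>2 / 2\<close>, a bound on the second moment
  suffices, and that moment is at most \<open>1 / A\<close> times the mass. For
  \<open>x\<^sup>2 \<le> A\<close> at least half of \<open>khat A 0\<close> is left, which makes the
  weights of many primes comparable.\<close>

lemma khat_lower:
  assumes A: "A \<ge> 8"
  shows "khat A x \<ge> (1 - x\<^sup>2 / (2 * A)) * khat A 0" and "khat A 0 > 0"
proof -
  have A0: "A > 0" using A by simp
  let ?k = "\<lambda>v. exp (- (A * cosh v))"
  have fin: "integral {- real n..real n} (\<lambda>v. cos (x * v) * ?k v) \<ge> (1 - x\<^sup>2 / (2 * A)) * integral {- real n..real n} ?k" for n
  proof -
    let ?S = "{- real n..real n}"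
    have ik: "?k integrable_on ?S" "(\<lambda>v. v\<^sup>2 * ?k v) integrable_on ?S" "(\<lambda>v. cos (x * v) * ?k v) integrable_on ?S"
      "(\<lambda>v. ?k v - A * (v\<^sup>2 * ?k v)) integrable_on ?S" "(\<lambda>v. ?k v - A * (v * sinh v * ?k v)) integrable_on ?S"
      by (intro integrable_continuous_real continuous_intros)+
    \<comment> \<open>The integrand is the derivative of \<open>v * exp (- (A * cosh v))\<close>,
      whose end values contribute nonnegatively; with \<open>v\<^sup>2 \<le> v * sinh v\<close> this
      bounds the second moment.\<close>
    have "((\<lambda>v. ?k v - A * (v * sinh v * ?k v)) has_integral (real n * ?k (real n) - (- real n) * ?k (- real n))) ?S"
    proof (rule fundamental_theorem_of_calculus)
      fix v
      show "((\<lambda>v. v * ?k v) has_vector_derivative ?k v - A * (v * sinh v * ?k v)) (at v within ?S)"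
        unfolding has_real_derivative_iff_has_vector_derivative[symmetric]
        by (auto intro!: derivative_eq_intros simp: algebra_simps)
    qed simp
    then have "0 \<le> integral ?S (\<lambda>v. ?k v - A * (v * sinh v * ?k v))"
      by (subst integral_unique) auto
    also have "\<dots> \<le> integral ?S (\<lambda>v. ?k v - A * (v\<^sup>2 * ?k v))"
    proof (rule integral_le[OF ik(5,4)])
      fix v :: real
      have "v\<^sup>2 \<le> v * sinh v"
      proof (cases "v \<ge> 0")
        case True
        then show ?thesis using mult_left_mono[OF sinh_ge_self[OF True] True] by (simp add: power2_eq_square)
      next
        case False
        then have "(- v) * (- v) \<le> (- v) * sinh (- v)" by (intro mult_left_mono sinh_ge_self) auto
        then show ?thesis by (simp add: power2_eq_square)
      qed
      then have "A * (v\<^sup>2 * ?k v) \<le> A * (v * sinh v * ?k v)" using A0 by (intro mult_left_mono mult_right_mono) auto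
      then show "?k v - A * (v * sinh v * ?k v) \<le> ?k v - A * (v\<^sup>2 * ?k v)" by simp
    qed
    also have "\<dots> = integral ?S ?k - A * integral ?S (\<lambda>v. v\<^sup>2 * ?k v)"
      using ik by (subst integral_diff) (auto intro: integrable_on_mult_right)
    finally have m2: "A * integral ?S (\<lambda>v. v\<^sup>2 * ?k v) \<le> integral ?S ?k" by simp
    have "integral ?S ?k - x\<^sup>2 / 2 * integral ?S (\<lambda>v. v\<^sup>2 * ?k v) = integral ?S (\<lambda>v. ?k v - x\<^sup>2 / 2 * (v\<^sup>2 * ?k v))"
      using ik by (subst integral_diff) (auto intro: integrable_on_mult_right)
    also have "\<dots> \<le> integral ?S (\<lambda>v. cos (x * v) * ?k v)"
    proof (rule integral_le[OF _ ik(3)])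
      show "(\<lambda>v. ?k v - x\<^sup>2 / 2 * (v\<^sup>2 * ?k v)) integrable_on ?S"
        by (intro integrable_continuous_real continuous_intros)
      fix v :: real
      have "1 - (x * v)\<^sup>2 / 2 \<le> cos (x * v)" by (rule cos_ge_quadratic)
      then have "(1 - (x * v)\<^sup>2 / 2) * ?k v \<le> cos (x * v) * ?k v" by (intro mult_right_mono) auto
      then show "?k v - x\<^sup>2 / 2 * (v\<^sup>2 * ?k v) \<le> cos (x * v) * ?k v"
        by (simp add: algebra_simps power_mult_distrib)
    qed
    finally have "integral ?S ?k - x\<^sup>2 / 2 * integral ?S (\<lambda>v. v\<^sup>2 * ?k v) \<le> integral ?S (\<lambda>v. cos (x * v) * ?k v)" .
    moreover have "x\<^sup>2 / 2 * integral ?S (\<lambda>v. v\<^sup>2 * ?k v) \<le> x\<^sup>2 / 2 * (integral ?S ?k / A)"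
      using m2 A0 by (intro mult_left_mono) (auto simp: field_simps)
    ultimately show ?thesis by (simp add: algebra_simps)
  qed
  have L0: "(\<lambda>n. integral {- real n..real n} ?k) \<longlonglongrightarrow> khat A 0"
    using khat_tendsto[OF A, of 0] by simp
  show "khat A x \<ge> (1 - x\<^sup>2 / (2 * A)) * khat A 0"
    by (rule LIMSEQ_le[OF tendsto_mult[OF tendsto_const L0] khat_tendsto[OF A]]) (use fin in blast)
  have pos: "integral {- real 1..real 1} ?k > 0"
  proof -
    have "integral {- real 1..real 1} (\<lambda>v. exp (- (A * cosh 1))) \<le> integral {- real 1..real 1} ?k"
    proof (rule integral_le)
      fix v assume v: "v \<in> {- real 1..real 1}"
      have "cosh v \<le> cosh (1::real)" using v by (subst cosh_real_abs[symmetric]) (intro cosh_real_nonneg_le_iff[THEN iffD2], auto)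
      then show "exp (- (A * cosh 1)) \<le> ?k v" using A0 by simp
    qed (auto intro!: integrable_continuous_real continuous_intros)
    moreover have "integral {- real 1..real 1} (\<lambda>v. exp (- (A * cosh 1))) > 0" by simp
    ultimately show ?thesis by linarith
  qed
  have "integral {- real 1..real 1} ?k \<le> khat A 0"
  proof (rule LIMSEQ_le_const[OF L0], intro exI[of _ 1] allI impI)
    fix n :: nat assume "1 \<le> n"
    then show "integral {- real 1..real 1} ?k \<le> integral {- real n..real n} ?k"
      by (intro integral_subset_le integrable_continuous_real continuous_intros) auto
  qed
  then show "khat A 0 > 0" using pos by linarith
qed

section \<open>Approximation by a Dirichlet polynomial\<close>

definition zpoly :: "real \<Rightarrow> nat \<Rightarrow> real \<Rightarrow> complex" where
  "zpoly A X t = (\<Sum>n<X. of_real (log_zeta_coeff n * real n powr (- 1/2) * khat A (ln (real n))) * cis (- (t * ln (real n))))"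

lemma continuous_on_kern_line: "continuous_on UNIV (\<lambda>v. kern A (Complex v (- 1)))"
  by (rule continuous_on_compose2[OF holomorphic_on_imp_continuous_on[OF holomorphic_kern[of A UNIV]]])
     (auto intro!: continuous_intros)

lemma continuous_on_log_zeta_line: "continuous_on UNIV (\<lambda>v. log_zeta (Complex (3/2) (t + v)))"
  by (rule continuous_on_compose2[OF continuous_on_log_zeta[of "3/2"]]) (auto intro!: continuous_intros)

text \<open>Inside the window the kernels differ by the factor \<open>w\<^sup>2 / L\<^sup>2\<close>;
  outside, \<open>1 \<le> (v\<^sup>2 + 1) / L\<^sup>2\<close>. Both parts are thus at most
  \<open>1 / L\<^sup>2\<close> times the same integrable majorant.\<close>

lemma shifted_integral_full_line:
  assumes A: "A \<ge> 8" and L: "L \<ge> 1" and Cz: "\<And>s. Re s \<ge> 3/2 \<Longrightarrow> norm (log_zeta s) \<le> Cz"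
  shows "norm (shifted_integral A L t - integral UNIV (\<lambda>v. log_zeta (Complex (3/2) (t + v)) * kern A (Complex v (- 1))))
     \<le> Cz / L\<^sup>2 * exp_abs_mass"
proof -
  let ?F = "\<lambda>v. log_zeta (Complex (3/2) (t + v))"
  let ?k = "\<lambda>v. kern A (Complex v (- 1))"
  let ?c = "\<lambda>v. kernel_cut A L (Complex v (- 1))"
  let ?g = "\<lambda>v. if v \<in> {- L..L} then ?F v * ?c v else 0"
  have Cz0: "Cz \<ge> 0" using order_trans[OF norm_ge_zero Cz[of 2]] by simp
  have L2: "L\<^sup>2 > 0" using L by simp
  have contc: "continuous_on UNIV ?c"
    by (rule continuous_on_compose2[OF holomorphic_on_imp_continuous_on[OF holomorphic_kernel_cut[of L A UNIV]]])
       (use L in \<open>auto intro!: continuous_intros\<close>)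
  have ig: "?g integrable_on UNIV"
    unfolding integrable_restrict_UNIV
    by (intro integrable_continuous_real continuous_on_mult continuous_on_subset[OF continuous_on_log_zeta_line]
        continuous_on_subset[OF contc]) auto
  have ik: "(\<lambda>v. ?F v * ?k v) integrable_on UNIV"
  proof (rule integrable_by_exp_abs(1))
    show "continuous_on UNIV (\<lambda>v. ?F v * ?k v)"
      by (intro continuous_on_mult continuous_on_kern_line continuous_on_log_zeta_line)
    show "norm (?F v * ?k v) \<le> Cz * exp (- 2 * \<bar>v\<bar>)" for v
      unfolding norm_mult using Cz[of "Complex (3/2) (t + v)"] norm_kern_majorant[OF A, of 1 v] Cz0
      by (intro mult_mono) auto
  qed
  have w2: "norm ((Complex v (- 1))\<^sup>2) = v\<^sup>2 + 1" for v
    unfolding norm_power by (simp add: cmod_power2)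
  have bound: "norm (?g v - ?F v * ?k v) \<le> Cz / L\<^sup>2 * exp (- 2 * \<bar>v\<bar>)" for v
  proof -
    have F: "norm (?F v) \<le> Cz" by (rule Cz) simp
    have kk: "norm (?k v) \<le> exp (- (A * cosh v / 2))" using norm_kern_le[of A 1 v] A by simp
    have "norm (?g v - ?F v * ?k v) \<le> Cz * ((v\<^sup>2 + 1) / L\<^sup>2 * exp (- (A * cosh v / 2)))"
    proof (cases "v \<in> {- L..L}")
      case True
      have "?g v - ?F v * ?k v = - (?F v * ((Complex v (- 1))\<^sup>2 / of_real (L\<^sup>2) * ?k v))"
        using True by (simp add: kernel_cut_def algebra_simps)
      then have "norm (?g v - ?F v * ?k v) = norm (?F v) * ((v\<^sup>2 + 1) / L\<^sup>2 * norm (?k v))"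
        by (simp add: norm_mult norm_divide w2 del: of_real_power)
      also have "\<dots> \<le> Cz * ((v\<^sup>2 + 1) / L\<^sup>2 * exp (- (A * cosh v / 2)))"
        using F kk Cz0 L2 by (intro mult_mono) auto
      finally show ?thesis .
    next
      case False
      then have "L \<le> \<bar>v\<bar>" by auto
      then have "L\<^sup>2 \<le> v\<^sup>2" using power_mono[of L "\<bar>v\<bar>" 2] L by simp
      then have one: "1 \<le> (v\<^sup>2 + 1) / L\<^sup>2" using L2 by (simp add: le_divide_eq)
      have g0: "?g v = 0" by (rule if_not_P[OF False])
      have "norm (?g v - ?F v * ?k v) = norm (?F v) * norm (?k v)" unfolding g0 by (simp add: norm_mult)
      also have "\<dots> \<le> Cz * (1 * exp (- (A * cosh v / 2)))"
        using F kk Cz0 by (intro mult_mono) auto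
      also have "\<dots> \<le> Cz * ((v\<^sup>2 + 1) / L\<^sup>2 * exp (- (A * cosh v / 2)))"
        using one Cz0 by (intro mult_left_mono mult_right_mono) auto
      finally show ?thesis .
    qed
    also have "\<dots> = Cz / L\<^sup>2 * ((v\<^sup>2 + 1) * exp (- (A * cosh v / 2)))" by simp
    also have "\<dots> \<le> Cz / L\<^sup>2 * exp (- 2 * \<bar>v\<bar>)"
      using kernel_majorant[OF A, of v] Cz0 by (intro mult_left_mono) auto
    finally show ?thesis .
  qed
  have "shifted_integral A L t = integral UNIV ?g"
    unfolding shifted_integral_def by (rule integral_restrict_UNIV[symmetric])
  then have "norm (shifted_integral A L t - integral UNIV (\<lambda>v. ?F v * ?k v)) = norm (integral UNIV (\<lambda>v. ?g v - ?F v * ?k v))"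
    by (simp only: integral_diff[OF ig ik])
  also have "\<dots> \<le> integral UNIV (\<lambda>v. Cz / L\<^sup>2 * exp (- 2 * \<bar>v\<bar>))"
    by (rule integral_norm_bound_integral[OF integrable_diff[OF ig ik] _ bound]) (intro integrable_on_mult_right integrable_exp_abs)
  also have "\<dots> = Cz / L\<^sup>2 * exp_abs_mass" unfolding exp_abs_mass_def by (rule integral_mult_right)
  finally show ?thesis .
qed

text \<open>On \<open>Re s = 3/2\<close> the series converges uniformly, so its tail costs the same
  for all \<open>t\<close>; each remaining term is evaluated by \<open>khat_shift\<close>.\<close>

lemma full_line_integral_zpoly:
  assumes A: "A \<ge> 8"
  shows "norm (integral UNIV (\<lambda>v. log_zeta (Complex (3/2) (t + v)) * kern A (Complex v (- 1))) - zpoly A X t)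
     \<le> (\<Sum>k. real (k + X) powr (- 3/2)) * exp_abs_mass"
proof -
  let ?k = "\<lambda>v. kern A (Complex v (- 1))"
  let ?F = "\<lambda>v. log_zeta (Complex (3/2) (t + v))"
  let ?term = "\<lambda>n v. of_real (log_zeta_coeff n) * of_nat n powr (- Complex (3/2) (t + v)) :: complex"
  let ?S = "\<lambda>v. \<Sum>n<X. ?term n v"
  define T where "T = (\<Sum>k. real (k + X) powr (- 3/2))"
  have sm0: "summable (\<lambda>n. real n powr (- 3/2))" by (subst summable_real_powr_iff) auto
  then have sm: "summable (\<lambda>k. real (k + X) powr (- 3/2))" by (subst summable_iff_shift)
  have T0: "T \<ge> 0" unfolding T_def by (rule suminf_nonneg[OF sm]) simp
  have tn: "norm (?term n v) \<le> real n powr (- 3/2)" for n v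
    using norm_log_zeta_term_le[of n "Complex (3/2) (t + v)"] by (simp add: norm_nat_powr)
  have tail: "norm (?F v - ?S v) \<le> T" for v
  proof -
    have s: "summable (\<lambda>n. ?term n v)"
      by (rule summable_comparison_test'[OF sm0, of 0]) (use tn in auto)
    have "?F v - ?S v = (\<Sum>k. ?term (k + X) v)"
      unfolding log_zeta_def using suminf_minus_initial_segment[OF s, of X] by simp
    also have "norm \<dots> \<le> T" unfolding T_def by (rule norm_suminf_le[OF tn sm])
    finally show ?thesis .
  qed
  have tv: "?term n v * ?k v = of_real (log_zeta_coeff n * real n powr (- 3/2)) * cis (- (t * ln (real n))) * (cis (- (ln (real n) * v)) * ?k v)" for n v
    unfolding nat_powr_Complex by (simp add: cis_mult algebra_simps)
  have ci: "continuous_on UNIV (\<lambda>v. cis (- (ln (real n) * v)) * ?k v)" for n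
    by (intro continuous_on_mult continuous_on_kern_line continuous_on_cis continuous_intros)
  have ii: "(\<lambda>v. cis (- (ln (real n) * v)) * ?k v) integrable_on UNIV" for n
    by (rule integrable_by_exp_abs(1)[OF ci, where C = 1]) (use norm_kern_majorant[OF A, of 1] in \<open>simp add: norm_mult\<close>)
  have it: "(\<lambda>v. ?term n v * ?k v) integrable_on UNIV" for n
    unfolding tv by (intro integrable_on_mult_right ii)
  have val: "integral UNIV (\<lambda>v. ?term n v * ?k v) =
     of_real (log_zeta_coeff n * real n powr (- 1/2) * khat A (ln (real n))) * cis (- (t * ln (real n)))" for n
  proof (cases "n = 0")
    case False
    then have n: "real n \<ge> 1" by simp
    have "integral UNIV (\<lambda>v. ?term n v * ?k v) =
      of_real (log_zeta_coeff n * real n powr (- 3/2)) * cis (- (t * ln (real n))) * of_real (exp (ln (real n)) * khat A (ln (real n)))"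
      unfolding tv using n khat_shift[OF A, of "ln (real n)"] by simp
    also have "\<dots> = of_real (log_zeta_coeff n * (real n powr (- 3/2) * exp (ln (real n))) * khat A (ln (real n))) * cis (- (t * ln (real n)))"
      by simp
    also have "real n powr (- 3/2) * exp (ln (real n)) = real n powr (- 1/2)"
    proof -
      have "exp (ln (real n)) = real n powr 1" using n by simp
      then show ?thesis by (simp only: powr_add[symmetric]) simp
    qed
    finally show ?thesis .
  qed simp
  have "integral UNIV (\<lambda>v. ?S v * ?k v) = integral UNIV (\<lambda>v. \<Sum>n<X. ?term n v * ?k v)"
    by (simp add: sum_distrib_right)
  also have "\<dots> = zpoly A X t" unfolding zpoly_def val[symmetric] by (rule integral_sum) (auto intro: it)
  finally have S: "integral UNIV (\<lambda>v. ?S v * ?k v) = zpoly A X t" .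
  have iS: "(\<lambda>v. ?S v * ?k v) integrable_on UNIV"
    unfolding sum_distrib_right by (intro integrable_sum it) auto
  obtain Cz where Cz: "\<And>s. Re s \<ge> 3/2 \<Longrightarrow> norm (log_zeta s) \<le> Cz" "Cz \<ge> 0"
    using norm_log_zeta_le[of "3/2"] by auto
  have iF: "(\<lambda>v. ?F v * ?k v) integrable_on UNIV"
  proof (rule integrable_by_exp_abs(1))
    show "continuous_on UNIV (\<lambda>v. ?F v * ?k v)"
      by (intro continuous_on_mult continuous_on_kern_line continuous_on_log_zeta_line)
    show "norm (?F v * ?k v) \<le> Cz * exp (- 2 * \<bar>v\<bar>)" for v
      unfolding norm_mult using Cz(1)[of "Complex (3/2) (t + v)"] norm_kern_majorant[OF A, of 1 v] Cz(2)
      by (intro mult_mono) auto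
  qed
  have "norm (integral UNIV (\<lambda>v. ?F v * ?k v) - zpoly A X t) = norm (integral UNIV (\<lambda>v. ?F v * ?k v - ?S v * ?k v))"
    unfolding S[symmetric] by (simp only: integral_diff[OF iF iS])
  also have "\<dots> \<le> integral UNIV (\<lambda>v. T * exp (- 2 * \<bar>v\<bar>))"
  proof (rule integral_norm_bound_integral[OF integrable_diff[OF iF iS]])
    show "(\<lambda>v. T * exp (- 2 * \<bar>v\<bar>)) integrable_on UNIV" by (intro integrable_on_mult_right integrable_exp_abs)
    fix v
    have "norm (?F v * ?k v - ?S v * ?k v) = norm (?F v - ?S v) * norm (?k v)"
      by (simp only: left_diff_distrib[symmetric] norm_mult)
    also have "\<dots> \<le> T * exp (- 2 * \<bar>v\<bar>)"
      using tail[of v] norm_kern_majorant[OF A, of 1 v] T0 by (intro mult_mono) auto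
    finally show "norm (?F v * ?k v - ?S v * ?k v) \<le> T * exp (- 2 * \<bar>v\<bar>)" .
  qed
  also have "\<dots> = T * exp_abs_mass" unfolding exp_abs_mass_def by (rule integral_mult_right)
  finally show ?thesis by (simp add: T_def)
qed

text \<open>The thresholds depend on \<open>A\<close> and \<open>\<eta>\<close> but not on
  \<open>t\<close>, so one polynomial serves all heights while \<open>L\<close> grows.\<close>

lemma shifted_integral_approx:
  assumes A: "A \<ge> 8" and \<eta>: "\<eta> > 0"
  obtains X0 L1 where "L1 \<ge> 1" "\<And>X L t. X \<ge> X0 \<Longrightarrow> L \<ge> L1 \<Longrightarrow> norm (shifted_integral A L t - zpoly A X t) \<le> \<eta>"
proof -
  obtain Cz where Cz: "\<And>s. Re s \<ge> 3/2 \<Longrightarrow> norm (log_zeta s) \<le> Cz" "Cz \<ge> 0"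
    using norm_log_zeta_le[of "3/2"] by auto
  have sm0: "summable (\<lambda>n. real n powr (- 3/2))" by (subst summable_real_powr_iff) auto
  have "(\<lambda>X. (\<Sum>k. real (k + X) powr (- 3/2)) * exp_abs_mass) \<longlonglongrightarrow> 0 * exp_abs_mass"
    by (intro tendsto_intros suminf_exist_split2[OF sm0])
  then have "eventually (\<lambda>X. (\<Sum>k. real (k + X) powr (- 3/2)) * exp_abs_mass < \<eta> / 2) sequentially"
    by (rule order_tendstoD) (use \<eta> in simp)
  then obtain X0 where X0: "\<And>X. X \<ge> X0 \<Longrightarrow> (\<Sum>k. real (k + X) powr (- 3/2)) * exp_abs_mass < \<eta> / 2"
    unfolding eventually_sequentially by blast
  have "((\<lambda>L. Cz / L\<^sup>2 * exp_abs_mass) \<longlongrightarrow> 0) at_top" by real_asymp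
  then have "eventually (\<lambda>L. Cz / L\<^sup>2 * exp_abs_mass < \<eta> / 2) at_top"
    by (rule order_tendstoD) (use \<eta> in simp)
  then obtain L0 where L0: "\<And>L. L \<ge> L0 \<Longrightarrow> Cz / L\<^sup>2 * exp_abs_mass < \<eta> / 2"
    unfolding eventually_at_top_linorder by blast
  show ?thesis
  proof (rule that[of "max L0 1" X0])
    fix X L t assume X: "X \<ge> X0" and L: "L \<ge> max L0 1"
    let ?I = "integral UNIV (\<lambda>v. log_zeta (Complex (3/2) (t + v)) * kern A (Complex v (- 1)))"
    have 1: "norm (shifted_integral A L t - ?I) \<le> Cz / L\<^sup>2 * exp_abs_mass"
      using L by (intro shifted_integral_full_line A Cz) auto
    have 2: "norm (?I - zpoly A X t) \<le> (\<Sum>k. real (k + X) powr (- 3/2)) * exp_abs_mass"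
      by (rule full_line_integral_zpoly[OF A])
    have "norm (shifted_integral A L t - zpoly A X t) \<le> norm (shifted_integral A L t - ?I) + norm (?I - zpoly A X t)"
      using norm_triangle_ineq[of "shifted_integral A L t - ?I" "?I - zpoly A X t"] by simp
    then show "norm (shifted_integral A L t - zpoly A X t) \<le> \<eta>"
      using 1 2 L0[of L] X0[OF X] L by linarith
  qed simp
qed

section \<open>Oscillation of Dirichlet polynomials\<close>

text \<open>Bolzano-Weierstrass for one more frequency at each induction step; convergence already
  gained passes to subsequences.\<close>

lemma cis_subsequence:
  fixes l :: "nat \<Rightarrow> real" and a :: "nat \<Rightarrow> real"
  shows "\<exists>r. strict_mono r \<and> (\<forall>n<X. convergent (\<lambda>j. cis (a (r j) * l n)))"
proof (induction X)
  case 0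
  show ?case by (intro exI[of _ id]) (auto simp: strict_mono_def)
next
  case (Suc X)
  then obtain r where r: "strict_mono r" "\<And>n. n < X \<Longrightarrow> convergent (\<lambda>j. cis (a (r j) * l n))" by blast
  have "seq_compact (cball (0::complex) 1)" by (simp add: compact_imp_seq_compact)
  moreover have "\<forall>j. cis (a (r j) * l X) \<in> cball 0 1" by simp
  ultimately obtain c s where s: "strict_mono (s :: nat \<Rightarrow> nat)" "((\<lambda>j. cis (a (r j) * l X)) \<circ> s) \<longlonglongrightarrow> c"
    by (meson seq_compactE)
  have "convergent (\<lambda>j. cis (a ((r \<circ> s) j) * l n))" if "n < Suc X" for n
  proof (cases "n = X")
    case True
    then show ?thesis using s(2) by (auto simp: convergent_def o_def)
  next
    case False
    then have "convergent (\<lambda>j. cis (a (r j) * l n))" using that by (intro r(2)) auto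
    from convergent_subseq_convergent[OF this s(1)] show ?thesis by (simp add: o_def)
  qed
  then show ?case using strict_mono_o[OF r(1) s(1)] by blast
qed

text \<open>Bohr's argument. If there were ever longer intervals without almost periods, their
  midpoints would have a subsequence with convergent phases, and the difference of two such
  midpoints would be an almost period inside one of the intervals.\<close>

lemma almost_periods:
  fixes l :: "nat \<Rightarrow> real"
  assumes e: "e > 0"
  shows "\<exists>R\<ge>0. \<forall>T. \<exists>\<tau>\<in>{T..T + R}. \<forall>n<X. norm (cis (\<tau> * l n) - 1) < e"
proof (rule ccontr)
  assume neg: "\<not> ?thesis"
  have "\<forall>j::nat. \<exists>T. \<forall>\<tau>\<in>{T..T + 2 * real j}. \<not> (\<forall>n<X. norm (cis (\<tau> * l n) - 1) < e)"
  proof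
    fix j :: nat
    have "0 \<le> 2 * real j" by simp
    then show "\<exists>T. \<forall>\<tau>\<in>{T..T + 2 * real j}. \<not> (\<forall>n<X. norm (cis (\<tau> * l n) - 1) < e)"
      using neg by meson
  qed
  then obtain T where T: "\<And>j \<tau>. \<tau> \<in> {T j..T j + 2 * real j} \<Longrightarrow> \<not> (\<forall>n<X. norm (cis (\<tau> * l n) - 1) < e)"
    by metis
  define a where "a j = T j + real j" for j
  obtain r where r: "strict_mono r" "\<And>n. n < X \<Longrightarrow> convergent (\<lambda>j. cis (a (r j) * l n))"
    using cis_subsequence[of X a l] by blast
  have "\<forall>n\<in>{..<X}. \<exists>J. \<forall>i\<ge>J. \<forall>j\<ge>J. dist (cis (a (r i) * l n)) (cis (a (r j) * l n)) < e"
    using convergent_Cauchy[OF r(2)] e unfolding Cauchy_def by blast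
  then obtain J where J: "\<And>n i j. n < X \<Longrightarrow> i \<ge> J n \<Longrightarrow> j \<ge> J n \<Longrightarrow> dist (cis (a (r i) * l n)) (cis (a (r j) * l n)) < e"
    by (metis lessThan_iff)
  define K where "K = Max (insert 0 (J ` {..<X}))"
  have K: "J n \<le> K" if "n < X" for n unfolding K_def using that by (intro Max_ge) auto
  obtain N :: nat where N: "\<bar>a (r K)\<bar> \<le> real N" using real_arch_simple by blast
  define j where "j = max K N"
  have rj: "real N \<le> real (r j)" using strict_mono_imp_increasing[OF r(1), of j] by (simp add: j_def)
  \<comment> \<open>Since \<open>\<bar>a (r K)\<bar> \<le> N \<le> r j\<close>, subtracting the
    midpoint \<open>a (r K)\<close> does not leave the interval of half-length \<open>r j\<close>
    around \<open>a (r j)\<close>.\<close>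
  define \<tau> where "\<tau> = a (r j) - a (r K)"
  have "\<tau> \<in> {T (r j)..T (r j) + 2 * real (r j)}"
    using N rj unfolding \<tau>_def a_def[of "r j"] by (auto simp: abs_le_iff)
  moreover have "norm (cis (\<tau> * l n) - 1) < e" if "n < X" for n
  proof -
    have "cis (a (r j) * l n) - cis (a (r K) * l n) = cis (a (r K) * l n) * (cis (\<tau> * l n) - 1)"
      by (simp add: right_diff_distrib cis_mult \<tau>_def algebra_simps)
    then have "norm (cis (\<tau> * l n) - 1) = dist (cis (a (r j) * l n)) (cis (a (r K) * l n))"
      by (simp add: dist_norm norm_mult)
    then show ?thesis using J[OF that, of j K] K[OF that] by (simp add: j_def)
  qed
  ultimately show False using T by blast
qed

lemma mean_cos:
  fixes c :: real
  assumes "c \<noteq> 0"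
  shows "((\<lambda>R. integral {0..R} (\<lambda>t. cos (c * t)) / R) \<longlongrightarrow> 0) at_top"
proof (rule Lim_null_comparison)
  have "integral {0..R} (\<lambda>t. cos (c * t)) = sin (c * R) / c" if "R > 0" for R
  proof -
    have "((\<lambda>t. cos (c * t)) has_integral (sin (c * R) / c - sin (c * 0) / c)) {0..R}"
    proof (rule fundamental_theorem_of_calculus)
      fix t
      show "((\<lambda>t. sin (c * t) / c) has_vector_derivative cos (c * t)) (at t within {0..R})"
        unfolding has_real_derivative_iff_has_vector_derivative[symmetric]
        using assms by (auto intro!: derivative_eq_intros)
    qed (use that in simp)
    then show ?thesis by (simp add: integral_unique)
  qed
  then have "norm (integral {0..R} (\<lambda>t. cos (c * t)) / R) \<le> 1 / \<bar>c\<bar> / R" if "R > 0" for R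
    using that assms abs_sin_le_one[of "c * R"] by (simp add: abs_divide abs_mult divide_right_mono)
  then show "\<forall>\<^sub>F R in at_top. norm (integral {0..R} (\<lambda>t. cos (c * t)) / R) \<le> 1 / \<bar>c\<bar> / R"
    by (intro eventually_mono[OF eventually_gt_at_top[of 0]])
  show "((\<lambda>R. 1 / \<bar>c\<bar> / R) \<longlongrightarrow> 0) at_top"
    by (intro tendsto_divide_0[OF tendsto_const] filterlim_at_top_imp_at_infinity filterlim_ident)
qed

lemma mean_sin_sin:
  fixes l m :: real
  assumes "l > 0" "m > 0"
  shows "((\<lambda>R. integral {0..R} (\<lambda>t. sin (t * l) * sin (t * m)) / R) \<longlongrightarrow> (if l = m then 1/2 else 0)) at_top"
proof -
  have eq: "integral {0..R} (\<lambda>t. sin (t * l) * sin (t * m)) / R =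
     (integral {0..R} (\<lambda>t. cos ((l - m) * t)) / R - integral {0..R} (\<lambda>t. cos ((l + m) * t)) / R) / 2" for R
  proof -
    have "integral {0..R} (\<lambda>t. sin (t * l) * sin (t * m)) = integral {0..R} (\<lambda>t. (cos ((l - m) * t) - cos ((l + m) * t)) / 2)"
      by (rule integral_cong) (simp add: sin_times_sin algebra_simps)
    also have "\<dots> = integral {0..R} (\<lambda>t. cos ((l - m) * t) - cos ((l + m) * t)) / 2"
      by simp
    also have "integral {0..R} (\<lambda>t. cos ((l - m) * t) - cos ((l + m) * t)) =
       integral {0..R} (\<lambda>t. cos ((l - m) * t)) - integral {0..R} (\<lambda>t. cos ((l + m) * t))"
      by (intro integral_diff integrable_continuous_real continuous_intros)
    finally show ?thesis by (simp add: diff_divide_distrib)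
  qed
  have 2: "((\<lambda>R. integral {0..R} (\<lambda>t. cos ((l + m) * t)) / R) \<longlongrightarrow> 0) at_top"
    using assms by (intro mean_cos) auto
  have 1: "((\<lambda>R. integral {0..R} (\<lambda>t. cos ((l - m) * t)) / R) \<longlongrightarrow> (if l = m then 1 else 0)) at_top"
  proof (cases "l = m")
    case True
    have "eventually (\<lambda>R. 1 = integral {0..R} (\<lambda>t. cos ((l - m) * t)) / R) at_top"
      using eventually_gt_at_top[of 0] by eventually_elim (use True in simp)
    then show ?thesis using True by (intro Lim_transform_eventually[OF tendsto_const]) simp_all
  qed (use mean_cos[of "l - m"] in simp)
  have "((\<lambda>R. (integral {0..R} (\<lambda>t. cos ((l - m) * t)) / R - integral {0..R} (\<lambda>t. cos ((l + m) * t)) / R) / 2) \<longlongrightarrow>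
     ((if l = m then 1 else 0) - 0) / 2) at_top"
    by (intro tendsto_intros 1 2) simp
  then show ?thesis unfolding eq by (cases "l = m") simp_all
qed

definition log_sine_sum :: "(nat \<Rightarrow> real) \<Rightarrow> nat \<Rightarrow> real \<Rightarrow> real" where
  "log_sine_sum b X t = (\<Sum>n<X. b n * sin (t * ln (real n)))"

text \<open>Distinct \<open>n \<ge> 2\<close> have distinct positive frequencies
  \<open>ln n\<close>, so the mixed products average to 0 and the squares to \<open>1/2\<close>; a
  pointwise bound \<open>W\<close> also bounds the mean. At 0 and 1 the frequency is 0, which the
  condition on \<open>b\<close> excludes.\<close>

lemma log_sine_sum_mean_square:
  assumes b: "\<And>n. n < 2 \<Longrightarrow> b n = 0" and W: "\<And>t. \<bar>log_sine_sum b X t\<bar> \<le> W"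
  shows "(\<Sum>n<X. (b n)\<^sup>2) / 2 \<le> W\<^sup>2"
proof -
  let ?f = "log_sine_sum b X"
  let ?s = "\<lambda>m n t. sin (t * ln (real m)) * sin (t * ln (real n))"
  have sq: "(?f t)\<^sup>2 = (\<Sum>m<X. \<Sum>n<X. b m * b n * ?s m n t)" for t
    unfolding log_sine_sum_def power2_eq_square sum_product by (intro sum.cong refl) (simp add: mult_ac)
  have int: "integral {0..R} (\<lambda>t. (?f t)\<^sup>2) / R = (\<Sum>m<X. \<Sum>n<X. b m * b n * (integral {0..R} (?s m n) / R))" for R
  proof -
    have "integral {0..R} (\<lambda>t. (?f t)\<^sup>2) = (\<Sum>m<X. integral {0..R} (\<lambda>t. \<Sum>n<X. b m * b n * ?s m n t))"
      unfolding sq by (rule integral_sum) (auto intro!: integrable_continuous_real continuous_intros)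
    also have "\<dots> = (\<Sum>m<X. \<Sum>n<X. integral {0..R} (\<lambda>t. b m * b n * ?s m n t))"
      by (intro sum.cong refl integral_sum) (auto intro!: integrable_continuous_real continuous_intros)
    finally show ?thesis by (simp add: sum_divide_distrib)
  qed
  have trm: "((\<lambda>R. b m * b n * (integral {0..R} (?s m n) / R)) \<longlongrightarrow> (if m = n then (b n)\<^sup>2 / 2 else 0)) at_top" for m n
  proof (cases "m < 2 \<or> n < 2")
    case True
    then have "b m * b n = 0" using b by auto
    moreover from this have "m = n \<Longrightarrow> (b n)\<^sup>2 = 0" by (simp add: power2_eq_square)
    ultimately show ?thesis by auto
  next
    case False
    then have "ln (real m) > 0" "ln (real n) > 0" by auto
    moreover have "ln (real m) = ln (real n) \<longleftrightarrow> m = n" using False by simp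
    ultimately have "((\<lambda>R. integral {0..R} (?s m n) / R) \<longlongrightarrow> (if m = n then 1/2 else 0)) at_top"
      using mean_sin_sin[of "ln (real m)" "ln (real n)"] by simp
    from tendsto_mult[OF tendsto_const this, of "b m * b n"] show ?thesis
      by (cases "m = n") (simp_all add: power2_eq_square)
  qed
  have "((\<lambda>R. integral {0..R} (\<lambda>t. (?f t)\<^sup>2) / R) \<longlongrightarrow> (\<Sum>m<X. \<Sum>n<X. (if m = n then (b n)\<^sup>2 / 2 else 0))) at_top"
    unfolding int by (intro tendsto_sum trm)
  also have "(\<Sum>m<X. \<Sum>n<X. (if m = n then (b n)\<^sup>2 / 2 else 0)) = (\<Sum>n<X. (b n)\<^sup>2) / 2"
    by (simp add: sum_divide_distrib)
  finally have lim: "((\<lambda>R. integral {0..R} (\<lambda>t. (?f t)\<^sup>2) / R) \<longlongrightarrow> (\<Sum>n<X. (b n)\<^sup>2) / 2) at_top" .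
  show ?thesis
  proof (rule tendsto_upperbound[OF lim])
    show "\<forall>\<^sub>F R in at_top. integral {0..R} (\<lambda>t. (?f t)\<^sup>2) / R \<le> W\<^sup>2"
      using eventually_gt_at_top[of 0]
    proof eventually_elim
      case (elim R)
      have "integral {0..R} (\<lambda>t. (?f t)\<^sup>2) \<le> integral {0..R} (\<lambda>t. W\<^sup>2)"
      proof (rule integral_le)
        show "(\<lambda>t. (?f t)\<^sup>2) integrable_on {0..R}"
          unfolding log_sine_sum_def by (intro integrable_continuous_real continuous_intros)
        show "(?f t)\<^sup>2 \<le> W\<^sup>2" for t using power_mono[OF W[of t], of 2] by simp
      qed auto
      then show ?case using elim by (simp add: divide_le_eq mult.commute)
    qed
  qed simp
qed

lemma log_sine_sum_minus: "log_sine_sum b X (- t) = - log_sine_sum b X t"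
  by (simp add: log_sine_sum_def sum_negf)

text \<open>Adding a common almost period of the finitely many frequencies to \<open>t0\<close>
  changes each summand by at most \<open>\<bar>b n\<bar> * (e / B)\<close>.\<close>

lemma log_sine_sum_recurrence:
  assumes "e > 0"
  shows "\<exists>R\<ge>0. \<forall>T. \<exists>t\<in>{T..T + R}. \<bar>log_sine_sum b X t - log_sine_sum b X t0\<bar> \<le> e"
proof -
  \<comment> \<open>The added 1 keeps the divisor positive when all coefficients vanish.\<close>
  define B where "B = (\<Sum>n<X. \<bar>b n\<bar>) + 1"
  have B: "B > 0" unfolding B_def by (intro add_nonneg_pos sum_nonneg) auto
  obtain R where R: "R \<ge> 0" "\<And>T. \<exists>\<tau>\<in>{T..T + R}. \<forall>n<X. norm (cis (\<tau> * ln (real n)) - 1) < e / B"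
    using almost_periods[of "e / B" X "\<lambda>n. ln (real n)"] assms B by auto
  show ?thesis
  proof (intro exI[of _ R] conjI allI R(1))
    fix T
    obtain \<tau> where \<tau>: "\<tau> \<in> {T - t0..T - t0 + R}" "\<And>n. n < X \<Longrightarrow> norm (cis (\<tau> * ln (real n)) - 1) < e / B"
      using R(2)[of "T - t0"] by blast
    have "\<bar>log_sine_sum b X (t0 + \<tau>) - log_sine_sum b X t0\<bar> \<le> (\<Sum>n<X. \<bar>b n\<bar> * (e / B))"
    proof -
      have "log_sine_sum b X (t0 + \<tau>) - log_sine_sum b X t0 = (\<Sum>n<X. b n * Im (cis (t0 * ln (real n)) * (cis (\<tau> * ln (real n)) - 1)))"
        unfolding log_sine_sum_def sum_subtractf[symmetric]
        by (intro sum.cong refl) (simp add: distrib_right sin_add algebra_simps)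
      also have "\<bar>\<dots>\<bar> \<le> (\<Sum>n<X. \<bar>b n * Im (cis (t0 * ln (real n)) * (cis (\<tau> * ln (real n)) - 1))\<bar>)"
        by (rule sum_abs)
      also have "\<dots> \<le> (\<Sum>n<X. \<bar>b n\<bar> * (e / B))"
      proof (rule sum_mono)
        fix n assume "n \<in> {..<X}"
        then have "norm (cis (t0 * ln (real n)) * (cis (\<tau> * ln (real n)) - 1)) \<le> e / B"
          using \<tau>(2)[of n] by (simp add: norm_mult)
        then have "\<bar>Im (cis (t0 * ln (real n)) * (cis (\<tau> * ln (real n)) - 1))\<bar> \<le> e / B"
          using abs_Im_le_cmod order_trans by blast
        then show "\<bar>b n * Im (cis (t0 * ln (real n)) * (cis (\<tau> * ln (real n)) - 1))\<bar> \<le> \<bar>b n\<bar> * (e / B)"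
          unfolding abs_mult by (rule mult_left_mono) simp
      qed
      finally show ?thesis .
    qed
    also have "\<dots> = (B - 1) * (e / B)" by (simp only: B_def sum_distrib_right[symmetric] add_diff_cancel)
    also have "\<dots> \<le> e" using assms B by (simp add: field_simps)
    finally show "\<exists>t\<in>{T..T + R}. \<bar>log_sine_sum b X t - log_sine_sum b X t0\<bar> \<le> e"
      using \<tau>(1) by (intro bexI[of _ "t0 + \<tau>"]) auto
  qed
qed

text \<open>The mean square of \<open>Im (zpoly A X t)\<close> is at least a constant times the sum of \<open>1 / p\<close> over the
  primes with \<open>(ln p)\<^sup>2 \<le> A\<close>, relative to \<open>(khat A 0)\<^sup>2\<close>, and that sum diverges.\<close>

lemma zpoly_oscillation:
  assumes W: "W > 0"
  obtains A Y where "A \<ge> 8" "\<And>X. X \<ge> Y \<Longrightarrow> \<exists>R\<ge>0. \<forall>T. (\<exists>t\<in>{T..T + R}. Im (zpoly A X t) \<ge> W * khat A 0) \<and>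
      (\<exists>t\<in>{T..T + R}. Im (zpoly A X t) \<le> - (W * khat A 0))"
proof -
  \<comment> \<open>With this value \<open>(khat A 0)\<^sup>2 / 4 * B\<close> equals
    \<open>2 * ((W + 1) * khat A 0)\<^sup>2\<close>, the most that the sum of squares could be if no
    value exceeded \<open>(W + 1) * khat A 0\<close>. The extra unit is spent on the recurrence
    below.\<close>
  define B where "B = 8 * (W + 1)\<^sup>2"
  obtain Y where Y: "(\<Sum>p | prime p \<and> p < Y. 1 / real p) > B" using prime_reciprocals_unbounded by blast
  \<comment> \<open>Large enough that \<open>(ln p)\<^sup>2 \<le> A\<close> for all primes below
    \<open>Y\<close>, so that \<open>khat A (ln p)\<close> is at least
    \<open>khat A 0 / 2\<close>.\<close>
  define A where "A = max 8 ((ln (real Y))\<^sup>2)"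
  have A: "A \<ge> 8" by (simp add: A_def)
  have k0: "khat A 0 > 0" by (rule khat_lower(2)[OF A])
  show ?thesis
  proof (rule that[OF A])
    fix X assume X: "X \<ge> Y"
    define b where "b n = log_zeta_coeff n * real n powr (- 1/2) * khat A (ln (real n))" for n
    have imz: "Im (zpoly A X t) = - log_sine_sum b X t" for t
      by (simp add: zpoly_def log_sine_sum_def b_def Im_sum sum_negf)
    have b01: "b n = 0" if "n < 2" for n
    proof -
      have "n = 0 \<or> n = Suc 0" using that by auto
      then show ?thesis by (auto simp: b_def)
    qed
    have "\<exists>t. \<bar>log_sine_sum b X t\<bar> > (W + 1) * khat A 0"
    proof (rule ccontr)
      assume "\<not> ?thesis"
      then have "\<bar>log_sine_sum b X t\<bar> \<le> (W + 1) * khat A 0" for t by (simp add: not_less)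
      from log_sine_sum_mean_square[of b X, OF b01 this]
      have up: "(\<Sum>n<X. (b n)\<^sup>2) / 2 \<le> ((W + 1) * khat A 0)\<^sup>2" .
      have "(khat A 0)\<^sup>2 / 4 * (\<Sum>p | prime p \<and> p < Y. 1 / real p) = (\<Sum>p | prime p \<and> p < Y. (khat A 0)\<^sup>2 / 4 * (1 / real p))"
        by (rule sum_distrib_left)
      also have "\<dots> \<le> (\<Sum>p | prime p \<and> p < Y. (b p)\<^sup>2)"
      proof (rule sum_mono)
        fix p assume "p \<in> {p. prime p \<and> p < Y}"
        then have p: "prime p" "p < Y" "p > 0" by (auto simp: prime_gt_0_nat)
        have lp: "0 \<le> ln (real p)" "ln (real p) \<le> ln (real Y)" using p by auto
        have "(ln (real p))\<^sup>2 \<le> A" using power_mono[OF lp(2,1), of 2] by (simp add: A_def)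
        then have "(ln (real p))\<^sup>2 / (2 * A) \<le> 1 / 2" using A by (simp add: divide_le_eq)
        then have "1 / 2 * khat A 0 \<le> (1 - (ln (real p))\<^sup>2 / (2 * A)) * khat A 0"
          using k0 by (intro mult_right_mono) auto
        also have "\<dots> \<le> khat A (ln (real p))" by (rule khat_lower(1)[OF A])
        finally have "(1 / 2 * khat A 0)\<^sup>2 \<le> (khat A (ln (real p)))\<^sup>2" using k0 by (intro power_mono) auto
        then have "(1 / 2 * khat A 0)\<^sup>2 * (1 / real p) \<le> (khat A (ln (real p)))\<^sup>2 * (1 / real p)"
          by (rule mult_right_mono) simp
        moreover have "(b p)\<^sup>2 = (khat A (ln (real p)))\<^sup>2 * (1 / real p)"
        proof -
          have "(real p powr (- 1/2))\<^sup>2 = real p powr (- 1)"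
            by (simp add: power2_eq_square flip: powr_add)
          also have "\<dots> = 1 / real p" using p by (simp add: powr_minus field_simps)
          finally show ?thesis using p by (simp add: b_def power_mult_distrib)
        qed
        ultimately show "(khat A 0)\<^sup>2 / 4 * (1 / real p) \<le> (b p)\<^sup>2" by (simp add: power_mult_distrib power_divide)
      qed
      also have "\<dots> \<le> (\<Sum>n<X. (b n)\<^sup>2)" using X by (intro sum_mono2) auto
      finally have "(khat A 0)\<^sup>2 / 4 * (\<Sum>p | prime p \<and> p < Y. 1 / real p) \<le> 2 * ((W + 1) * khat A 0)\<^sup>2"
        using up by simp
      moreover have "(khat A 0)\<^sup>2 / 4 * B < (khat A 0)\<^sup>2 / 4 * (\<Sum>p | prime p \<and> p < Y. 1 / real p)"
        using Y k0 by (intro mult_strict_left_mono) auto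
      moreover have "(khat A 0)\<^sup>2 / 4 * B = 2 * ((W + 1) * khat A 0)\<^sup>2"
        by (simp add: B_def power_mult_distrib)
      ultimately show False by linarith
    qed
    then obtain t1 where t1: "\<bar>log_sine_sum b X t1\<bar> > (W + 1) * khat A 0" by blast
    \<comment> \<open>The sine sum is odd, so a large absolute value yields large values of both
      signs.\<close>
    define t0 where "t0 = (if log_sine_sum b X t1 > 0 then t1 else - t1)"
    have t0: "log_sine_sum b X t0 > (W + 1) * khat A 0"
      using t1 by (auto simp: t0_def log_sine_sum_minus abs_if split: if_splits)
    obtain R1 where R1: "R1 \<ge> 0" "\<And>T. \<exists>t\<in>{T..T + R1}. \<bar>log_sine_sum b X t - log_sine_sum b X t0\<bar> \<le> khat A 0"
      using log_sine_sum_recurrence[OF k0, of b X t0] by blast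
    obtain R2 where R2: "R2 \<ge> 0" "\<And>T. \<exists>t\<in>{T..T + R2}. \<bar>log_sine_sum b X t - log_sine_sum b X (- t0)\<bar> \<le> khat A 0"
      using log_sine_sum_recurrence[OF k0, of b X "- t0"] by blast
    show "\<exists>R\<ge>0. \<forall>T. (\<exists>t\<in>{T..T + R}. Im (zpoly A X t) \<ge> W * khat A 0) \<and>
      (\<exists>t\<in>{T..T + R}. Im (zpoly A X t) \<le> - (W * khat A 0))"
    proof (intro exI[of _ "max R1 R2"] conjI allI)
      show "max R1 R2 \<ge> 0" using R1 by simp
      fix T
      have d: "(W + 1) * khat A 0 = W * khat A 0 + khat A 0" by (simp add: distrib_right)
      obtain t where t: "t \<in> {T..T + R1}" "\<bar>log_sine_sum b X t - log_sine_sum b X t0\<bar> \<le> khat A 0" using R1(2) by blast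
      then have "Im (zpoly A X t) \<le> - (W * khat A 0)" using t0 d unfolding imz by linarith
      then show "\<exists>t\<in>{T..T + max R1 R2}. Im (zpoly A X t) \<le> - (W * khat A 0)" using t by (intro bexI[of _ t]) auto
      obtain s where s: "s \<in> {T..T + R2}" "\<bar>log_sine_sum b X s - log_sine_sum b X (- t0)\<bar> \<le> khat A 0" using R2(2) by blast
      then have "Im (zpoly A X s) \<ge> W * khat A 0" using t0 d unfolding imz log_sine_sum_minus by linarith
      then show "\<exists>t\<in>{T..T + max R1 R2}. Im (zpoly A X t) \<ge> W * khat A 0" using s by (intro bexI[of _ s]) auto
    qed
  qed
qed

section \<open>Oscillation of the argument in short windows\<close>

lemma kcut_mass_le:
  assumes A: "A \<ge> 8" and L: "L \<ge> 1"
  shows "integral {- L..L} (kcut A L) \<le> khat A 0"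
proof -
  let ?k = "\<lambda>v. exp (- (A * cosh v))"
  obtain N where N: "L \<le> real N" using real_arch_simple by blast
  have ci: "?k integrable_on {a..b}" for a b by (intro integrable_continuous_real continuous_intros)
  have "integral {- L..L} (kcut A L) \<le> integral {- L..L} ?k"
  proof (rule integral_le)
    show "kcut A L integrable_on {- L..L}"
      unfolding kcut_def using L by (intro integrable_continuous_real continuous_intros) auto
    show "kcut A L v \<le> ?k v" for v
      unfolding kcut_def using mult_right_mono[of "1 - v\<^sup>2 / L\<^sup>2" 1 "?k v"] by simp
  qed (rule ci)
  also have "\<dots> \<le> khat A 0"
  proof (rule tendsto_lowerbound)
    show "(\<lambda>n. integral {- real n..real n} ?k) \<longlonglongrightarrow> khat A 0" using khat_tendsto[OF A, of 0] by simp
    show "\<forall>\<^sub>F n in sequentially. integral {- L..L} ?k \<le> integral {- real n..real n} ?k"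
      using eventually_ge_at_top[of N]
    proof eventually_elim
      case (elim n)
      then show ?case using N by (intro integral_subset_le ci) auto
    qed
  qed simp
  finally show ?thesis .
qed

lemma kcut_nonneg: "\<bar>v\<bar> \<le> L \<Longrightarrow> L \<ge> 1 \<Longrightarrow> kcut A L v \<ge> 0"
proof -
  assume "\<bar>v\<bar> \<le> L" "L \<ge> 1"
  then have "v\<^sup>2 \<le> L\<^sup>2" using power_mono[of "\<bar>v\<bar>" L 2] by simp
  then show "kcut A L v \<ge> 0" using \<open>L \<ge> 1\<close> unfolding kcut_def by (intro mult_nonneg_nonneg) (auto simp: divide_le_eq)
qed

text \<open>The weight is nonnegative with mass at most \<open>khat A 0\<close>. Used in
  contrapositive form: an average above \<open>V * khat A 0\<close> forces a value above
  \<open>V\<close> in the window.\<close>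

lemma kcut_average_le:
  assumes A: "A \<ge> 8" and L: "L \<ge> 1" and V: "V \<ge> 0"
    and i: "(\<lambda>u. kcut A L (u - t) * g u) integrable_on {t - L..t + L}"
    and g: "\<And>u. u \<in> {t - L..t + L} \<Longrightarrow> g u \<le> V"
  shows "integral {t - L..t + L} (\<lambda>u. kcut A L (u - t) * g u) \<le> V * khat A 0"
proof -
  have "integral {t - L..t + L} (\<lambda>u. kcut A L (u - t) * g u) \<le> integral {t - L..t + L} (\<lambda>u. kcut A L (u - t) * V)"
  proof (rule integral_le[OF i])
    show "(\<lambda>u. kcut A L (u - t) * V) integrable_on {t - L..t + L}"
      unfolding kcut_def using L by (intro integrable_continuous_real continuous_intros) auto
    show "kcut A L (u - t) * g u \<le> kcut A L (u - t) * V" if "u \<in> {t - L..t + L}" for u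
      using g[OF that] that L by (intro mult_left_mono kcut_nonneg) auto
  qed
  also have "\<dots> = V * integral {t - L..t + L} (\<lambda>u. kcut A L (u - t))" by simp
  also have "integral {t - L..t + L} (\<lambda>u. kcut A L (u - t)) = integral {- L..L} (kcut A L)"
    using integral_shift_real_ivl[of "t - L" t "t + L" "\<lambda>u. kcut A L (u - t)"] by simp
  also have "V * \<dots> \<le> V * khat A 0" by (intro mult_left_mono kcut_mass_le A L V)
  finally show ?thesis .
qed

text \<open>For \<open>L = ln (ln (ln T))\<close> and \<open>A \<ge> 8\<close> one has
  \<open>A * cosh L / 2 \<ge> 2 * exp L = 2 * ln (ln T)\<close>, so the kernel contributes at most
  \<open>1 / (ln T)\<^sup>2\<close> against the single logarithm that comes from log zeta.\<close>

lemma smoothing_error_small: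
  assumes A: "A \<ge> (8::real)" and C: "C > 0" and k: "k > 0"
  shows "eventually (\<lambda>T. \<forall>t\<in>{T..T + R}.
     C * ln (t + ln (ln (ln T))) / ln (ln (ln T)) * exp (- (A * cosh (ln (ln (ln T))) / 2)) \<le> k) at_top"
proof -
  have "((\<lambda>T. C * ln (T + R + ln (ln (ln T))) * exp (- 2 * ln (ln T))) \<longlongrightarrow> 0) at_top"
    using C by real_asymp
  then have "eventually (\<lambda>T. C * ln (T + R + ln (ln (ln T))) * exp (- 2 * ln (ln T)) < k) at_top"
    by (rule order_tendstoD) (rule k)
  moreover have "eventually (\<lambda>T::real. ln (ln (ln T)) \<ge> 1) at_top" by real_asymp
  moreover have "eventually (\<lambda>T::real. ln (ln T) > 0) at_top" by real_asymp
  ultimately show ?thesis using eventually_ge_at_top[of 1]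
  proof eventually_elim
    case (elim T)
    define L where "L = ln (ln (ln T))"
    have L: "L \<ge> 1" and eL: "exp L = ln (ln T)" using elim by (auto simp: L_def)
    have "cosh L \<ge> exp L / 2" by (simp add: cosh_def)
    then have "A * cosh L \<ge> 8 * (exp L / 2)" using A by (intro mult_mono) auto
    then have ex: "exp (- (A * cosh L / 2)) \<le> exp (- 2 * ln (ln T))" using eL by simp
    show ?case unfolding L_def[symmetric]
    proof
      fix t assume t: "t \<in> {T..T + R}"
      have "ln (t + L) \<le> ln (T + R + L)" "ln (t + L) \<ge> 0" using t L elim by (auto simp: ln_ge_zero_iff)
      moreover have "C * ln (t + L) / L \<le> C * ln (t + L) / 1"
        using L C \<open>ln (t + L) \<ge> 0\<close> by (intro divide_left_mono mult_nonneg_nonneg) auto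
      ultimately have "C * ln (t + L) / L \<le> C * ln (T + R + L)"
        using C mult_left_mono[of "ln (t + L)" "ln (T + R + L)" C] by linarith
      moreover have "0 \<le> C * ln (T + R + L)" using C \<open>ln (t + L) \<le> _\<close> \<open>ln (t + L) \<ge> 0\<close> by simp
      ultimately have "C * ln (t + L) / L * exp (- (A * cosh L / 2)) \<le> C * ln (T + R + L) * exp (- 2 * ln (ln T))"
        using ex by (intro mult_mono) auto
      then show "C * ln (t + L) / L * exp (- (A * cosh L / 2)) \<le> k" using elim by (simp add: L_def)
    qed
  qed
qed

context RH
begin

definition arg_fluct :: "real \<Rightarrow> real" where
  "arg_fluct u = pi * real (counting u) - theta u + boundary_const"

lemma arg_fluct_oscillation:
  assumes V: "V \<ge> 0"
  obtains R T0 where "R \<ge> 0"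
    "\<And>T. T \<ge> T0 \<Longrightarrow> \<exists>u. T - ln (ln (ln T)) \<le> u \<and> u \<le> T + R + ln (ln (ln T)) \<and> arg_fluct u \<ge> V"
    "\<And>T. T \<ge> T0 \<Longrightarrow> \<exists>u. T - ln (ln (ln T)) \<le> u \<and> u \<le> T + R + ln (ln (ln T)) \<and> arg_fluct u \<le> - V"
proof -
  \<comment> \<open>Of the two extra units of \<open>khat A 0\<close>, one covers the two errors of
    half a unit that add up in \<open>near\<close>, the other makes the contradictions
    strict.\<close>
  have "V + 2 > 0" using V by simp
  then obtain A Y where A: "A \<ge> 8" and osc: "\<And>X. X \<ge> Y \<Longrightarrow> \<exists>R\<ge>0. \<forall>T.
      (\<exists>t\<in>{T..T + R}. Im (zpoly A X t) \<ge> (V + 2) * khat A 0) \<and>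
      (\<exists>t\<in>{T..T + R}. Im (zpoly A X t) \<le> - ((V + 2) * khat A 0))"
    by (rule zpoly_oscillation) (rule that)
  have k0: "khat A 0 > 0" by (rule khat_lower(2)[OF A])
  then have k2: "khat A 0 / 2 > 0" by simp
  obtain X0 L1 where L1: "L1 \<ge> 1" and app: "\<And>X L t. X \<ge> X0 \<Longrightarrow> L \<ge> L1 \<Longrightarrow> norm (shifted_integral A L t - zpoly A X t) \<le> khat A 0 / 2"
    by (rule shifted_integral_approx[OF A k2]) (rule that)
  define X where "X = max X0 Y"
  obtain R where R: "R \<ge> 0" and up: "\<And>T. \<exists>t\<in>{T..T + R}. Im (zpoly A X t) \<ge> (V + 2) * khat A 0"
    and lo: "\<And>T. \<exists>t\<in>{T..T + R}. Im (zpoly A X t) \<le> - ((V + 2) * khat A 0)"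
    using osc[of X] by (auto simp: X_def)
  obtain C where C: "C > 0" and sm: "\<And>A L t. A \<ge> 0 \<Longrightarrow> L \<ge> 1 \<Longrightarrow> t - L \<ge> 3 \<Longrightarrow>
    \<bar>integral {t - L..t + L} (\<lambda>u. kcut A L (u - t) * (pi * real (counting u) - theta u + boundary_const))
      - Im (shifted_integral A L t)\<bar> \<le> C * ln (t + L) / L * exp (- (A * cosh L / 2))"
    by (rule smoothed_identity) (rule that)
  have "filterlim (\<lambda>T::real. ln (ln (ln T))) at_top at_top" "filterlim (\<lambda>T::real. T - ln (ln (ln T))) at_top at_top"
    by real_asymp+
  then have "eventually (\<lambda>T. ln (ln (ln T)) \<ge> L1) at_top" "eventually (\<lambda>T::real. T - ln (ln (ln T)) \<ge> 3) at_top"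
    by (auto simp: filterlim_at_top)
  then have "eventually (\<lambda>T. ln (ln (ln T)) \<ge> L1 \<and> T - ln (ln (ln T)) \<ge> 3 \<and> (\<forall>t\<in>{T..T + R}.
     C * ln (t + ln (ln (ln T))) / ln (ln (ln T)) * exp (- (A * cosh (ln (ln (ln T))) / 2)) \<le> khat A 0 / 2)) at_top"
    using smoothing_error_small[OF A C k2, of R] by eventually_elim auto
  then obtain T0 where T0: "\<And>T. T \<ge> T0 \<Longrightarrow> ln (ln (ln T)) \<ge> L1 \<and> T - ln (ln (ln T)) \<ge> 3 \<and> (\<forall>t\<in>{T..T + R}.
     C * ln (t + ln (ln (ln T))) / ln (ln (ln T)) * exp (- (A * cosh (ln (ln (ln T))) / 2)) \<le> khat A 0 / 2)"
    unfolding eventually_at_top_linorder by blast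
  have ii: "(\<lambda>u. kcut A L (u - t) * arg_fluct u) integrable_on {t - L..t + L}" if "L \<ge> 1" "t - L \<ge> 3" for L t
  proof -
    have "continuous_on {t - L..t + L} (\<lambda>u. kcut A L (u - t))"
      unfolding kcut_def using that by (intro continuous_intros) auto
    from conjunct1[OF boundary_integral[OF _ this]] that show ?thesis unfolding arg_fluct_def by simp
  qed
  have near: "\<bar>integral {t - L..t + L} (\<lambda>u. kcut A L (u - t) * arg_fluct u) - Im (zpoly A X t)\<bar> \<le> khat A 0"
    if "T \<ge> T0" "t \<in> {T..T + R}" "L = ln (ln (ln T))" for T t L
  proof -
    have L: "L \<ge> L1" "t - L \<ge> 3" and e: "C * ln (t + L) / L * exp (- (A * cosh L / 2)) \<le> khat A 0 / 2"
      using T0[OF that(1)] that(2) unfolding that(3)[symmetric] by auto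
    have "\<bar>Im (shifted_integral A L t) - Im (zpoly A X t)\<bar> \<le> khat A 0 / 2"
      using abs_Im_le_cmod[of "shifted_integral A L t - zpoly A X t"] app[of X L t] L by (simp add: X_def)
    then show ?thesis using sm[of A L t] L L1 A e unfolding arg_fluct_def by linarith
  qed
  show ?thesis
  proof (rule that[OF R])
    fix T assume T: "T \<ge> T0"
    define L where "L = ln (ln (ln T))"
    have L: "L \<ge> 1" "T - L \<ge> 3" using T0[OF T] L1 by (auto simp: L_def)
    have d: "(V + 2) * khat A 0 = V * khat A 0 + 2 * khat A 0" by (simp add: distrib_right)
    show "\<exists>u. T - ln (ln (ln T)) \<le> u \<and> u \<le> T + R + ln (ln (ln T)) \<and> arg_fluct u \<ge> V"
      unfolding L_def[symmetric]
    proof (rule ccontr)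
      assume neg: "\<not> (\<exists>u. T - L \<le> u \<and> u \<le> T + R + L \<and> arg_fluct u \<ge> V)"
      obtain t where t: "t \<in> {T..T + R}" "Im (zpoly A X t) \<ge> (V + 2) * khat A 0" using up by blast
      have "integral {t - L..t + L} (\<lambda>u. kcut A L (u - t) * arg_fluct u) \<le> V * khat A 0"
      proof (rule kcut_average_le[OF A L(1) V ii[OF L(1)]])
        show "t - L \<ge> 3" using t L by auto
        show "arg_fluct u \<le> V" if "u \<in> {t - L..t + L}" for u
        proof -
          have "T - L \<le> u" "u \<le> T + R + L" using that t by auto
          then show ?thesis using neg by force
        qed
      qed
      then show False using near[OF T t(1) L_def] t(2) d k0 by linarith
    qed
    show "\<exists>u. T - ln (ln (ln T)) \<le> u \<and> u \<le> T + R + ln (ln (ln T)) \<and> arg_fluct u \<le> - V"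
      unfolding L_def[symmetric]
    proof (rule ccontr)
      assume neg: "\<not> (\<exists>u. T - L \<le> u \<and> u \<le> T + R + L \<and> arg_fluct u \<le> - V)"
      obtain t where t: "t \<in> {T..T + R}" "Im (zpoly A X t) \<le> - ((V + 2) * khat A 0)" using lo by blast
      have t3: "t - L \<ge> 3" using t L by auto
      have "integral {t - L..t + L} (\<lambda>u. kcut A L (u - t) * - arg_fluct u) \<le> V * khat A 0"
      proof (rule kcut_average_le[OF A L(1) V])
        show "(\<lambda>u. kcut A L (u - t) * - arg_fluct u) integrable_on {t - L..t + L}"
          using integrable_neg[OF ii[OF L(1) t3]] by simp
        show "- arg_fluct u \<le> V" if "u \<in> {t - L..t + L}" for u
        proof -
          have "T - L \<le> u" "u \<le> T + R + L" using that t by auto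
          then show ?thesis using neg by force
        qed
      qed
      then show False using near[OF T t(1) L_def] t(2) d k0 by simp
    qed
  qed
qed

end

section \<open>Displacement of the ordinates against the Gram points\<close>

lemma dtheta_eventually_nonneg:
  obtains b where "dtheta b \<ge> 0" "b \<ge> 1"
proof -
  have "eventually (\<lambda>t. dtheta t \<ge> 0) at_top" using dtheta_at_top by (simp add: filterlim_at_top)
  then have "eventually (\<lambda>t. dtheta t \<ge> 0 \<and> t \<ge> 1) at_top" using eventually_ge_at_top[of 1] by eventually_elim auto
  then show ?thesis using that eventually_happens[of _ "at_top::real filter"] by auto
qed

text \<open>At the first index where \<open>f\<close> is at most \<open>c\<close> the value cannot
  be below \<open>c\<close>, because steps down have size at most 1; steps up are arbitrary.\<close>

lemma discrete_intermediate_value: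
  fixes f :: "nat \<Rightarrow> int"
  assumes "a \<le> b" "f a \<ge> c" "f b \<le> c" and step: "\<And>k. a \<le> k \<Longrightarrow> k < b \<Longrightarrow> f (Suc k) \<ge> f k - 1"
  shows "\<exists>k\<in>{a..b}. f k = c"
proof -
  define k where "k = (LEAST k. a \<le> k \<and> f k \<le> c)"
  have k: "a \<le> k" "f k \<le> c" unfolding k_def using LeastI[of "\<lambda>k. a \<le> k \<and> f k \<le> c" b] assms by auto
  have kb: "k \<le> b" unfolding k_def by (rule Least_le) (use assms in auto)
  have "f k \<ge> c"
  proof (cases "k = a")
    case False
    then obtain j where j: "k = Suc j" "a \<le> j" using k(1) by (cases k) auto
    have "\<not> f j \<le> c" using not_less_Least[of j "\<lambda>k. a \<le> k \<and> f k \<le> c"] j by (auto simp: k_def)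
    then show ?thesis using step[of j] j kb by auto
  qed (use assms in simp)
  then show ?thesis using k kb by (intro bexI[of _ k]) auto
qed

text \<open>All windows used below belong to points between \<open>T / 2\<close> and
  \<open>2 * T\<close>; this gives them the common half-length
  \<open>ln (ln (ln T)) + 1\<close>.\<close>

lemma lnlnln_le_double:
  "eventually (\<lambda>T::real. \<forall>x\<in>{T / 2..2 * T}. ln (ln (ln x)) \<le> ln (ln (ln T)) + 1) at_top"
proof -
  have "eventually (\<lambda>T::real. ln (ln (ln (2 * T))) \<le> ln (ln (ln T)) + 1) at_top"
    "eventually (\<lambda>T::real. ln (ln (T / 2)) > 0) at_top" "eventually (\<lambda>T::real. ln (T / 2) > 0) at_top"
    by real_asymp+
  then show ?thesis using eventually_gt_at_top[of 2]
  proof eventually_elim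
    case (elim T)
    show ?case
    proof
      fix x assume x: "x \<in> {T / 2..2 * T}"
      have 1: "ln (T / 2) \<le> ln x" "ln x \<le> ln (2 * T)" using x elim by auto
      then have "0 < ln x" using elim by linarith
      then have 2: "ln (ln (T / 2)) \<le> ln (ln x)" "ln (ln x) \<le> ln (ln (2 * T))" using 1 elim by (auto simp del: ln_mult_pos)
      have "ln (ln (ln x)) \<le> ln (ln (ln (2 * T)))" by (rule ln_mono[OF 2(2)]) (use 2 elim in linarith)
      then show "ln (ln (ln x)) \<le> ln (ln (ln T)) + 1" using elim by linarith
    qed
  qed
qed

context RH
begin

text \<open>Where \<open>arg_fluct u \<ge> \<bar>boundary_const\<bar>\<close> one has
  \<open>pi * counting u \<ge> theta u\<close>, and \<open>theta\<close> outgrows every linear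
  function. The definite description of \<open>zeta_ordinate\<close> has a value because of
  this.\<close>

lemma counting_unbounded: "\<exists>u. counting u \<ge> k"
proof -
  obtain R T0 where osc: "\<And>T. T \<ge> T0 \<Longrightarrow> \<exists>u. T - ln (ln (ln T)) \<le> u \<and> u \<le> T + R + ln (ln (ln T)) \<and> arg_fluct u \<ge> \<bar>boundary_const\<bar>"
    by (rule arg_fluct_oscillation[of "\<bar>boundary_const\<bar>"]) auto
  obtain U where U: "\<And>t. t \<ge> U \<Longrightarrow> theta t \<ge> (pi * real k) * t"
    using theta_linear_growth[of "pi * real k"] unfolding eventually_at_top_linorder by blast
  have "filterlim (\<lambda>T::real. T - ln (ln (ln T))) at_top at_top" by real_asymp
  then have "eventually (\<lambda>T::real. T - ln (ln (ln T)) \<ge> max U 1) at_top" unfolding filterlim_at_top by blast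
  then have "eventually (\<lambda>T::real. T - ln (ln (ln T)) \<ge> max U 1 \<and> T \<ge> T0) at_top"
    using eventually_ge_at_top[of T0] by eventually_elim auto
  then obtain T where T: "T - ln (ln (ln T)) \<ge> max U 1" "T \<ge> T0" using eventually_happens[of _ "at_top::real filter"] by auto
  obtain u where u: "u \<ge> T - ln (ln (ln T))" "arg_fluct u \<ge> \<bar>boundary_const\<bar>" using osc[OF T(2)] by blast
  have u1: "u \<ge> U" "u \<ge> 1" using u(1) T by auto
  have "pi * real k * 1 \<le> pi * real k * u" using u1 by (intro mult_left_mono) auto
  also have "\<dots> \<le> theta u" by (rule U) (rule u1)
  also have "\<dots> \<le> pi * real (counting u)" using u(2) unfolding arg_fluct_def by linarith
  finally have "real k \<le> real (counting u)" by simp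
  then show ?thesis by auto
qed

lemma zeta_ordinate_enumeration: "is_enumeration zeta_ordinate"
proof -
  have "zeta_ordinate = (THE \<gamma>. is_enumeration \<gamma>)"
    unfolding zeta_ordinate_def is_enumeration_def zmult_def by (rule refl)
  moreover have "\<exists>!\<gamma>. is_enumeration \<gamma>"
    using enumeration_exists[OF counting_unbounded] enumeration_unique[OF counting_unbounded] by blast
  ultimately show ?thesis using theI' by metis
qed

lemmas zeta_ordinate_le_iff = enumeration_le_iff[OF zeta_ordinate_enumeration]

lemma zeta_ordinate_mono: "1 \<le> n \<Longrightarrow> n \<le> k \<Longrightarrow> zeta_ordinate n \<le> zeta_ordinate k"
  using zeta_ordinate_enumeration mono_onD[of "{1..}" zeta_ordinate n k] by (simp add: is_enumeration_def)

lemma zeta_ordinate_at_top: "filterlim zeta_ordinate at_top sequentially"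
  unfolding filterlim_at_top
proof
  fix Z :: real
  show "eventually (\<lambda>n. Z \<le> zeta_ordinate n) sequentially"
    using eventually_gt_at_top[of "counting (max Z 1)"]
  proof eventually_elim
    case (elim n)
    have "max Z 1 > 0" by simp
    then have "\<not> zeta_ordinate n \<le> max Z 1" using zeta_ordinate_le_iff[of n "max Z 1"] elim by linarith
    then show ?case by linarith
  qed
qed

lemma Delta_eq: "eventually (\<lambda>n. Delta n = \<lceil>theta (zeta_ordinate n) / pi\<rceil> + 1 - int n) sequentially"
proof -
  have "eventually (\<lambda>n. zeta_ordinate n > max (max 0 (gram_point 0)) (max (gram_point 1) (gram_point 2))) sequentially"
    using zeta_ordinate_at_top unfolding filterlim_at_top_dense by blast
  then show ?thesis
  proof eventually_elim
    case (elim n)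
    then show ?case using gram_index_unique[of "zeta_ordinate n"] unfolding Delta_def gram_index_def by simp
  qed
qed

text \<open>Around \<open>T = zeta_ordinate N\<close> four windows carry alternating values of
  \<open>arg_fluct\<close>: high at \<open>a < T\<close>, low at \<open>u1 \<ge> T\<close>, high at
  \<open>u2\<close>, low at \<open>u3\<close>. The inner two produce \<open>n1\<close> and
  \<open>n2\<close>. The outer two serve the count: from a high to a low value, \<open>pi\<close>
  times the number of ordinates is at most the increase of \<open>theta\<close>, so the fluctuation
  costs nothing.\<close>

lemma Delta_oscillation:
  "eventually (\<lambda>N. \<exists>n1 n2. N < n1 \<and> n1 \<le> n2 \<and> Delta n1 \<ge> 3 \<and> Delta n2 \<le> - 3 \<and>
     pi * (real n2 - real N) \<le> 31 / 5 * ln (real N) * ln (ln (ln (real N)))) sequentially"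
proof -
  \<comment> \<open>The first summand compensates \<open>boundary_const\<close> in
    \<open>arg_fluct\<close>; the second puts \<open>counting\<close> and \<open>theta / pi\<close>
    ten apart, more than the 3 asked for.\<close>
  define V where "V = \<bar>boundary_const\<bar> + 10 * pi"
  have V0: "V \<ge> 0" by (simp add: V_def)
  obtain R T0 where R: "R \<ge> 0"
    and up: "\<And>T. T \<ge> T0 \<Longrightarrow> \<exists>u. T - ln (ln (ln T)) \<le> u \<and> u \<le> T + R + ln (ln (ln T)) \<and> arg_fluct u \<ge> V"
    and lo: "\<And>T. T \<ge> T0 \<Longrightarrow> \<exists>u. T - ln (ln (ln T)) \<le> u \<and> u \<le> T + R + ln (ln (ln T)) \<and> arg_fluct u \<le> - V"
    by (rule arg_fluct_oscillation[OF V0]) (rule that)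
  obtain C where C: "\<And>t. t \<ge> 1 \<Longrightarrow> \<bar>dtheta t - ln t / 2\<bar> \<le> C" by (rule dtheta_bounds) (rule that)
  obtain b where b: "dtheta b \<ge> 0" "b \<ge> 1" by (rule dtheta_eventually_nonneg)
  have mono: "theta s \<le> theta t" if "b \<le> s" "s \<le> t" for s t
    using theta_strict_mono_if[of b s t] b that by (cases "s = t") auto
  obtain g where g: "\<And>t. t \<ge> g \<Longrightarrow> theta t \<ge> (2 * pi) * t"
    using theta_linear_growth[of "2 * pi"] unfolding eventually_at_top_linorder by blast
  \<comment> \<open>In the fourth condition the first factor bounds the distance from
    \<open>a\<close> to \<open>u3\<close>, about four windows, and the second bounds
    \<open>dtheta\<close>. The leading term is \<open>4 * ln T * ln (ln (ln T))\<close>, so the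
    coefficient \<open>31 / 5\<close> leaves room for \<open>R\<close> and \<open>C\<close>.\<close>
  define P where "P T \<longleftrightarrow> (\<forall>x\<in>{T / 2..2 * T}. ln (ln (ln x)) \<le> ln (ln (ln T)) + 1) \<and>
     T - R - 2 * ln (ln (ln T)) - 3 \<ge> T / 2 \<and> T + 6 * ln (ln (ln T)) + 3 * R + 9 \<le> 2 * T \<and>
     (8 * ln (ln (ln T)) + 4 * R + 12) * (ln (2 * T) / 2 + C) \<le> 31 / 5 * ln T * ln (ln (ln T)) \<and>
     ln (ln (ln T)) \<ge> 1 \<and> ln (ln T) \<ge> 1 \<and> ln T \<ge> 1 \<and> T \<ge> 2 * max (max T0 b) (max g 1)" for T
  have "eventually (\<lambda>T. T - R - 2 * ln (ln (ln T)) - 3 \<ge> T / 2) at_top"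
    "eventually (\<lambda>T. T + 6 * ln (ln (ln T)) + 3 * R + 9 \<le> 2 * T) at_top"
    "eventually (\<lambda>T. (8 * ln (ln (ln T)) + 4 * R + 12) * (ln (2 * T) / 2 + C) \<le> 31 / 5 * ln T * ln (ln (ln T))) at_top"
    "eventually (\<lambda>T::real. ln (ln (ln T)) \<ge> 1) at_top" "eventually (\<lambda>T::real. ln (ln T) \<ge> 1) at_top"
    "eventually (\<lambda>T::real. ln T \<ge> 1) at_top"
    by real_asymp+
  then have "eventually P at_top"
    using lnlnln_le_double eventually_ge_at_top[of "2 * max (max T0 b) (max g 1)"]
    unfolding P_def by eventually_elim auto
  then have "eventually (\<lambda>n. P (zeta_ordinate n)) sequentially"
    using zeta_ordinate_at_top by (rule eventually_compose_filterlim)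
  moreover have "eventually (\<lambda>n. \<forall>k\<ge>n. Delta k = \<lceil>theta (zeta_ordinate k) / pi\<rceil> + 1 - int k) sequentially"
    using Delta_eq by (rule eventually_all_ge_at_top)
  ultimately show ?thesis using eventually_ge_at_top[of 1]
  proof eventually_elim
    case (elim N)
    define T where "T = zeta_ordinate N"
    define L where "L = ln (ln (ln T))"
    have win: "\<And>x. T / 2 \<le> x \<Longrightarrow> x \<le> 2 * T \<Longrightarrow> ln (ln (ln x)) \<le> L + 1"
      and a1: "T - R - 2 * L - 3 \<ge> T / 2" and a2: "T + 6 * L + 3 * R + 9 \<le> 2 * T"
      and a3: "(8 * L + 4 * R + 12) * (ln (2 * T) / 2 + C) \<le> 31 / 5 * ln T * L"
      and a4: "L \<ge> 1" "ln (ln T) \<ge> 1" "ln T \<ge> 1" and a5: "T / 2 \<ge> T0" "T / 2 \<ge> b" "T / 2 \<ge> g" "T / 2 \<ge> 1"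
      using elim(1) unfolding P_def T_def[symmetric] L_def[symmetric] by auto
    have hi: "\<exists>u. x - L - 1 \<le> u \<and> u \<le> x + R + L + 1 \<and> arg_fluct u \<ge> V" if "T / 2 \<le> x" "x \<le> 2 * T" for x
    proof -
      have "T0 \<le> x" using a5 that by linarith
      then obtain u where "x - ln (ln (ln x)) \<le> u" "u \<le> x + R + ln (ln (ln x))" "arg_fluct u \<ge> V" using up by blast
      then show ?thesis using win[OF that] by (intro exI[of _ u]) linarith
    qed
    have lw: "\<exists>u. x - L - 1 \<le> u \<and> u \<le> x + R + L + 1 \<and> arg_fluct u \<le> - V" if "T / 2 \<le> x" "x \<le> 2 * T" for x
    proof -
      have "T0 \<le> x" using a5 that by linarith
      then obtain u where "x - ln (ln (ln x)) \<le> u" "u \<le> x + R + ln (ln (ln x))" "arg_fluct u \<le> - V" using lo by blast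
      then show ?thesis using win[OF that] by (intro exI[of _ u]) linarith
    qed
    \<comment> \<open>The centre is placed so that the window ends at \<open>T - 1\<close>; the next
      three windows begin at \<open>T\<close> and follow each other with gaps of at least 1.\<close>
    obtain a where a: "T - R - 2 * L - 3 \<le> a" "a \<le> T - 1" "arg_fluct a \<ge> V"
      using hi[of "T - R - L - 2"] a1 a4 a5 R by (auto simp: algebra_simps)
    obtain u1 where u1: "T \<le> u1" "u1 \<le> T + 2 * L + R + 2" "arg_fluct u1 \<le> - V"
      using lw[of "T + L + 1"] a2 a4 a5 R by (auto simp: algebra_simps)
    obtain u2 where u2: "T + 2 * L + R + 3 \<le> u2" "u2 \<le> T + 4 * L + 2 * R + 5" "arg_fluct u2 \<ge> V"
      using hi[of "T + 3 * L + R + 4"] a2 a4 a5 R by (auto simp: algebra_simps)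
    obtain u3 where u3: "T + 4 * L + 2 * R + 7 \<le> u3" "u3 \<le> T + 6 * L + 3 * R + 9" "arg_fluct u3 \<le> - V"
      using lw[of "T + 5 * L + 2 * R + 8"] a2 a4 a5 R by (auto simp: algebra_simps)
    have ap: "a \<ge> b" "a \<ge> g" "a \<ge> T / 2" "a \<ge> 1" using a a1 a5 by auto
    have aN: "counting a < N" using zeta_ordinate_le_iff[of N a] elim(3) a ap by (simp add: T_def[symmetric] not_le[symmetric])
    have Nu1: "N \<le> counting u1" using zeta_ordinate_le_iff[of N u1] elim(3) u1 a5 by (simp add: T_def[symmetric])
    have gap: "\<bar>boundary_const\<bar> + 10 * pi = V" by (simp add: V_def)
    \<comment> \<open>Growth of \<open>theta\<close> with slope \<open>2 * pi\<close> makes the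
      ordinates dense enough; at the end \<open>ln N\<close> may replace
      \<open>ln T\<close>.\<close>
    have NT: "T \<le> real N"
    proof -
      have "(2 * pi) * (T / 2) \<le> (2 * pi) * a" using ap by (intro mult_left_mono) auto
      also have "\<dots> \<le> theta a" by (rule g) (rule ap)
      also have "\<dots> \<le> pi * real (counting a)" using a(3) gap pi_gt_zero unfolding arg_fluct_def by linarith
      finally have "T \<le> real (counting a)" by simp
      then show ?thesis using aN by simp
    qed
    have th12: "theta u1 \<le> theta u2" using u1 u2 a5 by (intro mono) auto
    \<comment> \<open>The first index with ordinate beyond \<open>u1\<close> and, next, the last one
      with ordinate at most \<open>u2\<close>.\<close>
    define n1 where "n1 = Suc (counting u1)"
    define n2 where "n2 = counting u2"
    \<comment> \<open>With no ordinate between \<open>u1\<close> and \<open>u2\<close>,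
      \<open>arg_fluct\<close> could not rise from one to the other, since \<open>theta\<close> does
      not decrease there.\<close>
    have n12: "n1 \<le> n2"
    proof (rule ccontr)
      assume "\<not> n1 \<le> n2"
      then have "pi * real (counting u2) \<le> pi * real (counting u1)" by (simp add: n1_def n2_def)
      then show False using u1(3) u2(3) th12 gap pi_gt_zero unfolding arg_fluct_def by linarith
    qed
    have Nn1: "N < n1" using Nu1 by (simp add: n1_def)
    have Delta: "Delta k = \<lceil>theta (zeta_ordinate k) / pi\<rceil> + 1 - int k" if "k \<ge> N" for k using elim(2) that by blast
    have D1: "Delta n1 \<ge> 3"
    proof -
      have "u1 < zeta_ordinate n1" using zeta_ordinate_le_iff[of n1 u1] u1 a5 by (auto simp: n1_def not_le[symmetric])
      then have "theta u1 \<le> theta (zeta_ordinate n1)" using u1 a5 by (intro mono) auto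
      moreover have "pi * (real (counting u1) + 10) \<le> theta u1"
        using u1(3) gap unfolding arg_fluct_def by (simp add: distrib_left abs_if split: if_splits)
      ultimately have "pi * (real (counting u1) + 10) \<le> theta (zeta_ordinate n1)" by linarith
      then have "real (counting u1) + 10 \<le> theta (zeta_ordinate n1) / pi" by (simp add: le_divide_eq mult.commute)
      then have "int (counting u1) + 10 \<le> \<lceil>theta (zeta_ordinate n1) / pi\<rceil>" by linarith
      then show ?thesis using Delta[of n1] Nn1 by (simp add: n1_def)
    qed
    have D2: "Delta n2 \<le> - 3"
    proof -
      have N2: "N \<le> n2" using n12 Nn1 by simp
      have "zeta_ordinate n2 \<le> u2" using zeta_ordinate_le_iff[of n2 u2] u2 a5 a4 R N2 elim(3) by (auto simp: n2_def)
      moreover have "T \<le> zeta_ordinate n2" unfolding T_def using elim(3) N2 by (rule zeta_ordinate_mono)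
      ultimately have "theta (zeta_ordinate n2) \<le> theta u2" using a5 by (intro mono) auto
      moreover have "theta u2 \<le> pi * (real n2 - 10)"
        using u2(3) gap unfolding arg_fluct_def n2_def by (simp add: right_diff_distrib abs_if split: if_splits)
      ultimately have "theta (zeta_ordinate n2) \<le> pi * (real n2 - 10)" by linarith
      then have "theta (zeta_ordinate n2) / pi \<le> real n2 - 10" by (simp add: divide_le_eq mult.commute)
      then have "\<lceil>theta (zeta_ordinate n2) / pi\<rceil> \<le> int n2 - 10" by linarith
      then show ?thesis using Delta[OF N2] by simp
    qed
    have "counting u2 \<le> counting u3" using u2 u3 by (intro counting_mono) auto
    then have "pi * (real n2 - real N) \<le> pi * (real (counting u3) - real (counting a))"
      using aN by (intro mult_left_mono) (auto simp: n2_def)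
    also have "\<dots> \<le> theta u3 - theta a"
      using a(3) u3(3) V0 unfolding arg_fluct_def by (simp add: right_diff_distrib)
    also have "\<dots> \<le> (8 * L + 4 * R + 12) * (ln (2 * T) / 2 + C)"
    proof -
      have "a < u3" using a u3 a4 R by linarith
      then obtain x where x: "a < x" "x < u3" "theta u3 - theta a = (u3 - a) * dtheta x" by (rule theta_diff_MVT)
      have "x \<le> 2 * T" using x u3 a2 by linarith
      then have "ln x \<le> ln (2 * T)" using x ap by (intro ln_mono) auto
      then have "dtheta x \<le> ln (2 * T) / 2 + C" using C[of x] x ap by (auto simp: abs_le_iff)
      moreover have "dtheta x \<ge> 0" using dtheta_strict_mono[of b x] b x ap by linarith
      ultimately have "(u3 - a) * dtheta x \<le> (8 * L + 4 * R + 12) * (ln (2 * T) / 2 + C)"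
        using a u3 \<open>a < u3\<close> a4 R by (intro mult_mono) linarith+
      then show ?thesis using x(3) by simp
    qed
    also have "\<dots> \<le> 31 / 5 * ln T * L" by (rule a3)
    also have "\<dots> \<le> 31 / 5 * ln (real N) * ln (ln (ln (real N)))"
    proof -
      have 1: "ln T \<le> ln (real N)" using NT a5 by (intro ln_mono) auto
      have 2: "ln (ln T) \<le> ln (ln (real N))" by (rule ln_mono[OF 1]) (use a4 in linarith)
      have "L \<le> ln (ln (ln (real N)))" unfolding L_def by (rule ln_mono[OF 2]) (use a4 in linarith)
      then show ?thesis using 1 a4 by (intro mult_mono) auto
    qed
    finally have "pi * (real n2 - real N) \<le> 31 / 5 * ln (real N) * ln (ln (ln (real N)))" .
    then show ?case using Nn1 n12 D1 D2 by blast
  qed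
qed

text \<open>The ceiling of \<open>theta / pi\<close> does not decrease along the ordinates, so only
  the growing index lowers the displacement, by one.\<close>

lemma Delta_step: "eventually (\<lambda>n. Delta (Suc n) \<ge> Delta n - 1) sequentially"
proof -
  obtain b where b: "dtheta b \<ge> 0" "b \<ge> 1" by (rule dtheta_eventually_nonneg)
  have "eventually (\<lambda>n. zeta_ordinate n \<ge> b) sequentially"
    using zeta_ordinate_at_top unfolding filterlim_at_top by blast
  moreover have "eventually (\<lambda>n. Delta (Suc n) = \<lceil>theta (zeta_ordinate (Suc n)) / pi\<rceil> + 1 - int (Suc n)) sequentially"
    using Delta_eq by (subst eventually_sequentially_Suc)
  ultimately show ?thesis using Delta_eq eventually_ge_at_top[of 1]
  proof eventually_elim
    case (elim n)
    have "zeta_ordinate n \<le> zeta_ordinate (Suc n)" using elim by (intro zeta_ordinate_mono) auto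
    then have "theta (zeta_ordinate n) \<le> theta (zeta_ordinate (Suc n))"
      using theta_strict_mono_if[of b "zeta_ordinate n" "zeta_ordinate (Suc n)"] b elim
      by (cases "zeta_ordinate n = zeta_ordinate (Suc n)") auto
    then have "\<lceil>theta (zeta_ordinate n) / pi\<rceil> \<le> \<lceil>theta (zeta_ordinate (Suc n)) / pi\<rceil>"
      by (intro ceiling_mono divide_right_mono) auto
    then show ?case using elim by simp
  qed
qed

end

theorem theorem7:
  assumes "Riemann_hypothesis"
  shows "\<exists>(N\<^sub>0 :: nat) (c\<^sub>0 :: real). \<forall>N :: nat. N \<ge> N\<^sub>0 \<longrightarrow>
    (let M = \<lfloor>31 / (5 * pi) * (ln (real N) + c\<^sub>0) * ln (ln (ln (real N)))\<rfloor> in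
      (\<exists>n :: nat. int n \<in> {int N <.. int N + M} \<and> Delta n = 3) \<and>
      (\<exists>m :: nat. int m \<in> {int N <.. int N + M} \<and> Delta m = -3))"
proof -
  interpret RH by unfold_locales (rule assms)
  have "eventually (\<lambda>N. (\<forall>k\<ge>N. Delta (Suc k) \<ge> Delta k - 1) \<and> (\<exists>n1 n2. N < n1 \<and> n1 \<le> n2 \<and> Delta n1 \<ge> 3 \<and> Delta n2 \<le> - 3 \<and>
     pi * (real n2 - real N) \<le> 31 / 5 * ln (real N) * ln (ln (ln (real N))))) sequentially"
    using eventually_all_ge_at_top[OF Delta_step] Delta_oscillation by eventually_elim auto
  then obtain N0 where N0: "\<And>N. N \<ge> N0 \<Longrightarrow> (\<forall>k\<ge>N. Delta (Suc k) \<ge> Delta k - 1) \<and> (\<exists>n1 n2. N < n1 \<and> n1 \<le> n2 \<and> Delta n1 \<ge> 3 \<and> Delta n2 \<le> - 3 \<and>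
     pi * (real n2 - real N) \<le> 31 / 5 * ln (real N) * ln (ln (ln (real N))))"
    unfolding eventually_sequentially by blast
  show ?thesis
  \<comment> \<open>\<open>c\<^sub>0 = 0\<close> works, because the margin in the coefficient has
    already absorbed all lower-order terms.\<close>
  proof (intro exI[of _ N0] exI[of _ "0::real"] allI impI)
    fix N assume "N \<ge> N0"
    then obtain n1 n2 where step: "\<And>k. k \<ge> N \<Longrightarrow> Delta (Suc k) \<ge> Delta k - 1"
      and n: "N < n1" "n1 \<le> n2" "Delta n1 \<ge> 3" "Delta n2 \<le> - 3"
      and M: "pi * (real n2 - real N) \<le> 31 / 5 * ln (real N) * ln (ln (ln (real N)))"
      using N0 by blast
    define M where "M = \<lfloor>31 / (5 * pi) * (ln (real N) + 0) * ln (ln (ln (real N)))\<rfloor>"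
    have "real n2 - real N \<le> 31 / (5 * pi) * (ln (real N) + 0) * ln (ln (ln (real N)))"
      using M by (simp add: field_simps)
    then have "int n2 - int N \<le> M" unfolding M_def le_floor_iff by simp
    then have int: "int k \<in> {int N <.. int N + M}" if "k \<in> {n1..n2}" for k using that n by auto
    have "\<exists>k\<in>{n1..n2}. Delta k = c" if "c = 3 \<or> c = - 3" for c
      using n that step by (intro discrete_intermediate_value) auto
    then show "let M = \<lfloor>31 / (5 * pi) * (ln (real N) + 0) * ln (ln (ln (real N)))\<rfloor> in
      (\<exists>n :: nat. int n \<in> {int N <.. int N + M} \<and> Delta n = 3) \<and>
      (\<exists>m :: nat. int m \<in> {int N <.. int N + M} \<and> Delta m = -3)"
      unfolding Let_def M_def[symmetric] using int by blast
  qed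
qed

end
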